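(* Let $k$ be a field of characteristic $0$, let $S\subset M$ be an affine monoid spanning the lattice $M$ as an abelian group, let $X=\operatorname{Spec} k[S]$ be the corresponding (not necessarily normal) affine toric variety, and let $E\subset S$ be a finite generating set of $S$. For $u\in M$ put $E^u_S=\{w\in E\mid u+w\notin S\}$. Then for every $u\in M$ the homogeneous component of degree $u$ of the space of first-order deformations of $X$ is $$(T^1_X)_u\;\cong\;\Bigl(L(E^u_S)\big/\langle q\in L(E^u_S)\mid \bar q+u\notin S\rangle\Bigr)^*\otimes k ,$$ where $(-)^*=\operatorname{Hom}_{\mathbb Z}(-,\mathbb Z)$.
   Context: An affine monoid is a finitely generated submonoid $S$ of a lattice (free abelian group of finite rank) $M$. The monoid algebra $k[S]$ has $k$-basis $\chi^w$, $w\in S$, and is $M$-graded by $\deg\chi^w=w$. Relations: for a finite set $F=\{w_1,\dots,w_r\}\subset M$ let $\pi:\mathbb Z^r\to M$, $e_i\mapsto w_i$, and $L(F)=\ker\pi$, the group of integral linear relations among the elements of $F$. Every $q\in L(F)$ is written uniquely as $q=q^+-q^-$ with $q^+,q^-\in\mathbb Z_{\ge0}^r$ of disjoint supports, and $\bar q:=\pi(q^+)=\pi(q^-)\in M$. $\langle\cdot\rangle$ denotes the generated subgroup. $T^1$: write $A=k[S]=R/I$ with $R=k[z_1,\dots,z_r]$, $z_i\mapsto\chi^{w_i}$ for a finite generating set $\{w_1,\dots,w_r\}$ of $S$. Then $T^1_X=\operatorname{Hom}_A(I/I^2,A)/D$, where $D$ is the $A$-submodule generated by the homomorphisms $\partial_i:f\mapsto\partial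 f/\partial z_i$. This is independent of the presentation up to isomorphism and is naturally $M$-graded (with $\deg z_i=w_i$; a homomorphism has degree $u$ if it maps elements of degree $d$ to elements of degree $d+u$); $(T^1_X)_u$ is the component of degree $u$. *)

theory Defs
  imports
    "HOL.Hull"
    "HOL-Library.Poly_Mapping"
    "HOL-Algebra.Module"
    "HOL-Algebra.Ideal_Product"
    "HOL-Algebra.Generated_Groups"
    "HOL-Algebra.Elementary_Groups"
    "HOL-Algebra.Free_Abelian_Groups"
begin

section \<open>Modules\<close>

text \<open>Module records inherit a multiplication and a unit from ring records; these two fields play
  no role for modules and are left undefined below.\<close>

definition mk_module :: "'b set \<Rightarrow> 'b \<Rightarrow> ('b \<Rightarrow> 'b \<Rightarrow> 'b) \<Rightarrow> ('a \<Rightarrow> 'b \<Rightarrow> 'b) \<Rightarrow> ('a, 'b) module"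
  where "mk_module C z a s =
    \<lparr>carrier = C, monoid.mult = undefined, one = undefined, ring.zero = z, add = a, smult = s\<rparr>"

definition regular_module :: "'a ring \<Rightarrow> ('a, 'a) module"
  where "regular_module A = mk_module (carrier A) \<zero>\<^bsub>A\<^esub> (add A) (monoid.mult A)"

definition quotient_module :: "('a, 'b) module \<Rightarrow> 'b set \<Rightarrow> ('a, 'b set) module"
  where "quotient_module M N =
    mk_module (a_rcosets\<^bsub>M\<^esub> N) N (set_add M) (\<lambda>a X. \<Union>x\<in>X. N +>\<^bsub>M\<^esub> (a \<odot>\<^bsub>M\<^esub> x))"

definition linear_maps :: "'a ring \<Rightarrow> ('a, 'b) module \<Rightarrow> ('a, 'c) module \<Rightarrow> ('b \<Rightarrow> 'c) set"
  where "linear_maps A M N =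
    {h \<in> hom (add_monoid M) (add_monoid N).
      \<forall>a \<in> carrier A. \<forall>x \<in> carrier M. h (a \<odot>\<^bsub>M\<^esub> x) = a \<odot>\<^bsub>N\<^esub> h x}"

text \<open>Maps are made extensional, so that a map is determined by its values on the carrier.\<close>

definition Hom_module :: "'a ring \<Rightarrow> ('a, 'b) module \<Rightarrow> ('a, 'c) module \<Rightarrow> ('a, 'b \<Rightarrow> 'c) module"
  where "Hom_module A M N =
    mk_module (linear_maps A M N \<inter> extensional (carrier M))
      (\<lambda>x\<in>carrier M. \<zero>\<^bsub>N\<^esub>)
      (\<lambda>f g. \<lambda>x\<in>carrier M. f x \<oplus>\<^bsub>N\<^esub> g x)
      (\<lambda>a f. \<lambda>x\<in>carrier M. a \<odot>\<^bsub>N\<^esub> f x)"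

definition module_isomorphic :: "'a ring \<Rightarrow> ('a, 'b) module \<Rightarrow> ('a, 'c) module \<Rightarrow> bool"
  where "module_isomorphic A M N \<longleftrightarrow>
    (\<exists>h \<in> linear_maps A M N. bij_betw h (carrier M) (carrier N))"


section \<open>Duals and extension of scalars\<close>

definition int_dual :: "'a monoid \<Rightarrow> ('a \<Rightarrow> int) monoid"
  where "int_dual G =
    \<lparr>carrier = hom G integer_group \<inter> extensional (carrier G),
     monoid.mult = (\<lambda>f g. \<lambda>x\<in>carrier G. f x + g x),
     one = (\<lambda>x\<in>carrier G. 0)\<rparr>"

text \<open>The tensor product over the integers of an abelian group \<open>G\<close> and the additive group of a
  field: the free abelian group on the pairs \<open>(x, c)\<close> modulo the subgroup generated by the
  biadditivity relations. Scalars act by \<open>c (x \<otimes> d) = x \<otimes> c d\<close>.\<close>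

definition tensor_relations :: "'a monoid \<Rightarrow> (('a \<times> 'k::field) \<Rightarrow>\<^sub>0 int) set"
  where "tensor_relations G =
    {frag_of (x \<otimes>\<^bsub>G\<^esub> y, c) - frag_of (x, c) - frag_of (y, c) | x y c.
        x \<in> carrier G \<and> y \<in> carrier G} \<union>
    {frag_of (x, c + d) - frag_of (x, c) - frag_of (x, d) | x c d. x \<in> carrier G}"

definition tensor_field :: "'a monoid \<Rightarrow> ('k::field, (('a \<times> 'k) \<Rightarrow>\<^sub>0 int) set) module"
  where "tensor_field G =
    (let F = free_Abelian_group (carrier G \<times> UNIV);
         N = generate F (tensor_relations G)
     in mk_module (carrier (F Mod N)) \<one>\<^bsub>F Mod N\<^esub> (monoid.mult (F Mod N))
          (\<lambda>c X. \<Union>x\<in>X. N #>\<^bsub>F\<^esub> frag_extend (\<lambda>(g, d). frag_of (g, c * d)) x))"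


section \<open>Affine monoids and relations\<close>

text \<open>The ambient lattice is a whole type \<open>'m\<close>.\<close>

definition additive_group :: "'m::ab_group_add monoid"
  where "additive_group = \<lparr>carrier = UNIV, monoid.mult = (+), one = 0\<rparr>"

definition is_lattice :: "'m monoid \<Rightarrow> bool"
  where "is_lattice M \<longleftrightarrow> (\<exists>n::nat. M \<cong> free_Abelian_group {..<n})"

definition monoid_span :: "'m::ab_group_add set \<Rightarrow> 'm set"
  where "monoid_span E = (\<lambda>H. submonoid H additive_group) hull E"

definition affine_monoid :: "'m::ab_group_add set \<Rightarrow> bool"
  where "affine_monoid S \<longleftrightarrow>
    is_lattice (additive_group :: 'm monoid) \<and> submonoid S additive_group \<and>
    (\<exists>F. finite F \<and> monoid_span F = S)"

text \<open>Vectors in \<open>\<int>\<^sup>r\<close> are indexed by the elements of the set \<open>F = {w\<^sub>1, \<dots>, w\<^sub>r}\<close> itself: they are the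
  elements of the free abelian group on \<open>F\<close>. The map \<open>\<pi>\<close> is \<^term>\<open>lin_comb\<close>.\<close>

definition lin_comb :: "('m::ab_group_add \<Rightarrow>\<^sub>0 int) \<Rightarrow> 'm"
  where "lin_comb q =
    (\<Sum>w\<in>Poly_Mapping.keys q. w [^]\<^bsub>additive_group\<^esub> Poly_Mapping.lookup q w)"

definition relation_group :: "'m::ab_group_add set \<Rightarrow> ('m \<Rightarrow>\<^sub>0 int) monoid"
  where "relation_group F =
    (free_Abelian_group F)
      \<lparr>carrier := kernel (free_Abelian_group F) additive_group lin_comb\<rparr>"

definition pos_part :: "('m \<Rightarrow>\<^sub>0 int) \<Rightarrow> 'm \<Rightarrow>\<^sub>0 int"
  where "pos_part q = Poly_Mapping.map (\<lambda>n. max n 0) q"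

definition relation_degree :: "('m::ab_group_add \<Rightarrow>\<^sub>0 int) \<Rightarrow> 'm"
  where "relation_degree q = lin_comb (pos_part q)"

definition E_set :: "'m::ab_group_add set \<Rightarrow> 'm set \<Rightarrow> 'm \<Rightarrow> 'm set"
  where "E_set E S u = {w \<in> E. u + w \<notin> S}"

definition relation_quotient :: "'m::ab_group_add set \<Rightarrow> 'm set \<Rightarrow> 'm \<Rightarrow> ('m \<Rightarrow>\<^sub>0 int) set monoid"
  where "relation_quotient E S u =
    (let L = relation_group (E_set E S u)
     in L Mod generate L {q \<in> carrier L. relation_degree q + u \<notin> S})"


section \<open>Presentations of monoid algebras\<close>

definition ring_on :: "'a::comm_ring_1 set \<Rightarrow> 'a ring"
  where "ring_on C = \<lparr>carrier = C, monoid.mult = (*), one = 1, ring.zero = 0, add = (+)\<rparr>"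

text \<open>In \<^typ>\<open>'m \<Rightarrow>\<^sub>0 'k\<close> the basis element \<open>\<chi>\<^sup>w\<close> is \<open>Poly_Mapping.single w 1\<close>, and the product is
  convolution.\<close>

definition monoid_algebra :: "'m::ab_group_add set \<Rightarrow> ('m \<Rightarrow>\<^sub>0 'k::field) ring"
  where "monoid_algebra S = ring_on {a. Poly_Mapping.keys a \<subseteq> S}"

text \<open>Polynomials in variables \<open>z\<^sub>w\<close> for \<open>w \<in> E\<close>; a monomial is its exponent vector \<^typ>\<open>'m \<Rightarrow>\<^sub>0 nat\<close>.\<close>

definition poly_ring :: "'m set \<Rightarrow> (('m \<Rightarrow>\<^sub>0 nat) \<Rightarrow>\<^sub>0 'k::field) ring"
  where "poly_ring E = ring_on {f. \<forall>m\<in>Poly_Mapping.keys f. Poly_Mapping.keys m \<subseteq> E}"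

text \<open>The \<open>k\<close>-algebra homomorphism with \<open>z\<^sub>w \<mapsto> \<chi>\<^sup>w\<close>.\<close>

definition presentation :: "(('m::ab_group_add \<Rightarrow>\<^sub>0 nat) \<Rightarrow>\<^sub>0 'k::field) \<Rightarrow> 'm \<Rightarrow>\<^sub>0 'k"
  where "presentation f =
    (\<Sum>m\<in>Poly_Mapping.keys f. Poly_Mapping.single 0 (Poly_Mapping.lookup f m) *
       (\<Prod>w\<in>Poly_Mapping.keys m. Poly_Mapping.single w 1 ^ Poly_Mapping.lookup m w))"

definition toric_ideal :: "'m::ab_group_add set \<Rightarrow> 'm set \<Rightarrow> (('m \<Rightarrow>\<^sub>0 nat) \<Rightarrow>\<^sub>0 'k::field) set"
  where "toric_ideal E S = a_kernel (poly_ring E) (monoid_algebra S) presentation"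

definition square_ideal :: "'m::ab_group_add set \<Rightarrow> 'm set \<Rightarrow> (('m \<Rightarrow>\<^sub>0 nat) \<Rightarrow>\<^sub>0 'k::field) set"
  where "square_ideal E S = ideal_prod (poly_ring E) (toric_ideal E S) (toric_ideal E S)"

text \<open>The module \<open>I/I\<^sup>2\<close> over \<open>A = R/I\<close>: an element of \<open>A\<close> acts through any of its preimages in \<open>R\<close>.\<close>

definition conormal_module ::
    "'m::ab_group_add set \<Rightarrow> 'm set \<Rightarrow> ('m \<Rightarrow>\<^sub>0 'k::field, (('m \<Rightarrow>\<^sub>0 nat) \<Rightarrow>\<^sub>0 'k) set) module"
  where "conormal_module E S =
    (let R = poly_ring E; J = square_ideal E S
     in mk_module ((\<lambda>f. J +>\<^bsub>R\<^esub> f) ` toric_ideal E S) J (set_add R)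
          (\<lambda>a X. \<Union>r\<in>{r \<in> carrier R. presentation r = a}. \<Union>x\<in>X. J +>\<^bsub>R\<^esub> (r \<otimes>\<^bsub>R\<^esub> x)))"


section \<open>First-order deformations\<close>

definition normal_module ::
    "'m::ab_group_add set \<Rightarrow> 'm set \<Rightarrow>
     ('m \<Rightarrow>\<^sub>0 'k::field, (('m \<Rightarrow>\<^sub>0 nat) \<Rightarrow>\<^sub>0 'k) set \<Rightarrow> 'm \<Rightarrow>\<^sub>0 'k) module"
  where "normal_module E S =
    Hom_module (monoid_algebra S) (conormal_module E S) (regular_module (monoid_algebra S))"

text \<open>Where the truncated subtraction on exponents is not a true one, the coefficient is zero.\<close>

definition partial_derivative ::
    "'m \<Rightarrow> (('m \<Rightarrow>\<^sub>0 nat) \<Rightarrow>\<^sub>0 'k::field) \<Rightarrow> (('m \<Rightarrow>\<^sub>0 nat) \<Rightarrow>\<^sub>0 'k)"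
  where "partial_derivative w f =
    (\<Sum>m\<in>Poly_Mapping.keys f. Poly_Mapping.single (m - Poly_Mapping.single w 1)
       (of_nat (Poly_Mapping.lookup m w) * Poly_Mapping.lookup f m))"

text \<open>The derivative is constant on each coset \<open>X\<close> of \<open>I\<^sup>2\<close> in \<open>I\<close> once it is mapped to \<open>A\<close>.\<close>

definition derivative_hom ::
    "'m::ab_group_add set \<Rightarrow> 'm set \<Rightarrow> 'm \<Rightarrow> (('m \<Rightarrow>\<^sub>0 nat) \<Rightarrow>\<^sub>0 'k::field) set \<Rightarrow> 'm \<Rightarrow>\<^sub>0 'k"
  where "derivative_hom E S w =
    (\<lambda>X\<in>carrier (conormal_module E S). the_elem ((\<lambda>f. presentation (partial_derivative w f)) ` X))"

definition derivative_submodule ::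
    "'m::ab_group_add set \<Rightarrow> 'm set \<Rightarrow> ((('m \<Rightarrow>\<^sub>0 nat) \<Rightarrow>\<^sub>0 'k::field) set \<Rightarrow> 'm \<Rightarrow>\<^sub>0 'k) set"
  where "derivative_submodule E S =
    (\<lambda>H. submodule H (monoid_algebra S) (normal_module E S)) hull (derivative_hom E S ` E)"

definition T1 ::
    "'m::ab_group_add set \<Rightarrow> 'm set \<Rightarrow>
     ('m \<Rightarrow>\<^sub>0 'k::field, ((('m \<Rightarrow>\<^sub>0 nat) \<Rightarrow>\<^sub>0 'k) set \<Rightarrow> 'm \<Rightarrow>\<^sub>0 'k) set) module"
  where "T1 E S = quotient_module (normal_module E S) (derivative_submodule E S)"


subsection \<open>Gradings\<close>

definition monomial_degree :: "('m::ab_group_add \<Rightarrow>\<^sub>0 nat) \<Rightarrow> 'm"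
  where "monomial_degree m =
    (\<Sum>w\<in>Poly_Mapping.keys m. w [^]\<^bsub>additive_group\<^esub> Poly_Mapping.lookup m w)"

definition conormal_component ::
    "'m::ab_group_add set \<Rightarrow> 'm set \<Rightarrow> 'm \<Rightarrow> (('m \<Rightarrow>\<^sub>0 nat) \<Rightarrow>\<^sub>0 'k::field) set set"
  where "conormal_component E S d =
    {square_ideal E S +>\<^bsub>poly_ring E\<^esub> f | f.
       f \<in> toric_ideal E S \<and> (\<forall>m\<in>Poly_Mapping.keys f. monomial_degree m = d)}"

definition normal_component ::
    "'m::ab_group_add set \<Rightarrow> 'm set \<Rightarrow> 'm \<Rightarrow>
     ((('m \<Rightarrow>\<^sub>0 nat) \<Rightarrow>\<^sub>0 'k::field) set \<Rightarrow> 'm \<Rightarrow>\<^sub>0 'k) set"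
  where "normal_component E S u =
    {h \<in> carrier (normal_module E S).
       \<forall>d. \<forall>X \<in> conormal_component E S d. Poly_Mapping.keys (h X) \<subseteq> {d + u}}"

text \<open>The classes of the homomorphisms of degree \<open>u\<close>, as a vector space over \<open>k \<subseteq> A\<close>.\<close>

definition T1_component ::
    "'m::ab_group_add set \<Rightarrow> 'm set \<Rightarrow> 'm \<Rightarrow>
     ('k::field, ((('m \<Rightarrow>\<^sub>0 nat) \<Rightarrow>\<^sub>0 'k) set \<Rightarrow> 'm \<Rightarrow>\<^sub>0 'k) set) module"
  where "T1_component E S u =
    mk_module
      ((\<lambda>h. derivative_submodule E S +>\<^bsub>normal_module E S\<^esub> h) ` normal_component E S u)
      \<zero>\<^bsub>T1 E S\<^esub> (add (T1 E S)) (\<lambda>c x. Poly_Mapping.single 0 c \<odot>\<^bsub>T1 E S\<^esub> x)"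

end

theory Submission
  imports Defs
begin

text \<open>Both sides are compared with the space of functionals
  \<open>V\<^sub>F = Hom (L(F\<^sup>u) / \<langle>q | q' + u \<notin> S\<rangle>, k)\<close>, where \<open>F\<close> is a finite generating set of \<open>S\<close>,
  \<open>F\<^sup>u\<close> consists of the \<open>w \<in> F\<close> with \<open>u + w \<notin> S\<close>, and \<open>q'\<close> is the common degree of the two parts
  of \<open>q\<close>. Relations with \<open>q' + u \<notin> S\<close> are called obstructed. There are three steps.

  Step 1: \<open>(T\<^sup>1)\<^sub>u \<cong> V\<^sub>G\<close>. The toric ideal is spanned by the binomials \<open>z\<^sup>a - z\<^sup>b\<close> with \<open>deg a = deg b\<close>.
  A homomorphism \<open>h\<close> of degree \<open>u\<close> from \<open>I/I\<^sup>2\<close> to \<open>k[S]\<close> maps such a binomial to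
  \<open>\<psi>(a - b) \<chi>\<^bsup>deg a + u\<^esup>\<close>. Linearity over the monomials makes the coefficient depend on \<open>a - b\<close> only
  and makes it additive; it vanishes when \<open>deg a + u \<notin> S\<close>. So \<open>h\<close> is an additive map \<open>\<psi>\<close> on \<open>L(G)\<close>
  that kills the obstructed relations. Every additive map on \<open>L(G)\<close> extends to a linear form
  \<open>c\<close> on \<open>\<int>\<^sup>G\<close>, because \<open>k\<close> has characteristic 0, and then \<open>h\<close> is the restriction of the derivation
  \<open>z\<^sup>m \<mapsto> \<langle>c, m\<rangle> \<chi>\<^bsup>deg m + u\<^esup>\<close>. The homomorphisms of degree \<open>u\<close> in the span of the partial derivatives
  are those for which \<open>c\<close> can be supported on the \<open>w\<close> with \<open>u + w \<in> S\<close>, and these are exactly the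
  ones whose \<open>\<psi>\<close> vanishes on \<open>L(G\<^sup>u)\<close>: an additive map that vanishes wherever certain
  coordinates vanish is a combination of those coordinates (\<open>additive_eq_pairing\<close>).
  Restriction of \<open>\<psi>\<close> to \<open>L(G\<^sup>u)\<close> loses no condition, since an
  obstructed relation involves only elements of \<open>G\<^sup>u\<close> (\<open>support_in_E_set\<close>). The step is
  \<open>T1_component_isomorphic\<close>.

  Step 2: \<open>V\<^sub>G \<cong> V\<^sub>E\<close>. Writing the elements of one generating set as monomials in the other gives maps
  between the relation groups in both directions. They preserve obstructed relations, and going
  back and forth changes a relation by a combination of obstructed ones
  (\<open>functionals_independent_of_generators\<close>).

  Step 3: \<open>V\<^sub>E \<cong> Hom (Q, \<int>) \<otimes> k\<close> for the finitely generated group \<open>Q = L(E\<^sup>u) / \<langle>\<dots>\<rangle>\<close>. Modulo torsion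
  \<open>Q\<close> is free, so it has elements \<open>q\<^sub>i\<close> and integral functionals \<open>f\<^sub>i\<close> dual to each other such that
  every \<open>k\<close>-valued functional is \<open>\<psi> = \<Sum> \<psi>(q\<^sub>i) f\<^sub>i\<close> (\<open>dual_system_exists\<close>); the isomorphism sends \<open>\<psi>\<close> to
  \<open>\<Sum> f\<^sub>i \<otimes> \<psi>(q\<^sub>i)\<close> (\<open>tensor_dual_isomorphic\<close>).\<close>

section \<open>Functionals on groups of integer vectors\<close>

text \<open>Quotients need the group records of the algebra library, but computations inside a subgroup of a
  group that is a whole type are easier with plain sets and with maps that are additive on them.\<close>

definition is_subgroup :: "'a::ab_group_add set \<Rightarrow> bool"
  where "is_subgroup H \<longleftrightarrow> 0 \<in> H \<and> (\<forall>x\<in>H. \<forall>y\<in>H. x - y \<in> H)"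

definition additive_on :: "'a::ab_group_add set \<Rightarrow> ('a \<Rightarrow> 'b::ab_group_add) \<Rightarrow> bool"
  where "additive_on H f \<longleftrightarrow> (\<forall>x\<in>H. \<forall>y\<in>H. f (x + y) = f x + f y)"

text \<open>The homomorphism that takes the value \<open>c w\<close> on the unit vector of \<open>w\<close>.\<close>

definition pairing :: "('a \<Rightarrow> 'r::comm_ring_1) \<Rightarrow> ('a \<Rightarrow>\<^sub>0 int) \<Rightarrow> 'r"
  where "pairing c q = (\<Sum>w\<in>Poly_Mapping.keys q. of_int (Poly_Mapping.lookup q w) * c w)"

lemma is_subgroupD:
  assumes "is_subgroup H"
  shows "0 \<in> H" "x \<in> H \<Longrightarrow> y \<in> H \<Longrightarrow> x - y \<in> H"
    "x \<in> H \<Longrightarrow> - x \<in> H" "x \<in> H \<Longrightarrow> y \<in> H \<Longrightarrow> x + y \<in> H"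
proof -
  show 0: "0 \<in> H" using assms unfolding is_subgroup_def by auto
  have m: "x - y \<in> H" if "x \<in> H" "y \<in> H" for x y
    using assms that unfolding is_subgroup_def by auto
  then show "x \<in> H \<Longrightarrow> y \<in> H \<Longrightarrow> x - y \<in> H" .
  have n: "- x \<in> H" if "x \<in> H" for x
    using m[OF 0 that] by simp
  show "x \<in> H \<Longrightarrow> - x \<in> H" using n .
  show "x \<in> H \<Longrightarrow> y \<in> H \<Longrightarrow> x + y \<in> H"
    using m[of x "- y"] n[of y] by simp
qed

lemma is_subgroup_sum:
  assumes "is_subgroup H" "\<And>i. i \<in> I \<Longrightarrow> f i \<in> H"
  shows "sum f I \<in> H"
  using assms(2)
  by (induction I rule: infinite_finite_induct) (auto simp: is_subgroupD[OF assms(1)])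

lemma additive_onD: "additive_on H f \<Longrightarrow> x \<in> H \<Longrightarrow> y \<in> H \<Longrightarrow> f (x + y) = f x + f y"
  unfolding additive_on_def by blast

lemma additive_on_subset: "additive_on H f \<Longrightarrow> K \<subseteq> H \<Longrightarrow> additive_on K f"
  unfolding additive_on_def by blast

lemma additive_on_zero:
  assumes "is_subgroup H" "additive_on H f" shows "f 0 = 0"
  using additive_onD[OF assms(2), of 0 0] is_subgroupD(1)[OF assms(1)] by simp

lemma additive_on_minus:
  assumes "is_subgroup H" "additive_on H f" "x \<in> H" shows "f (- x) = - f x"
  using additive_onD[OF assms(2), of x "- x"] assms additive_on_zero[OF assms(1,2)]
  by (simp add: is_subgroupD eq_neg_iff_add_eq_0 add.commute)

lemma additive_on_diff:
  assumes "is_subgroup H" "additive_on H f" "x \<in> H" "y \<in> H" shows "f (x - y) = f x - f y"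
  using additive_onD[OF assms(2), of x "- y"] additive_on_minus[OF assms(1,2,4)] assms
  by (simp add: is_subgroupD)

lemma additive_on_sum:
  assumes "is_subgroup H" "additive_on H f" "\<And>i. i \<in> I \<Longrightarrow> g i \<in> H"
  shows "f (sum g I) = (\<Sum>i\<in>I. f (g i))"
  using assms(3)
  by (induction I rule: infinite_finite_induct)
     (auto simp: additive_on_zero[OF assms(1,2)] additive_onD[OF assms(2)] is_subgroup_sum[OF assms(1)])

lemma is_subgroup_frag_cmul:
  assumes "is_subgroup H" "x \<in> H" shows "frag_cmul n x \<in> H"
proof (induction n)
  case (nonneg n)
  then show ?case
    by (induction n) (use assms in \<open>auto simp: is_subgroupD frag_cmul_distrib\<close>)
next
  case (neg n)
  have "frag_cmul (int m) x \<in> H" for m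
    by (induction m) (use assms in \<open>auto simp: is_subgroupD frag_cmul_distrib\<close>)
  from is_subgroupD(3)[OF assms(1) this[of "Suc n"]] show ?case by simp
qed

lemma additive_on_frag_cmul:
  fixes f :: "_ \<Rightarrow> 'r::comm_ring_1"
  assumes "is_subgroup H" "additive_on H f" "x \<in> H"
  shows "f (frag_cmul n x) = of_int n * f x"
proof -
  have nonneg_case: "f (frag_cmul (int n) x) = of_nat n * f x" for n
    by (induction n)
       (auto simp: additive_on_zero[OF assms(1,2)] frag_cmul_distrib additive_onD[OF assms(2)]
          is_subgroup_frag_cmul assms algebra_simps)
  show ?thesis
  proof (cases n)
    case (nonneg m) then show ?thesis using nonneg_case by simp
  next
    case (neg m)
    have "f (frag_cmul n x) = f (- frag_cmul (int (Suc m)) x)" using neg by simp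
    also have "\<dots> = - (of_nat (Suc m) * f x)"
      by (subst additive_on_minus[OF assms(1,2) is_subgroup_frag_cmul[OF assms(1,3)]]) (simp only: nonneg_case)
    finally show ?thesis unfolding neg by (simp add: algebra_simps)
  qed
qed

lemma pairing_superset:
  assumes "finite W" "Poly_Mapping.keys q \<subseteq> W"
  shows "pairing c q = (\<Sum>w\<in>W. of_int (Poly_Mapping.lookup q w) * c w)"
  unfolding pairing_def
  by (rule sum.mono_neutral_left) (use assms in \<open>auto simp: in_keys_iff\<close>)

lemma pairing_add: "pairing c (p + q) = pairing c p + pairing c q"
proof -
  define W where "W = Poly_Mapping.keys p \<union> Poly_Mapping.keys q"
  have W: "finite W" "Poly_Mapping.keys p \<subseteq> W" "Poly_Mapping.keys q \<subseteq> W" "Poly_Mapping.keys (p + q) \<subseteq> W"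
    using keys_add[of p q] by (auto simp: W_def)
  show ?thesis
    by (simp add: pairing_superset[OF W(1)] W lookup_add algebra_simps sum.distrib)
qed

lemma pairing_additive_on: "additive_on H (pairing c)"
  by (simp add: additive_on_def pairing_add)

lemma is_subgroup_UNIV: "is_subgroup UNIV"
  by (simp add: is_subgroup_def)

lemmas pairing_zero = additive_on_zero[OF is_subgroup_UNIV pairing_additive_on]
lemmas pairing_diff = additive_on_diff[OF is_subgroup_UNIV pairing_additive_on UNIV_I UNIV_I]

lemma pairing_frag_of: "pairing c (frag_of w) = c w"
  by (simp add: pairing_def)

lemma pairing_add_left: "pairing (\<lambda>w. c w + d w) q = pairing c q + pairing d q"
  by (simp add: pairing_def algebra_simps sum.distrib)

lemma pairing_indicator: "pairing (\<lambda>v. if v = w then a else 0) q = of_int (Poly_Mapping.lookup q w) * a"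
proof -
  have "pairing (\<lambda>v. if v = w then a else 0) q
      = (\<Sum>v\<in>insert w (Poly_Mapping.keys q). of_int (Poly_Mapping.lookup q v) * (if v = w then a else 0))"
    by (rule pairing_superset) auto
  also have "\<dots> = (\<Sum>v\<in>insert w (Poly_Mapping.keys q). if v = w then of_int (Poly_Mapping.lookup q v) * a else 0)"
    by (rule sum.cong) auto
  finally show ?thesis by (simp add: sum.delta)
qed

text \<open>Induction on \<open>W\<close>. On the subgroup of those \<open>q\<close> whose coordinate \<open>w\<close> vanishes, the induction
  hypothesis leaves an error \<open>\<phi>\<close> that is zero there. If some \<open>p\<close> has a nonzero coordinate \<open>w\<close>, then
  \<open>p\<^sub>w q - q\<^sub>w p\<close> lies in that subgroup for every \<open>q\<close>, so \<open>\<phi>\<close> is a multiple of the coordinate \<open>w\<close>;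
  this is where division by a nonzero integer enters. With \<open>W\<close> the set of all coordinates the
  hypothesis on \<open>\<psi>\<close> is void and the lemma becomes an extension theorem; with \<open>W\<close> the generators
  outside \<open>F\<^sup>u\<close> it recognises combinations of partial derivatives.\<close>

lemma additive_eq_pairing:
  fixes \<psi> :: "('a \<Rightarrow>\<^sub>0 int) \<Rightarrow> 'k::field_char_0"
  assumes "finite W" "is_subgroup H" "additive_on H \<psi>"
    and "\<And>q. q \<in> H \<Longrightarrow> (\<forall>w\<in>W. Poly_Mapping.lookup q w = 0) \<Longrightarrow> \<psi> q = 0"
  shows "\<exists>c. (\<forall>w. w \<notin> W \<longrightarrow> c w = 0) \<and> (\<forall>q\<in>H. \<psi> q = pairing c q)"
  using assms
proof (induction W arbitrary: H rule: finite_induct)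
  case empty
  then show ?case by (intro exI[of _ "\<lambda>_. 0"]) (simp add: pairing_def)
next
  case (insert w W)
  define H0 where "H0 = {q\<in>H. Poly_Mapping.lookup q w = 0}"
  have H0: "is_subgroup H0"
    using insert.prems(1) by (auto simp: H0_def is_subgroup_def lookup_minus)
  have "\<exists>c. (\<forall>w. w \<notin> W \<longrightarrow> c w = 0) \<and> (\<forall>q\<in>H0. \<psi> q = pairing c q)"
    by (rule insert.IH[OF H0])
       (auto simp: H0_def intro: insert.prems(3) additive_on_subset[OF insert.prems(2)])
  then obtain c where c: "\<And>v. v \<notin> W \<Longrightarrow> c v = 0" "\<And>q. q \<in> H0 \<Longrightarrow> \<psi> q = pairing c q" by blast
  define \<phi> where "\<phi> q = \<psi> q - pairing c q" for q
  have \<phi>: "additive_on H \<phi>"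
    using insert.prems(2) by (auto simp: additive_on_def \<phi>_def pairing_add)
  show ?case
  proof (cases "\<exists>p\<in>H. Poly_Mapping.lookup p w \<noteq> 0")
    case False
    then have "H0 = H" by (auto simp: H0_def)
    then show ?thesis using c by auto
  next
    case True
    then obtain p where p: "p \<in> H" "Poly_Mapping.lookup p w \<noteq> 0" by blast
    define a where "a = \<phi> p / of_int (Poly_Mapping.lookup p w)"
    have "\<phi> q = of_int (Poly_Mapping.lookup q w) * a" if q: "q \<in> H" for q
    proof -
      let ?m = "Poly_Mapping.lookup p w" and ?n = "Poly_Mapping.lookup q w"
      have mem: "frag_cmul ?m q \<in> H" "frag_cmul ?n p \<in> H"
        by (simp_all add: is_subgroup_frag_cmul insert.prems(1) p q)
      have "frag_cmul ?m q - frag_cmul ?n p \<in> H0"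
        using is_subgroupD(2)[OF insert.prems(1) mem] by (simp add: H0_def lookup_minus)
      then have "\<phi> (frag_cmul ?m q - frag_cmul ?n p) = 0"
        using c(2) by (simp add: \<phi>_def)
      then have "of_int ?m * \<phi> q = of_int ?n * \<phi> p"
        by (simp add: additive_on_diff[OF insert.prems(1) \<phi>] mem
              additive_on_frag_cmul[OF insert.prems(1) \<phi>] p q)
      then show ?thesis using p(2) by (simp add: a_def field_simps)
    qed
    then have "\<forall>q\<in>H. \<psi> q = pairing (\<lambda>v. c v + (if v = w then a else 0)) q"
      by (simp add: pairing_add_left pairing_indicator \<phi>_def algebra_simps)
    moreover have "\<forall>v. v \<notin> insert w W \<longrightarrow> c v + (if v = w then a else 0) = 0"
      using c(1) by auto
    ultimately show ?thesis by (intro exI[of _ "\<lambda>v. c v + (if v = w then a else 0)"]) auto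
  qed
qed

lemma additive_extends:
  fixes \<psi> :: "('a \<Rightarrow>\<^sub>0 int) \<Rightarrow> 'k::field_char_0"
  assumes "finite F" "is_subgroup H" "\<And>q. q \<in> H \<Longrightarrow> Poly_Mapping.keys q \<subseteq> F" "additive_on H \<psi>"
  shows "\<exists>c. \<forall>q\<in>H. \<psi> q = pairing c q"
proof -
  have "\<psi> q = 0" if q: "q \<in> H" and *: "\<forall>w\<in>F. Poly_Mapping.lookup q w = 0" for q
  proof -
    have "q = 0" using assms(3)[OF q] * by (intro poly_mapping_eqI) (metis in_keys_iff lookup_zero subsetD)
    then show ?thesis using additive_on_zero[OF assms(2,4)] by simp
  qed
  then show ?thesis using additive_eq_pairing[OF assms(1,2,4)] by blast
qed

definition adjoin :: "('a \<Rightarrow>\<^sub>0 int) set \<Rightarrow> ('a \<Rightarrow>\<^sub>0 int) \<Rightarrow> ('a \<Rightarrow>\<^sub>0 int) set"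
  where "adjoin B x = {b + frag_cmul n x | b n. b \<in> B}"

lemma adjoin_subgroup:
  assumes "is_subgroup B" shows "is_subgroup (adjoin B x)"
  unfolding is_subgroup_def
proof (intro conjI ballI)
  show "0 \<in> adjoin B x"
    unfolding adjoin_def using is_subgroupD(1)[OF assms] by (force intro: exI[of _ 0])
  fix y z assume "y \<in> adjoin B x" "z \<in> adjoin B x"
  then obtain b n c m where yz: "y = b + frag_cmul n x" "z = c + frag_cmul m x" "b \<in> B" "c \<in> B"
    unfolding adjoin_def by blast
  have "y - z = (b - c) + frag_cmul (n - m) x"
    using yz by (simp add: frag_cmul_diff_distrib)
  then show "y - z \<in> adjoin B x"
    unfolding adjoin_def using is_subgroupD(2)[OF assms yz(3,4)] by blast
qed

lemma adjoin_superset: "B \<subseteq> adjoin B x"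
  by (force simp: adjoin_def intro: exI[of _ 0])

lemma mem_adjoin: "is_subgroup B \<Longrightarrow> x \<in> adjoin B x"
  using is_subgroupD(1)[of B] by (force simp: adjoin_def intro: exI[of _ 1])

lemma adjoin_subset: "is_subgroup H \<Longrightarrow> B \<subseteq> H \<Longrightarrow> x \<in> H \<Longrightarrow> adjoin B x \<subseteq> H"
  by (auto simp: adjoin_def is_subgroup_frag_cmul intro!: is_subgroupD(4))

lemma clear_denominators:
  assumes "finite F"
  shows "\<exists>N>0. \<forall>w\<in>F. \<exists>m. of_int N * (c w :: rat) = of_int m"
  using assms
proof (induction F rule: finite_induct)
  case empty then show ?case by (intro exI[of _ 1]) simp
next
  case (insert w F)
  then obtain N where N: "N > 0" "\<forall>w\<in>F. \<exists>m. of_int N * c w = of_int m" by blast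
  obtain a b where ab: "quotient_of (c w) = (a, b)" by force
  have b: "b > 0" "c w = of_int a / of_int b"
    using ab quotient_of_denom_pos quotient_of_div by blast+
  show ?case
  proof (rule exI[of _ "N * b"], intro conjI ballI)
    show "N * b > 0" using N b by simp
    fix v assume "v \<in> insert w F"
    then show "\<exists>m. of_int (N * b) * c v = of_int m"
    proof (cases "v = w")
      case True
      then show ?thesis using b by (intro exI[of _ "N * a"]) (simp add: field_simps)
    next
      case False
      then obtain m where "of_int N * c v = of_int m" using N \<open>v \<in> insert w F\<close> by blast
      then show ?thesis by (intro exI[of _ "m * b"]) (simp add: field_simps)
    qed
  qed
qed

text \<open>Since no nonzero multiple of \<open>x\<close> lies in \<open>B\<close>, the map \<open>b + n x \<mapsto> n\<close> is well defined. It extends to a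
  rational linear form with finitely many coefficients, and a common denominator makes it integral.\<close>

lemma integral_separation:
  assumes F: "finite F" "\<And>q. q \<in> B \<Longrightarrow> Poly_Mapping.keys q \<subseteq> F" "Poly_Mapping.keys x \<subseteq> F"
    and B: "is_subgroup B" and x: "\<And>n. frag_cmul n x \<in> B \<Longrightarrow> n = 0"
  shows "\<exists>a::'a \<Rightarrow> int. (\<forall>b\<in>B. pairing a b = 0) \<and> pairing a x \<noteq> 0"
proof -
  define \<psi> :: "_ \<Rightarrow> rat" where "\<psi> y = of_int (THE n. \<exists>b\<in>B. y = b + frag_cmul n x)" for y
  have \<psi>: "\<psi> (b + frag_cmul n x) = of_int n" if b: "b \<in> B" for b n
  proof -
    have "(THE m. \<exists>b'\<in>B. b + frag_cmul n x = b' + frag_cmul m x) = n"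
    proof (rule the_equality)
      show "\<exists>b'\<in>B. b + frag_cmul n x = b' + frag_cmul n x" using b by blast
      fix m assume "\<exists>b'\<in>B. b + frag_cmul n x = b' + frag_cmul m x"
      then obtain b' where b': "b' \<in> B" "b + frag_cmul n x = b' + frag_cmul m x" by blast
      then have "frag_cmul (n - m) x = b' - b" by (simp add: frag_cmul_diff_distrib algebra_simps)
      then show "m = n" using x[of "n - m"] is_subgroupD(2)[OF B b'(1) b] by simp
    qed
    then show ?thesis by (simp add: \<psi>_def)
  qed
  have "additive_on (adjoin B x) \<psi>"
    unfolding additive_on_def
  proof (intro ballI)
    fix y z assume "y \<in> adjoin B x" "z \<in> adjoin B x"
    then obtain b n c m where yz: "y = b + frag_cmul n x" "z = c + frag_cmul m x" "b \<in> B" "c \<in> B"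
      unfolding adjoin_def by blast
    have "\<psi> (y + z) = \<psi> ((b + c) + frag_cmul (n + m) x)"
      using yz by (simp add: frag_cmul_distrib algebra_simps)
    also have "\<dots> = of_int (n + m)" by (rule \<psi>[OF is_subgroupD(4)[OF B yz(3,4)]])
    finally show "\<psi> (y + z) = \<psi> y + \<psi> z" using yz by (simp add: \<psi>)
  qed
  moreover have "Poly_Mapping.keys q \<subseteq> F" if mem: "q \<in> adjoin B x" for q
  proof -
    obtain b n where b: "b \<in> B" "q = b + frag_cmul n x" using mem unfolding adjoin_def by blast
    show ?thesis using F(2)[OF b(1)] F(3) keys_cmul[of n x] keys_add[of b "frag_cmul n x"] b(2) by blast
  qed
  ultimately obtain c where c: "\<forall>q\<in>adjoin B x. \<psi> q = pairing c q"
    using additive_extends[OF F(1) adjoin_subgroup[OF B]] by blast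
  obtain N where N: "N > 0" "\<forall>w\<in>F. \<exists>m. of_int N * c w = of_int m"
    using clear_denominators[OF F(1)] by blast
  then obtain a where a: "\<And>w. w \<in> F \<Longrightarrow> of_int N * c w = of_int (a w)" by metis
  have pa: "of_int (pairing a q) = of_int N * pairing c q" if "Poly_Mapping.keys q \<subseteq> F" for q
  proof -
    have "of_int (pairing a q) = (\<Sum>w\<in>Poly_Mapping.keys q. of_int (Poly_Mapping.lookup q w) * (of_int N * c w))"
      unfolding pairing_def using a that by (auto intro!: sum.cong)
    then show ?thesis by (simp add: pairing_def sum_distrib_left algebra_simps)
  qed
  have "pairing a b = 0" if b: "b \<in> B" for b
  proof -
    have "pairing c b = 0"
      using c \<psi>[OF b, of 0] adjoin_superset[of B x] b by fastforce
    then show ?thesis using pa[OF F(2)[OF b]] by simp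
  qed
  moreover have "pairing a x \<noteq> 0"
  proof -
    have "pairing c x = 1"
      using c \<psi>[OF is_subgroupD(1)[OF B], of 1] mem_adjoin[OF B, of x] by simp
    then show ?thesis using pa[OF F(3)] N(1) by fastforce
  qed
  ultimately show ?thesis by blast
qed

text \<open>The values of \<open>g\<close> form a nonzero subgroup of the integers, generated by its least positive element.\<close>

lemma minimal_positive_value:
  fixes g :: "('a \<Rightarrow>\<^sub>0 int) \<Rightarrow> int"
  assumes H: "is_subgroup H" and g: "additive_on H g" and p: "p \<in> H" "g p \<noteq> 0"
  shows "\<exists>q\<in>H. g q > 0 \<and> (\<forall>h\<in>H. g q dvd g h)"
proof -
  let ?P = "\<lambda>n. n > 0 \<and> (\<exists>q\<in>H. g q = int n)"
  have "?P (nat \<bar>g p\<bar>)"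
  proof (cases "g p > 0")
    case True then show ?thesis using p by (intro conjI bexI[of _ p]) auto
  next
    case False
    then show ?thesis using p additive_on_minus[OF H g p(1)] is_subgroupD(3)[OF H p(1)]
      by (intro conjI bexI[of _ "- p"]) auto
  qed
  then have L: "?P (LEAST n. ?P n)" by (rule LeastI)
  then obtain q where q: "q \<in> H" "g q = int (LEAST n. ?P n)" by blast
  have pos: "g q > 0" using L q by simp
  moreover have "g q dvd g h" if h: "h \<in> H" for h
  proof (rule ccontr)
    assume nd: "\<not> g q dvd g h"
    let ?r = "h - frag_cmul (g h div g q) q"
    have r: "?r \<in> H" by (simp add: is_subgroupD(2)[OF H] is_subgroup_frag_cmul[OF H] h q)
    have "g ?r = g h - (g h div g q) * g q"
      by (simp add: additive_on_diff[OF H g] is_subgroup_frag_cmul[OF H] h q additive_on_frag_cmul[OF H g])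
    then have gr: "g ?r = g h mod g q" by (simp add: minus_div_mult_eq_mod)
    then have "g ?r > 0" using nd pos by (metis dvd_eq_mod_eq_0 pos_mod_sign order_le_less)
    then have "?P (nat (g ?r))" using r by (intro conjI bexI[of _ ?r]) auto
    then have "(LEAST n. ?P n) \<le> nat (g ?r)" by (rule Least_le)
    then show False using gr q(2) pos pos_mod_bound[of "g q" "g h"] by linarith
  qed
  ultimately show ?thesis using q by blast
qed

text \<open>Induction on the coordinates: the part of \<open>H\<close> with vanishing coordinate \<open>w\<close> is finitely
  generated, and one further generator is enough because the coordinates \<open>w\<close> form a cyclic group.\<close>

lemma subgroup_finitely_generated:
  fixes H :: "('a \<Rightarrow>\<^sub>0 int) set"
  assumes "finite F" "is_subgroup H" "\<And>q. q \<in> H \<Longrightarrow> Poly_Mapping.keys q \<subseteq> F"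
  shows "\<exists>X. finite X \<and> X \<subseteq> H \<and> (\<forall>K. is_subgroup K \<longrightarrow> X \<subseteq> K \<longrightarrow> H \<subseteq> K)"
  using assms
proof (induction F arbitrary: H rule: finite_induct)
  case empty
  then show ?case by (intro exI[of _ "{}"]) (auto simp: is_subgroup_def)
next
  case (insert w F)
  define H0 where "H0 = {q\<in>H. Poly_Mapping.lookup q w = 0}"
  have H0: "is_subgroup H0"
    using insert.prems(1) by (auto simp: H0_def is_subgroup_def lookup_minus)
  have "Poly_Mapping.keys q \<subseteq> F" if "q \<in> H0" for q
    using insert.prems(2)[of q] that by (auto simp: H0_def in_keys_iff)
  from insert.IH[OF H0 this] obtain X where
    X: "finite X" "X \<subseteq> H0" "\<And>K. is_subgroup K \<Longrightarrow> X \<subseteq> K \<Longrightarrow> H0 \<subseteq> K" by blast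
  show ?case
  proof (cases "\<exists>p\<in>H. Poly_Mapping.lookup p w \<noteq> 0")
    case False
    then have "H0 = H" by (auto simp: H0_def)
    then show ?thesis using X by blast
  next
    case True
    have "additive_on H (\<lambda>q. Poly_Mapping.lookup q w)"
      by (simp add: additive_on_def lookup_add)
    then obtain x where x: "x \<in> H" "\<forall>h\<in>H. Poly_Mapping.lookup x w dvd Poly_Mapping.lookup h w"
      using minimal_positive_value[OF insert.prems(1)] True by meson
    have "H \<subseteq> K" if K: "is_subgroup K" "insert x X \<subseteq> K" for K
    proof
      fix h assume h: "h \<in> H"
      then obtain n where n: "Poly_Mapping.lookup h w = Poly_Mapping.lookup x w * n"
        using x by (meson dvdE)
      have "h - frag_cmul n x \<in> H0"
        using is_subgroupD(2)[OF insert.prems(1) h is_subgroup_frag_cmul[OF insert.prems(1) x(1)]] n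
        by (simp add: H0_def lookup_minus)
      then have "h - frag_cmul n x \<in> K" using X(3)[of K] K by blast
      from is_subgroupD(4)[OF K(1) this is_subgroup_frag_cmul[OF K(1), of x n]] K(2)
      show "h \<in> K" by simp
    qed
    then show ?thesis using X x by (intro exI[of _ "insert x X"]) (auto simp: H0_def)
  qed
qed

text \<open>The \<open>q\<^sub>i\<close> represent a basis of \<open>H/B\<close> modulo torsion and the \<open>f\<^sub>i\<close> its dual basis. Instead of
  freeness, the definition demands that the \<open>q\<^sub>i\<close> determine the functionals with values in \<open>k\<close>, which
  do not see torsion.\<close>

definition dual_system ::
    "('a \<Rightarrow>\<^sub>0 int) set \<Rightarrow> ('a \<Rightarrow>\<^sub>0 int) set \<Rightarrow> 'k::field_char_0 itself \<Rightarrow> nat \<Rightarrow>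
     (nat \<Rightarrow> 'a \<Rightarrow>\<^sub>0 int) \<Rightarrow> (nat \<Rightarrow> ('a \<Rightarrow>\<^sub>0 int) \<Rightarrow> int) \<Rightarrow> bool"
  where "dual_system H B k n q f \<longleftrightarrow>
    (\<forall>i<n. q i \<in> H \<and> additive_on H (f i) \<and> (\<forall>b\<in>B. f i b = 0) \<and>
       (\<forall>j<n. f i (q j) = (if i = j then 1 else 0))) \<and>
    (\<forall>\<psi>::_ \<Rightarrow> 'k. additive_on H \<psi> \<longrightarrow> (\<forall>b\<in>B. \<psi> b = 0) \<longrightarrow>
       (\<forall>x\<in>H. \<psi> x = (\<Sum>i<n. \<psi> (q i) * of_int (f i x))))"

text \<open>If a nonzero multiple of \<open>x\<close> lies in \<open>B\<close>, then functionals that vanish on \<open>B\<close> also vanish at \<open>x\<close>, and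
  nothing has to be added. Otherwise some integral functional that vanishes on \<open>B\<close> is nonzero at \<open>x\<close>.
  On the common kernel \<open>K\<close> of the \<open>f\<^sub>i\<close>, which contains \<open>x\<close>, its values are the multiples of its value
  \<open>d\<close> at some \<open>p\<close>. Divided by \<open>d\<close> and composed with the projection to \<open>K\<close> along the \<open>q\<^sub>i\<close>, it is the functional
  to be added, together with \<open>p\<close>.\<close>

lemma dual_system_step:
  assumes F: "finite F" "\<And>q. q \<in> H \<Longrightarrow> Poly_Mapping.keys q \<subseteq> F"
    and H: "is_subgroup H" and B: "is_subgroup B" "B \<subseteq> H" and x: "x \<in> H"
    and ds: "dual_system H (adjoin B x) (TYPE('k::field_char_0)) n q f"
  shows "\<exists>n q f. dual_system H B (TYPE('k)) n q f"
proof -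
  let ?B1 = "adjoin B x"
  have q: "\<And>i. i < n \<Longrightarrow> q i \<in> H" and f: "\<And>i. i < n \<Longrightarrow> additive_on H (f i)"
    and fB: "\<And>i b. i < n \<Longrightarrow> b \<in> ?B1 \<Longrightarrow> f i b = 0"
    and fq: "\<And>i j. i < n \<Longrightarrow> j < n \<Longrightarrow> f i (q j) = (if i = j then 1 else 0)"
    and rep: "\<And>(\<psi>::_ \<Rightarrow> 'k) y. additive_on H \<psi> \<Longrightarrow> (\<forall>b\<in>?B1. \<psi> b = 0) \<Longrightarrow> y \<in> H \<Longrightarrow>
        \<psi> y = (\<Sum>i<n. \<psi> (q i) * of_int (f i y))"
    using ds unfolding dual_system_def by auto
  have onB1: "\<forall>b\<in>?B1. \<psi> b = 0"
    if "additive_on H \<psi>" "\<forall>b\<in>B. \<psi> b = 0" "\<psi> x = 0" for \<psi> :: "_ \<Rightarrow> 'k"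
    using that x B H
    by (auto simp: adjoin_def additive_on_frag_cmul[OF H] is_subgroup_frag_cmul subset_iff
          additive_onD[OF that(1)])
  show ?thesis
  proof (cases "\<exists>m. m \<noteq> 0 \<and> frag_cmul m x \<in> B")
    case True
    then obtain m where m: "m \<noteq> 0" "frag_cmul m x \<in> B" by blast
    have "\<psi> x = 0" if "additive_on H \<psi>" "\<forall>b\<in>B. \<psi> b = 0" for \<psi> :: "_ \<Rightarrow> 'k"
      using that m additive_on_frag_cmul[OF H that(1) x, of m] by simp
    then have "dual_system H B (TYPE('k)) n q f"
      unfolding dual_system_def
    proof (intro conjI allI impI ballI)
      fix \<psi> :: "_ \<Rightarrow> 'k" and y
      assume "additive_on H \<psi>" "\<forall>b\<in>B. \<psi> b = 0" "y \<in> H"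
      then show "\<psi> y = (\<Sum>i<n. \<psi> (q i) * of_int (f i y))"
        using rep onB1 \<open>\<And>\<psi>::_ \<Rightarrow> 'k. additive_on H \<psi> \<Longrightarrow> \<forall>b\<in>B. \<psi> b = 0 \<Longrightarrow> \<psi> x = 0\<close> by simp
    qed (use q f fB fq adjoin_superset[of B x] in \<open>auto simp: subset_iff\<close>)
    then show ?thesis by blast
  next
    case False
    obtain a where a: "\<forall>b\<in>B. pairing a b = 0" "pairing a x \<noteq> (0::int)"
      using integral_separation[OF F(1) _ F(2)[OF x] B(1)] F(2) B(2) False by (metis subsetD)
    define K where "K = {h\<in>H. \<forall>i<n. f i h = 0}"
    have K: "is_subgroup K"
      unfolding is_subgroup_def K_def
      using H f by (auto simp: is_subgroupD additive_on_zero[OF H] additive_on_diff[OF H])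
    have xK: "x \<in> K" using x fB mem_adjoin[OF B(1)] by (simp add: K_def)
    obtain p where p: "p \<in> K" "pairing a p > 0" "\<forall>h\<in>K. pairing a p dvd pairing a h"
      using minimal_positive_value[OF K pairing_additive_on xK a(2)] by blast
    define d where "d = pairing a p"
    define r where "r h = h - (\<Sum>i<n. frag_cmul (f i h) (q i))" for h
    have cm: "frag_cmul (f i h) (q i) \<in> H" if "i < n" for i h
      using is_subgroup_frag_cmul[OF H q[OF that]] .
    have rK: "r h \<in> K" if h: "h \<in> H" for h
    proof -
      have s: "(\<Sum>i<n. frag_cmul (f i h) (q i)) \<in> H"
        by (rule is_subgroup_sum[OF H]) (simp add: cm)
      have "f j (r h) = 0" if j: "j < n" for j
      proof -
        have "f j (\<Sum>i<n. frag_cmul (f i h) (q i)) = (\<Sum>i<n. f j (frag_cmul (f i h) (q i)))"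
          by (rule additive_on_sum[OF H f[OF j]]) (simp add: cm)
        also have "\<dots> = (\<Sum>i<n. if i = j then f j h else 0)"
          by (rule sum.cong) (auto simp: additive_on_frag_cmul[OF H f[OF j]] q fq j)
        also have "\<dots> = f j h" using j by (simp add: sum.delta)
        finally show ?thesis unfolding r_def by (simp add: additive_on_diff[OF H f[OF j] h s])
      qed
      then show ?thesis using is_subgroupD(2)[OF H h s] by (simp add: K_def r_def)
    qed
    have r_add: "r (g + h) = r g + r h" if "g \<in> H" "h \<in> H" for g h
      using that by (simp add: r_def additive_onD[OF f] frag_cmul_distrib sum.distrib)
    have r_on_K: "r h = h" if "h \<in> K" for h
      using that by (simp add: r_def K_def)
    have r_q: "r (q j) = 0" if "j < n" for j
    proof -
      have "(\<Sum>i<n. frag_cmul (f i (q j)) (q i)) = (\<Sum>i<n. if i = j then q j else 0)"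
        by (rule sum.cong) (use fq that in auto)
      then show ?thesis using that by (simp add: r_def sum.delta)
    qed
    define f0 where "f0 h = pairing a (r h) div d" for h
    have d: "d > 0" using p by (simp add: d_def)
    have df0: "d * f0 h = pairing a (r h)" if "h \<in> H" for h
      using p(3) rK[OF that] by (simp add: f0_def d_def)
    have f0: "additive_on H f0"
      unfolding additive_on_def
    proof (intro ballI)
      fix g h assume gh: "g \<in> H" "h \<in> H"
      have "d * f0 (g + h) = d * (f0 g + f0 h)"
        using df0 gh is_subgroupD(4)[OF H gh] by (simp add: r_add pairing_add algebra_simps)
      then show "f0 (g + h) = f0 g + f0 h" using d by simp
    qed
    have BK: "B \<subseteq> K" using B(2) fB adjoin_superset[of B x] by (auto simp: K_def)
    have f0B: "f0 b = 0" if "b \<in> B" for b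
      using that BK a(1) by (simp add: f0_def r_on_K subset_iff)
    have f0q: "f0 (q j) = 0" if "j < n" for j
      using that by (simp add: f0_def r_q pairing_zero)
    have f0p: "f0 p = 1" using p(1) d by (simp add: f0_def r_on_K d_def)
    have pH: "p \<in> H" "\<And>i. i < n \<Longrightarrow> f i p = 0" using p(1) by (auto simp: K_def)
    have f0x: "f0 x \<noteq> 0" using df0[OF x] a(2) xK by (auto simp: r_on_K)
    have "dual_system H B (TYPE('k)) (Suc n) (q(n := p)) (f(n := f0))"
      unfolding dual_system_def
    proof (intro conjI allI impI ballI)
      fix \<psi> :: "_ \<Rightarrow> 'k" and y
      assume \<psi>: "additive_on H \<psi>" "\<forall>b\<in>B. \<psi> b = 0" and y: "y \<in> H"
      (* subtracting this multiple of f0 makes the functional vanish at x, hence on adjoin B x *)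
      define c where "c = \<psi> x / of_int (f0 x)"
      define \<phi> where "\<phi> h = \<psi> h - c * of_int (f0 h)" for h
      have \<phi>: "additive_on H \<phi>"
        using \<psi>(1) f0 by (auto simp: additive_on_def \<phi>_def algebra_simps)
      have \<phi>B: "\<forall>b\<in>?B1. \<phi> b = 0"
        by (rule onB1[OF \<phi>]) (use \<psi> f0B f0x in \<open>auto simp: \<phi>_def c_def\<close>)
      have "\<phi> p = 0" using rep[OF \<phi> \<phi>B pH(1)] pH(2) by simp
      then have c: "c = \<psi> p" by (simp add: \<phi>_def f0p)
      have "\<phi> y = (\<Sum>i<n. \<psi> (q i) * of_int (f i y))"
        using rep[OF \<phi> \<phi>B y] f0q by (simp add: \<phi>_def)
      then show "\<psi> y = (\<Sum>i<Suc n. \<psi> ((q(n := p)) i) * of_int ((f(n := f0)) i y))"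
        by (simp add: \<phi>_def c algebra_simps)
    qed (use q f fB fq f0 f0B f0q f0p pH adjoin_superset[of B x] in \<open>auto simp: less_Suc_eq subset_iff\<close>)
    then show ?thesis by blast
  qed
qed

text \<open>Induction on a finite generating set of \<open>H\<close> modulo \<open>B\<close>. It is the subgroup \<open>B\<close> that varies: adjoining
  a generator to \<open>B\<close> leaves fewer generators to be treated, and \<open>dual_system_step\<close> leads back.\<close>

lemma dual_system_exists:
  assumes F: "finite F" "\<And>q. q \<in> H \<Longrightarrow> Poly_Mapping.keys q \<subseteq> F"
    and H: "is_subgroup H" and B: "is_subgroup B" "B \<subseteq> H"
  shows "\<exists>n q f. dual_system H B (TYPE('k::field_char_0)) n q f"
proof -
  obtain X where X: "finite X" "X \<subseteq> H" "\<And>K. is_subgroup K \<Longrightarrow> X \<subseteq> K \<Longrightarrow> H \<subseteq> K"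
    using subgroup_finitely_generated[OF F(1) H F(2)] by blast
  then have "\<And>K. is_subgroup K \<Longrightarrow> B \<union> X \<subseteq> K \<Longrightarrow> H \<subseteq> K" by blast
  with X(1,2) B show ?thesis
  proof (induction X arbitrary: B rule: finite_induct)
    case empty
    then have "H = B" by blast
    then have "dual_system H B (TYPE('k)) 0 (\<lambda>_. 0) (\<lambda>_ _. 0)" by (simp add: dual_system_def)
    then show ?case by blast
  next
    case (insert x X)
    have x: "x \<in> H" using insert.prems by simp
    have "\<exists>n q f. dual_system H (adjoin B x) (TYPE('k)) n q f"
    proof (rule insert.IH)
      show "X \<subseteq> H" using insert.prems by simp
      show "is_subgroup (adjoin B x)" using adjoin_subgroup insert.prems by blast
      show "adjoin B x \<subseteq> H" using adjoin_subset[OF H] insert.prems x by blast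
      show "H \<subseteq> K" if "is_subgroup K" "adjoin B x \<union> X \<subseteq> K" for K
        using insert.prems(4)[OF that(1)] that(2) adjoin_superset[of B x] mem_adjoin[of B x] insert.prems(2)
        by blast
    qed
    then show ?case using dual_system_step[OF F H insert.prems(2,3) x] by blast
  qed
qed

section \<open>Exponents, degrees and relations\<close>

lemma comm_group_additive_group: "comm_group (additive_group :: 'm::ab_group_add monoid)"
  by (rule comm_groupI) (auto simp: additive_group_def intro: exI[of _ "- _"] add.assoc add.commute left_minus)

interpretation additive_group: comm_group additive_group
  by (rule comm_group_additive_group)

lemma additive_group_simps [simp]:
  "carrier additive_group = UNIV" "x \<otimes>\<^bsub>additive_group\<^esub> y = x + y" "\<one>\<^bsub>additive_group\<^esub> = 0"
  by (simp_all add: additive_group_def)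

lemma int_pow_additive:
  "w [^]\<^bsub>additive_group\<^esub> (m + n :: int) = w [^]\<^bsub>additive_group\<^esub> m + w [^]\<^bsub>additive_group\<^esub> n"
  using additive_group.int_pow_mult[of w m n] by simp

lemma lin_comb_superset:
  assumes "finite W" "Poly_Mapping.keys q \<subseteq> W"
  shows "lin_comb q = (\<Sum>w\<in>W. w [^]\<^bsub>additive_group\<^esub> Poly_Mapping.lookup q w)"
  unfolding lin_comb_def
  by (rule sum.mono_neutral_left) (use assms in \<open>auto simp: in_keys_iff\<close>)

lemma lin_comb_add: "lin_comb (p + q) = lin_comb p + lin_comb q"
proof -
  define W where "W = Poly_Mapping.keys p \<union> Poly_Mapping.keys q"
  have W: "finite W" "Poly_Mapping.keys p \<subseteq> W" "Poly_Mapping.keys q \<subseteq> W" "Poly_Mapping.keys (p + q) \<subseteq> W"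
    using keys_add[of p q] by (auto simp: W_def)
  show ?thesis
    by (simp add: lin_comb_superset[OF W(1)] W lookup_add int_pow_additive sum.distrib)
qed

lemma lin_comb_additive_on: "additive_on H lin_comb"
  by (simp add: additive_on_def lin_comb_add)

lemmas lin_comb_zero = additive_on_zero[OF is_subgroup_UNIV lin_comb_additive_on]
lemmas lin_comb_diff = additive_on_diff[OF is_subgroup_UNIV lin_comb_additive_on UNIV_I UNIV_I]

lemma lin_comb_frag_of: "lin_comb (frag_of w) = w"
  using additive_group.int_pow_1[of w] by (simp add: lin_comb_def)

definition of_exponent :: "('m \<Rightarrow>\<^sub>0 nat) \<Rightarrow> 'm \<Rightarrow>\<^sub>0 int"
  where "of_exponent m = Poly_Mapping.map int m"

definition pos_exponent :: "('m \<Rightarrow>\<^sub>0 int) \<Rightarrow> 'm \<Rightarrow>\<^sub>0 nat"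
  where "pos_exponent q = Poly_Mapping.map nat q"

lemma lookup_of_exponent [simp]: "Poly_Mapping.lookup (of_exponent m) w = int (Poly_Mapping.lookup m w)"
  unfolding of_exponent_def by transfer (simp add: when_def)

lemma lookup_pos_exponent [simp]: "Poly_Mapping.lookup (pos_exponent q) w = nat (Poly_Mapping.lookup q w)"
  unfolding pos_exponent_def by transfer (simp add: when_def)

lemma lookup_pos_part [simp]: "Poly_Mapping.lookup (pos_part q) w = max (Poly_Mapping.lookup q w) 0"
  unfolding pos_part_def by transfer (simp add: when_def)

lemma keys_of_exponent [simp]: "Poly_Mapping.keys (of_exponent m) = Poly_Mapping.keys m"
  by (auto simp: in_keys_iff)

lemma keys_pos_exponent: "Poly_Mapping.keys (pos_exponent q) \<subseteq> Poly_Mapping.keys q"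
  by (auto simp: in_keys_iff)

lemma of_exponent_add: "of_exponent (a + b) = of_exponent a + of_exponent b"
  by (rule poly_mapping_eqI) (simp add: lookup_add)

lemma of_exponent_zero [simp]: "of_exponent 0 = 0"
  by (rule poly_mapping_eqI) simp

lemma of_exponent_single: "of_exponent (Poly_Mapping.single w n) = Poly_Mapping.single w (int n)"
  by (rule poly_mapping_eqI) (simp add: lookup_single when_def)

lemma lin_comb_of_exponent: "lin_comb (of_exponent m) = monomial_degree m"
  by (simp add: lin_comb_def monomial_degree_def int_pow_int)

lemma monomial_degree_add: "monomial_degree (a + b) = monomial_degree a + monomial_degree b"
  by (simp flip: lin_comb_of_exponent add: of_exponent_add lin_comb_add)

lemma monomial_degree_zero [simp]: "monomial_degree 0 = 0"
  by (simp flip: lin_comb_of_exponent add: lin_comb_zero)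

lemma monomial_degree_single [simp]: "monomial_degree (Poly_Mapping.single w 1) = w"
  by (simp flip: lin_comb_of_exponent add: of_exponent_single lin_comb_frag_of del: single_one)

lemma pos_part_eq: "pos_part q = of_exponent (pos_exponent q)"
  by (rule poly_mapping_eqI) simp

lemma relation_degree_eq: "relation_degree q = monomial_degree (pos_exponent q)"
  by (simp add: relation_degree_def pos_part_eq lin_comb_of_exponent)

lemma exponent_difference: "of_exponent (pos_exponent q) - of_exponent (pos_exponent (- q)) = q"
  by (rule poly_mapping_eqI) (simp add: lookup_minus)

lemma relation_degree_uminus:
  assumes "lin_comb q = 0" shows "relation_degree (- q) = relation_degree q"
  using arg_cong[OF exponent_difference[of q], of lin_comb] assms
  by (simp add: relation_degree_eq lin_comb_diff lin_comb_of_exponent)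

text \<open>The exponent \<open>c\<close> is the componentwise minimum of \<open>a\<close> and \<open>b\<close>.\<close>

lemma exponent_common_part:
  defines "q \<equiv> \<lambda>a b. of_exponent a - of_exponent b"
  shows "\<exists>c. a = c + pos_exponent (q a b) \<and> b = c + pos_exponent (- q a b)"
proof -
  have "a = (a - pos_exponent (q a b)) + pos_exponent (q a b)"
       "b = (a - pos_exponent (q a b)) + pos_exponent (- q a b)"
    by (rule poly_mapping_eqI, simp add: lookup_add lookup_minus q_def)+
  then show ?thesis by blast
qed

lemma split_exponent:
  fixes m :: "'a \<Rightarrow>\<^sub>0 nat"
  assumes "w \<in> Poly_Mapping.keys m"
  shows "m = Poly_Mapping.single w 1 + (m - Poly_Mapping.single w 1)"
    and "Poly_Mapping.keys (m - Poly_Mapping.single w 1) \<subseteq> Poly_Mapping.keys m"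
  using assms
  by (auto intro!: poly_mapping_eqI simp: lookup_add lookup_minus lookup_single when_def in_keys_iff split: if_splits)

lemma keys_add_nat: "Poly_Mapping.keys (a + b :: 'a \<Rightarrow>\<^sub>0 nat) = Poly_Mapping.keys a \<union> Poly_Mapping.keys b"
  by (auto simp: in_keys_iff lookup_add)

locale generating_set =
  fixes F S :: "'m::ab_group_add set"
  assumes finite_generators: "finite F" and span: "monoid_span F = S"
begin

lemma submonoid: "submonoid S additive_group"
proof -
  have "submonoid (monoid_span F) additive_group"
    unfolding monoid_span_def
    by (rule hull_in) (auto simp: submonoid_def)
  then show ?thesis by (simp add: span)
qed

lemma zero_mem: "0 \<in> S" and add_mem: "x \<in> S \<Longrightarrow> y \<in> S \<Longrightarrow> x + y \<in> S"
  using submonoid.one_closed[OF submonoid] submonoid.m_closed[OF submonoid, of x y] by simp_all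

lemma generators_subset: "F \<subseteq> S"
  using hull_subset[of F] span unfolding monoid_span_def by blast

lemma monomial_degree_mem:
  assumes "Poly_Mapping.keys m \<subseteq> F" shows "monomial_degree m \<in> S"
proof -
  have pow: "w [^]\<^bsub>additive_group\<^esub> (n::nat) \<in> S" if "w \<in> S" for w n
    using that by (induction n) (auto simp: zero_mem add_mem)
  have "(\<Sum>w\<in>W. w [^]\<^bsub>additive_group\<^esub> Poly_Mapping.lookup m w) \<in> S" if "W \<subseteq> F" for W
    using that by (induction W rule: infinite_finite_induct)
      (use generators_subset in \<open>auto intro!: add_mem pow simp: zero_mem\<close>)
  then show ?thesis using assms by (simp add: monomial_degree_def)
qed

lemma mem_imp_monomial_degree:
  assumes "s \<in> S" shows "\<exists>m. Poly_Mapping.keys m \<subseteq> F \<and> monomial_degree m = s"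
proof -
  have "submonoid {monomial_degree m | m. Poly_Mapping.keys m \<subseteq> F} additive_group"
  proof (rule submonoid.intro)
    fix x y assume "x \<in> {monomial_degree m | m. Poly_Mapping.keys m \<subseteq> F}"
      "y \<in> {monomial_degree m | m. Poly_Mapping.keys m \<subseteq> F}"
    then obtain a b where "x = monomial_degree a" "y = monomial_degree b"
      "Poly_Mapping.keys a \<subseteq> F" "Poly_Mapping.keys b \<subseteq> F" by blast
    then have "x + y = monomial_degree (a + b)" "Poly_Mapping.keys (a + b) \<subseteq> F"
      by (auto simp: monomial_degree_add keys_add_nat)
    then show "x \<otimes>\<^bsub>additive_group\<^esub> y \<in> {monomial_degree m | m. Poly_Mapping.keys m \<subseteq> F}" by auto
  qed (auto intro: exI[of _ 0])
  moreover have "F \<subseteq> {monomial_degree m | m. Poly_Mapping.keys m \<subseteq> F}"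
  proof
    fix w assume "w \<in> F"
    then show "w \<in> {monomial_degree m | m. Poly_Mapping.keys m \<subseteq> F}"
      by (intro CollectI exI[of _ "Poly_Mapping.single w 1"]) (simp del: One_nat_def)
  qed
  ultimately have "monoid_span F \<subseteq> {monomial_degree m | m. Poly_Mapping.keys m \<subseteq> F}"
    unfolding monoid_span_def by (rule hull_minimal[rotated])
  then show ?thesis using assms span by auto
qed

text \<open>If \<open>w\<close> divides the monomial \<open>m\<close> and \<open>u + w \<in> S\<close>, then \<open>deg m + u\<close> is the sum of \<open>u + w\<close> and the degree
  of the cofactor, hence in \<open>S\<close>.\<close>

lemma support_in_E_set:
  assumes "Poly_Mapping.keys m \<subseteq> F" "monomial_degree m + u \<notin> S"
  shows "Poly_Mapping.keys m \<subseteq> E_set F S u"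
proof
  fix w assume w: "w \<in> Poly_Mapping.keys m"
  note m = split_exponent[OF w]
  have deg: "monomial_degree m = w + monomial_degree (m - Poly_Mapping.single w 1)"
    using arg_cong[OF m(1), of monomial_degree] by (simp add: monomial_degree_add del: One_nat_def)
  have rest: "monomial_degree (m - Poly_Mapping.single w 1) \<in> S"
    using m(2) assms(1) by (intro monomial_degree_mem) blast
  have "u + w \<notin> S"
  proof
    assume "u + w \<in> S"
    from add_mem[OF this rest] show False using assms(2) deg by (simp add: ac_simps)
  qed
  then show "w \<in> E_set F S u" using w assms(1) by (auto simp: E_set_def)
qed

definition relations :: "'m \<Rightarrow> ('m \<Rightarrow>\<^sub>0 int) set"
  where "relations u = {q. Poly_Mapping.keys q \<subseteq> E_set F S u \<and> lin_comb q = 0}"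

lemma relations_subgroup: "is_subgroup (relations u)"
  unfolding is_subgroup_def relations_def
  using keys_diff by (fastforce simp: lin_comb_zero lin_comb_diff)

lemma relations_subset: "q \<in> relations u \<Longrightarrow> Poly_Mapping.keys q \<subseteq> F"
  by (auto simp: relations_def E_set_def)

text \<open>The obstruction of a relation refers to its parts of disjoint support, but it may be tested on any
  representation as a difference \<open>a - b\<close>: removing the common part lowers the degree by an element
  of \<open>S\<close>, so it cannot bring \<open>deg a + u\<close> into \<open>S\<close>.\<close>

lemma obstructed_difference:
  assumes "Poly_Mapping.keys a \<subseteq> F" "Poly_Mapping.keys b \<subseteq> F"
    and "monomial_degree a = monomial_degree b" "monomial_degree a + u \<notin> S"
  shows "of_exponent a - of_exponent b \<in> relations u"
    and "relation_degree (of_exponent a - of_exponent b) + u \<notin> S"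
proof -
  let ?q = "of_exponent a - of_exponent b"
  have "Poly_Mapping.keys ?q \<subseteq> Poly_Mapping.keys a \<union> Poly_Mapping.keys b"
    using keys_diff[of "of_exponent a" "of_exponent b"] by simp
  then show "?q \<in> relations u"
    using support_in_E_set[of a u] support_in_E_set[of b u] assms
    by (auto simp: relations_def lin_comb_diff lin_comb_of_exponent)
  obtain c where c: "a = c + pos_exponent ?q" using exponent_common_part by blast
  then have "Poly_Mapping.keys c \<subseteq> F" using assms(1) keys_add_nat[of c "pos_exponent ?q"] by simp
  then have "monomial_degree c \<in> S" by (rule monomial_degree_mem)
  moreover have "monomial_degree a = monomial_degree c + relation_degree ?q"
    unfolding relation_degree_eq using c monomial_degree_add by metis
  ultimately show "relation_degree ?q + u \<notin> S"
    using assms(4) add_mem[of "monomial_degree c" "relation_degree ?q + u"] by (auto simp: ac_simps)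
qed

text \<open>The space \<open>V\<^sub>F\<close> of the introduction, as functions on the relation group itself instead of
  its quotient.\<close>

definition functionals :: "'m \<Rightarrow> ('k::field, ('m \<Rightarrow>\<^sub>0 int) \<Rightarrow> 'k) module"
  where "functionals u =
    mk_module
      {\<psi> \<in> extensional (relations u). additive_on (relations u) \<psi> \<and>
         (\<forall>q\<in>relations u. relation_degree q + u \<notin> S \<longrightarrow> \<psi> q = 0)}
      (\<lambda>q\<in>relations u. 0)
      (\<lambda>f g. \<lambda>q\<in>relations u. f q + g q)
      (\<lambda>c f. \<lambda>q\<in>relations u. c * f q)"

end

lemma mk_module_simps [simp]:
  "carrier (mk_module C z a s) = C" "ring.zero (mk_module C z a s) = z" "add (mk_module C z a s) = a"
  "smult (mk_module C z a s) = s"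
  by (simp_all add: mk_module_def)

section \<open>Independence of the generating set\<close>

lemma frag_extend_of_exponent:
  fixes n :: "'a \<Rightarrow> 'b \<Rightarrow>\<^sub>0 nat"
  shows
  "\<exists>a'. frag_extend (\<lambda>g. of_exponent (n g)) (of_exponent a) = of_exponent a' \<and>
    Poly_Mapping.keys a' \<subseteq> (\<Union>g\<in>Poly_Mapping.keys a. Poly_Mapping.keys (n g))"
proof -
  define a' where "a' = (\<Sum>g\<in>Poly_Mapping.keys a. \<Sum>i<Poly_Mapping.lookup a g. n g)"
  have sum: "of_exponent (sum h I) = (\<Sum>i\<in>I. of_exponent (h i))" for h :: "'a \<Rightarrow> 'b \<Rightarrow>\<^sub>0 nat" and I :: "'a set"
    by (induction I rule: infinite_finite_induct) (auto simp: of_exponent_add)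
  have pow: "(\<Sum>i<k. x) = frag_cmul (int k) x" for x :: "'b \<Rightarrow>\<^sub>0 int" and k :: nat
    by (induction k) (auto simp: frag_cmul_distrib add.commute)
  have sum': "of_exponent (\<Sum>i<k. h) = frag_cmul (int k) (of_exponent h)" for h :: "'b \<Rightarrow>\<^sub>0 nat" and k :: nat
    by (induction k) (auto simp: frag_cmul_distrib of_exponent_add add.commute)
  have "of_exponent a' = frag_extend (\<lambda>g. of_exponent (n g)) (of_exponent a)"
    unfolding a'_def frag_extend_def sum sum' by simp
  moreover have "Poly_Mapping.keys a' \<subseteq> (\<Union>g\<in>Poly_Mapping.keys a. Poly_Mapping.keys (n g))"
  proof
    fix w assume "w \<in> Poly_Mapping.keys a'"
    then have "Poly_Mapping.lookup a' w \<noteq> 0" by (simp add: in_keys_iff)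
    then obtain g where "g \<in> Poly_Mapping.keys a" "(\<Sum>i<Poly_Mapping.lookup a g. Poly_Mapping.lookup (n g) w) \<noteq> 0"
      unfolding a'_def lookup_sum by (meson sum.neutral)
    then show "w \<in> (\<Union>g\<in>Poly_Mapping.keys a. Poly_Mapping.keys (n g))" by (auto simp: in_keys_iff)
  qed
  ultimately show ?thesis by metis
qed

lemma lin_comb_frag_extend:
  assumes "Poly_Mapping.keys q \<subseteq> G" "\<And>g. g \<in> G \<Longrightarrow> lin_comb (N g) = g"
  shows "lin_comb (frag_extend N q) = lin_comb q"
  using assms(1)
  by (induction q rule: frag_induction)
     (auto simp: lin_comb_zero lin_comb_frag_of lin_comb_diff frag_extend_diff assms(2))

locale two_generating_sets = F: generating_set F S + G: generating_set G S
  for F G S :: "'m::ab_group_add set" +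
  fixes n :: "'m \<Rightarrow> 'm \<Rightarrow>\<^sub>0 nat"
  assumes n: "\<And>g. g \<in> G \<Longrightarrow> Poly_Mapping.keys (n g) \<subseteq> F" "\<And>g. g \<in> G \<Longrightarrow> monomial_degree (n g) = g"
begin

definition substitute :: "('m \<Rightarrow>\<^sub>0 int) \<Rightarrow> 'm \<Rightarrow>\<^sub>0 int"
  where "substitute = frag_extend (\<lambda>g. of_exponent (n g))"

lemma substitute_add: "substitute (x + y) = substitute x + substitute y"
  by (simp add: substitute_def frag_extend_add)

lemma substitute_exponent:
  assumes "Poly_Mapping.keys a \<subseteq> G"
  shows "\<exists>a'. substitute (of_exponent a) = of_exponent a' \<and> Poly_Mapping.keys a' \<subseteq> F \<and>
    monomial_degree a' = monomial_degree a"
proof -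
  obtain a' where a': "substitute (of_exponent a) = of_exponent a'"
    "Poly_Mapping.keys a' \<subseteq> (\<Union>g\<in>Poly_Mapping.keys a. Poly_Mapping.keys (n g))"
    unfolding substitute_def using frag_extend_of_exponent by metis
  have "lin_comb (substitute (of_exponent a)) = lin_comb (of_exponent a)"
    unfolding substitute_def
    by (rule lin_comb_frag_extend[of _ G]) (use assms n in \<open>auto simp: lin_comb_of_exponent\<close>)
  then show ?thesis using a' n assms by (fastforce simp: lin_comb_of_exponent)
qed

lemma substitute_relations:
  assumes "q \<in> G.relations u" shows "substitute q \<in> F.relations u"
proof -
  have q: "Poly_Mapping.keys q \<subseteq> E_set G S u" "lin_comb q = 0" "Poly_Mapping.keys q \<subseteq> G"
    using assms G.relations_subset by (auto simp: G.relations_def)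
  have "Poly_Mapping.keys (n g) \<subseteq> E_set F S u" if "g \<in> E_set G S u" for g
    by (rule F.support_in_E_set) (use n that in \<open>auto simp: E_set_def add.commute\<close>)
  then have "Poly_Mapping.keys (substitute q) \<subseteq> E_set F S u"
    unfolding substitute_def using q(1) keys_frag_extend[of "\<lambda>g. of_exponent (n g)" q] by fastforce
  moreover have "lin_comb (substitute q) = 0"
    unfolding substitute_def
    by (subst lin_comb_frag_extend[of _ G]) (use q n in \<open>auto simp: lin_comb_of_exponent\<close>)
  ultimately show ?thesis by (simp add: F.relations_def)
qed

text \<open>The images of the two parts of \<open>q\<close> may have common variables, but they still have the obstructed
  degree of \<open>q\<close>, which is all that \<open>obstructed_difference\<close> asks for.\<close>

lemma substitute_obstructed:
  assumes q: "q \<in> G.relations u" "relation_degree q + u \<notin> S"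
  shows "relation_degree (substitute q) + u \<notin> S"
proof -
  let ?a = "pos_exponent q" and ?b = "pos_exponent (- q)"
  have k: "Poly_Mapping.keys ?a \<subseteq> G" "Poly_Mapping.keys ?b \<subseteq> G"
    using keys_pos_exponent[of q] keys_pos_exponent[of "- q"] G.relations_subset[OF q(1)] by auto
  obtain a where a: "substitute (of_exponent ?a) = of_exponent a" "Poly_Mapping.keys a \<subseteq> F"
    "monomial_degree a = monomial_degree ?a" using substitute_exponent[OF k(1)] by blast
  obtain b where b: "substitute (of_exponent ?b) = of_exponent b" "Poly_Mapping.keys b \<subseteq> F"
    "monomial_degree b = monomial_degree ?b" using substitute_exponent[OF k(2)] by blast
  have "monomial_degree ?b = monomial_degree ?a"
    using relation_degree_uminus[of q] q(1) by (simp add: G.relations_def relation_degree_eq)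
  then have "relation_degree (of_exponent a - of_exponent b) + u \<notin> S"
    using F.obstructed_difference(2)[OF a(2) b(2)] a(3) b(3) q(2) by (simp add: relation_degree_eq)
  moreover have "substitute q = of_exponent a - of_exponent b"
    using arg_cong[OF exponent_difference[of q], of substitute] a(1) b(1)
    by (simp add: substitute_def frag_extend_diff)
  ultimately show ?thesis by simp
qed

definition pullback :: "'m \<Rightarrow> (('m \<Rightarrow>\<^sub>0 int) \<Rightarrow> 'k::field) \<Rightarrow> ('m \<Rightarrow>\<^sub>0 int) \<Rightarrow> 'k"
  where "pullback u \<psi> = (\<lambda>q\<in>G.relations u. \<psi> (substitute q))"

lemma pullback_functionals:
  assumes "\<psi> \<in> carrier (F.functionals u)" shows "pullback u \<psi> \<in> carrier (G.functionals u)"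
  using assms is_subgroupD(4)[OF G.relations_subgroup, of _ u]
  by (auto simp: F.functionals_def G.functionals_def pullback_def additive_on_def substitute_relations
      substitute_obstructed substitute_add)

lemma pullback_linear:
  "pullback u \<in> linear_maps (ring_on UNIV) (F.functionals u) (G.functionals u)"
  by (auto simp: linear_maps_def hom_def pullback_functionals)
     (auto simp: F.functionals_def G.functionals_def pullback_def substitute_relations restrict_def)

end

text \<open>Substituting back and forth moves the unit vector of a generator \<open>w \<in> F\<^sup>u\<close> by the difference of two
  exponents of degree \<open>w\<close>. As \<open>w + u \<notin> S\<close>, this difference is obstructed and \<open>\<psi>\<close> vanishes on it. By
  additivity \<open>\<psi>\<close> does not notice the substitution on any relation.\<close>

lemma pullback_inverse:
  fixes \<psi> :: "_ \<Rightarrow> 'k::field"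
  assumes "two_generating_sets F G S n" "two_generating_sets G F S n'"
    and \<psi>: "\<psi> \<in> carrier (generating_set.functionals F S u)"
  shows "two_generating_sets.pullback F S n' u (two_generating_sets.pullback G S n u \<psi>) = \<psi>"
proof -
  interpret FG: two_generating_sets F G S n by fact
  interpret GF: two_generating_sets G F S n' by fact
  let ?L = "FG.F.relations u"
  have \<psi>: "\<psi> \<in> extensional ?L" "additive_on ?L \<psi>"
    "\<And>q. q \<in> ?L \<Longrightarrow> relation_degree q + u \<notin> S \<Longrightarrow> \<psi> q = 0"
    using \<psi> by (auto simp: FG.F.functionals_def)
  have L: "is_subgroup ?L" by (rule FG.F.relations_subgroup)
  let ?e = "\<lambda>q. q - FG.substitute (GF.substitute q)"
  have diff: "?e (x - y) = ?e x - ?e y" for x y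
    by (simp add: FG.substitute_def GF.substitute_def frag_extend_diff)
  have "?e q \<in> ?L \<and> \<psi> (?e q) = 0" if "Poly_Mapping.keys q \<subseteq> E_set F S u" for q
    using that
  proof (induction q rule: free_Abelian_group_induct[consumes 1, case_names 1 2 3])
    case 1
    then show ?case
      by (simp add: FG.substitute_def GF.substitute_def is_subgroupD[OF L] additive_on_zero[OF L \<psi>(2)])
  next
    case (2 x y)
    then show ?case unfolding diff by (auto simp: additive_on_diff[OF L \<psi>(2)] is_subgroupD[OF L])
  next
    case (3 w)
    then have w: "w \<in> F" "w + u \<notin> S" by (auto simp: E_set_def add.commute)
    let ?w = "Poly_Mapping.single w (1::nat)"
    have "Poly_Mapping.keys ?w \<subseteq> F" using w by simp
    from GF.substitute_exponent[OF this] obtain a where a: "GF.substitute (of_exponent ?w) = of_exponent a"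
      "Poly_Mapping.keys a \<subseteq> G" "monomial_degree a = w" by (auto simp del: One_nat_def)
    from FG.substitute_exponent[OF a(2)] obtain b where b: "FG.substitute (of_exponent a) = of_exponent b"
      "Poly_Mapping.keys b \<subseteq> F" "monomial_degree b = w" using a(3) by auto
    have "?e (frag_of w) = of_exponent ?w - of_exponent b"
      using a(1) b(1) by (simp add: of_exponent_single)
    moreover have "of_exponent ?w - of_exponent b \<in> ?L" "relation_degree (of_exponent ?w - of_exponent b) + u \<notin> S"
      using FG.F.obstructed_difference[of ?w b u] b w by (auto simp del: One_nat_def)
    ultimately show ?case using \<psi>(3) by simp
  qed
  then have "\<psi> (FG.substitute (GF.substitute q)) = \<psi> q" if "q \<in> ?L" for q
    using that additive_on_diff[OF L \<psi>(2) that, of "FG.substitute (GF.substitute q)"]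
      FG.substitute_relations[OF GF.substitute_relations[OF that]]
    by (auto simp: FG.F.relations_def)
  then show ?thesis
    using \<psi>(1) by (auto simp: GF.pullback_def FG.pullback_def GF.substitute_relations
        restrict_def extensional_def fun_eq_iff)
qed

lemma functionals_independent_of_generators:
  assumes "generating_set F S" "generating_set G S"
  shows "module_isomorphic (ring_on UNIV)
    (generating_set.functionals F S u :: ('k::field, _) module) (generating_set.functionals G S u)"
proof -
  interpret F: generating_set F S by fact
  interpret G: generating_set G S by fact
  obtain n where n: "\<And>g. g \<in> G \<Longrightarrow> Poly_Mapping.keys (n g) \<subseteq> F \<and> monomial_degree (n g) = g"
    using F.mem_imp_monomial_degree G.generators_subset by (metis subsetD)
  obtain n' where n': "\<And>g. g \<in> F \<Longrightarrow> Poly_Mapping.keys (n' g) \<subseteq> G \<and> monomial_degree (n' g) = g"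
    using G.mem_imp_monomial_degree F.generators_subset by (metis subsetD)
  interpret FG: two_generating_sets F G S n using n by unfold_locales auto
  interpret GF: two_generating_sets G F S n' using n' by unfold_locales auto
  have "bij_betw (FG.pullback u) (carrier (F.functionals u :: ('k, _) module)) (carrier (G.functionals u))"
    by (rule bij_betw_byWitness[where f' = "GF.pullback u"])
       (use pullback_inverse[OF FG.two_generating_sets_axioms GF.two_generating_sets_axioms]
          pullback_inverse[OF GF.two_generating_sets_axioms FG.two_generating_sets_axioms]
          FG.pullback_functionals GF.pullback_functionals in auto)
  then show ?thesis unfolding module_isomorphic_def using FG.pullback_linear by blast
qed

section \<open>Quotients and tensor products in terms of representatives\<close>

text \<open>The relation group and the free abelian group below the tensor product are both of this form, so
  facts about their cosets are proved once.\<close>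

definition subgroup_monoid :: "'a::ab_group_add set \<Rightarrow> 'a monoid"
  where "subgroup_monoid H = \<lparr>carrier = H, monoid.mult = (+), one = 0\<rparr>"

lemma subgroup_monoid_simps [simp]:
  "carrier (subgroup_monoid H) = H" "x \<otimes>\<^bsub>subgroup_monoid H\<^esub> y = x + y" "\<one>\<^bsub>subgroup_monoid H\<^esub> = 0"
  by (simp_all add: subgroup_monoid_def)

lemma comm_group_subgroup_monoid:
  assumes "is_subgroup H" shows "comm_group (subgroup_monoid H)"
  by (rule comm_groupI)
     (use is_subgroupD[OF assms] in \<open>auto simp: add.assoc add.commute intro: bexI[of _ "- _"]\<close>)

lemma inv_subgroup_monoid:
  assumes "is_subgroup H" "x \<in> H" shows "inv\<^bsub>subgroup_monoid H\<^esub> x = - x"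
  using assms is_subgroupD[OF assms(1)]
  by (intro group.inv_equality comm_group.axioms(2)[OF comm_group_subgroup_monoid]) auto

lemma subgroup_iff_is_subgroup:
  assumes "is_subgroup H"
  shows "subgroup K (subgroup_monoid H) \<longleftrightarrow> is_subgroup K \<and> K \<subseteq> H"
proof
  assume K: "subgroup K (subgroup_monoid H)"
  have "x - y \<in> K" if "x \<in> K" "y \<in> K" for x y
    using subgroup.m_closed[OF K that(1) subgroup.m_inv_closed[OF K that(2)]]
      inv_subgroup_monoid[OF assms] subgroup.subset[OF K] that by auto
  then show "is_subgroup K \<and> K \<subseteq> H"
    using subgroup.subset[OF K] subgroup.one_closed[OF K] by (auto simp: is_subgroup_def)
next
  assume "is_subgroup K \<and> K \<subseteq> H"
  then show "subgroup K (subgroup_monoid H)"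
    using is_subgroupD[of K] inv_subgroup_monoid[OF assms] by (intro subgroup.intro) auto
qed

lemma generate_subgroup_monoid:
  assumes "is_subgroup H" "X \<subseteq> H"
  shows "is_subgroup (generate (subgroup_monoid H) X)" "generate (subgroup_monoid H) X \<subseteq> H"
    "X \<subseteq> generate (subgroup_monoid H) X"
    "is_subgroup K \<Longrightarrow> X \<subseteq> K \<Longrightarrow> generate (subgroup_monoid H) X \<subseteq> K"
proof -
  interpret comm_group "subgroup_monoid H" by (rule comm_group_subgroup_monoid[OF assms(1)])
  have "subgroup (generate (subgroup_monoid H) X) (subgroup_monoid H)"
    by (rule generate_is_subgroup) (use assms in simp)
  then show sub: "is_subgroup (generate (subgroup_monoid H) X)" "generate (subgroup_monoid H) X \<subseteq> H"
    unfolding subgroup_iff_is_subgroup[OF assms(1)] by auto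
  show "X \<subseteq> generate (subgroup_monoid H) X" by (auto intro: generate.incl)
  assume K: "is_subgroup K" "X \<subseteq> K"
  have "is_subgroup (K \<inter> H)" using K(1) assms(1) by (auto simp: is_subgroup_def)
  then have "generate (subgroup_monoid H) X \<subseteq> K \<inter> H"
    by (intro generate_subgroup_incl) (use K assms in \<open>auto simp: subgroup_iff_is_subgroup\<close>)
  then show "generate (subgroup_monoid H) X \<subseteq> K" by blast
qed

lemma r_coset_subgroup_monoid: "B #>\<^bsub>subgroup_monoid H\<^esub> x = (\<lambda>b. b + x) ` B"
  by (auto simp: r_coset_def)

lemma coset_eq_iff:
  assumes "is_subgroup B"
  shows "(\<lambda>b. b + x) ` B = (\<lambda>b. b + y) ` B \<longleftrightarrow> x - y \<in> B"
proof
  assume "(\<lambda>b. b + x) ` B = (\<lambda>b. b + y) ` B"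
  then have "0 + x \<in> (\<lambda>b. b + y) ` B" using is_subgroupD(1)[OF assms] by blast
  then show "x - y \<in> B" by auto
next
  assume xy: "x - y \<in> B"
  show "(\<lambda>b. b + x) ` B = (\<lambda>b. b + y) ` B"
  proof (intro subset_antisym image_subsetI)
    fix b assume "b \<in> B"
    then show "b + x \<in> (\<lambda>b. b + y) ` B" using is_subgroupD(4)[OF assms _ xy]
      by (intro image_eqI[of _ _ "b + (x - y)"]) auto
    show "b + y \<in> (\<lambda>b. b + x) ` B" using is_subgroupD(2)[OF assms \<open>b \<in> B\<close> xy]
      by (intro image_eqI[of _ _ "b - (x - y)"]) auto
  qed
qed

lemma coset_add:
  assumes "is_subgroup B"
  shows "((\<lambda>b. b + x) ` B) <#>\<^bsub>subgroup_monoid H\<^esub> ((\<lambda>b. b + y) ` B) = (\<lambda>b. b + (x + y)) ` B"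
proof (intro subset_antisym subsetI)
  fix z assume "z \<in> ((\<lambda>b. b + x) ` B) <#>\<^bsub>subgroup_monoid H\<^esub> ((\<lambda>b. b + y) ` B)"
  then obtain b c where bc: "b \<in> B" "c \<in> B" "z = (b + x) + (c + y)" by (auto simp: set_mult_def)
  then have "z = (b + c) + (x + y)" by (simp add: algebra_simps)
  then show "z \<in> (\<lambda>b. b + (x + y)) ` B" using is_subgroupD(4)[OF assms bc(1,2)] by blast
next
  fix z assume "z \<in> (\<lambda>b. b + (x + y)) ` B"
  then obtain b where b: "b \<in> B" "z = b + (x + y)" by blast
  have "b + x \<in> (\<lambda>b. b + x) ` B" "y \<in> (\<lambda>b. b + y) ` B"
    using b(1) is_subgroupD(1)[OF assms] by force+
  moreover have "z = (b + x) + y" using b by (simp add: algebra_simps)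
  ultimately show "z \<in> ((\<lambda>b. b + x) ` B) <#>\<^bsub>subgroup_monoid H\<^esub> ((\<lambda>b. b + y) ` B)"
    unfolding set_mult_def subgroup_monoid_simps by blast
qed

lemma free_Abelian_group_eq: "free_Abelian_group A = subgroup_monoid {c. Poly_Mapping.keys c \<subseteq> A}"
  by (simp add: free_Abelian_group_def subgroup_monoid_def)

lemma is_subgroup_frags: "is_subgroup {c :: 'a \<Rightarrow>\<^sub>0 int. Poly_Mapping.keys c \<subseteq> A}"
  using keys_diff by (fastforce simp: is_subgroup_def)

definition tensor_null :: "'a monoid \<Rightarrow> (('a \<times> 'k::field) \<Rightarrow>\<^sub>0 int) set"
  where "tensor_null G = generate (free_Abelian_group (carrier G \<times> UNIV)) (tensor_relations G)"

definition tensor_class :: "'a monoid \<Rightarrow> (('a \<times> 'k::field) \<Rightarrow>\<^sub>0 int) \<Rightarrow> (('a \<times> 'k) \<Rightarrow>\<^sub>0 int) set"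
  where "tensor_class G x = (\<lambda>b. b + x) ` tensor_null G"

locale tensor = G: monoid G for G :: "'a monoid"
begin

lemma tensor_relations_subset: "tensor_relations G \<subseteq> {c :: ('a \<times> 'k::field) \<Rightarrow>\<^sub>0 int. Poly_Mapping.keys c \<subseteq> carrier G \<times> UNIV}"
proof -
  have k: "Poly_Mapping.keys (frag_of p - frag_of q - frag_of r) \<subseteq> {p, q, r}" for p q r :: "'a \<times> 'k"
    using keys_diff[of "frag_of p - frag_of q" "frag_of r"] keys_diff[of "frag_of p" "frag_of q"] by auto
  show ?thesis unfolding tensor_relations_def using k by fastforce
qed

lemmas tensor_null_facts = generate_subgroup_monoid[OF is_subgroup_frags tensor_relations_subset,
    folded free_Abelian_group_eq tensor_null_def]

lemma add_left_null:
  "x \<in> carrier G \<Longrightarrow> y \<in> carrier G \<Longrightarrow> frag_of (x \<otimes>\<^bsub>G\<^esub> y, c) - frag_of (x, c) - frag_of (y, c) \<in> tensor_null G"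
  using tensor_null_facts(3) by (auto simp: tensor_relations_def)

lemma add_right_null:
  "x \<in> carrier G \<Longrightarrow> frag_of (x, c + d) - frag_of (x, c) - frag_of (x, d) \<in> tensor_null G"
  by (rule subsetD[OF tensor_null_facts(3)]) (unfold tensor_relations_def, blast)

lemma zero_right_null: "x \<in> carrier G \<Longrightarrow> frag_of (x, 0) \<in> tensor_null G"
  using is_subgroupD(3)[OF tensor_null_facts(1) add_right_null[of x 0 0]] by simp

lemma zero_left_null: "frag_of (\<one>\<^bsub>G\<^esub>, c) \<in> tensor_null G"
  using is_subgroupD(3)[OF tensor_null_facts(1) add_left_null[of "\<one>\<^bsub>G\<^esub>" "\<one>\<^bsub>G\<^esub>" c]] by simp

lemma class_eq_iff: "tensor_class G x = tensor_class G y \<longleftrightarrow> x - y \<in> tensor_null G"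
  unfolding tensor_class_def by (rule coset_eq_iff[OF tensor_null_facts(1)])

lemma carrier_tensor_field:
  "carrier (tensor_field G) = tensor_class G ` {c. Poly_Mapping.keys c \<subseteq> carrier G \<times> UNIV}"
  by (auto simp: tensor_field_def Let_def FactGroup_def RCOSETS_def free_Abelian_group_eq
      r_coset_subgroup_monoid tensor_class_def tensor_null_def)

lemma add_tensor_field: "tensor_class G x \<oplus>\<^bsub>tensor_field G\<^esub> tensor_class G y = tensor_class G (x + y)"
  using coset_add[OF tensor_null_facts(1)]
  by (simp add: tensor_field_def Let_def FactGroup_def free_Abelian_group_eq tensor_class_def tensor_null_def)

definition scale :: "'k::field \<Rightarrow> (('a \<times> 'k) \<Rightarrow>\<^sub>0 int) \<Rightarrow> (('a \<times> 'k) \<Rightarrow>\<^sub>0 int)"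
  where "scale c = frag_extend (\<lambda>(g, d). frag_of (g, c * d))"

lemma scale_simps: "scale c (frag_of (g, d)) = frag_of (g, c * d)" "scale c (x - y) = scale c x - scale c y"
  by (simp_all add: scale_def frag_extend_diff)

lemma scale_null: "x \<in> tensor_null G \<Longrightarrow> scale c x \<in> tensor_null G"
proof -
  have "is_subgroup {x. scale c x \<in> tensor_null G}"
    using tensor_null_facts(1) by (auto simp: is_subgroup_def scale_simps) (auto simp: scale_def)
  moreover have "tensor_relations G \<subseteq> {x. scale c x \<in> tensor_null G}"
    using add_left_null add_right_null by (auto simp: tensor_relations_def scale_simps ring_distribs)
  ultimately show "x \<in> tensor_null G \<Longrightarrow> scale c x \<in> tensor_null G" using tensor_null_facts(4) by blast
qed

lemma smult_tensor_field: "c \<odot>\<^bsub>tensor_field G\<^esub> tensor_class G x = tensor_class G (scale c x)"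
proof -
  have "c \<odot>\<^bsub>tensor_field G\<^esub> tensor_class G x = (\<Union>y\<in>tensor_class G x. tensor_class G (scale c y))"
    by (simp add: tensor_field_def Let_def free_Abelian_group_eq r_coset_subgroup_monoid
        tensor_class_def tensor_null_def scale_def)
  moreover have "tensor_class G (scale c y) = tensor_class G (scale c x)" if "y \<in> tensor_class G x" for y
  proof -
    have "y - x \<in> tensor_null G" using that by (auto simp: tensor_class_def)
    then show ?thesis using scale_null by (simp add: class_eq_iff flip: scale_simps)
  qed
  moreover have "x \<in> tensor_class G x"
    using is_subgroupD(1)[OF tensor_null_facts(1)] by (force simp: tensor_class_def)
  ultimately show ?thesis by blast
qed

end

section \<open>The functionals as a tensor product\<close>

context generating_set
begin

definition null_relations :: "'m \<Rightarrow> ('m \<Rightarrow>\<^sub>0 int) set"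
  where "null_relations u = generate (subgroup_monoid (relations u)) {q\<in>relations u. relation_degree q + u \<notin> S}"

lemma relation_group_eq: "relation_group (E_set F S u) = subgroup_monoid (relations u)"
  by (simp add: relation_group_def free_Abelian_group_def subgroup_monoid_def kernel_def relations_def)

lemmas null_facts = generate_subgroup_monoid[OF relations_subgroup, of "{q\<in>relations u. relation_degree q + u \<notin> S}" u,
    OF Collect_restrict, folded null_relations_def] for u

lemma functionals_iff:
  "\<psi> \<in> carrier (functionals u) \<longleftrightarrow> \<psi> \<in> extensional (relations u) \<and> additive_on (relations u) \<psi> \<and>
     (\<forall>q\<in>null_relations u. \<psi> q = 0)"
proof -
  have "\<psi> q = 0" if \<psi>: "additive_on (relations u) \<psi>"
    "\<forall>q\<in>relations u. relation_degree q + u \<notin> S \<longrightarrow> \<psi> q = 0" and q: "q \<in> null_relations u" for q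
  proof -
    have "is_subgroup {q\<in>relations u. \<psi> q = 0}"
      using relations_subgroup[of u]
      by (auto simp: is_subgroup_def additive_on_zero[OF relations_subgroup \<psi>(1)]
          additive_on_diff[OF relations_subgroup \<psi>(1)])
    then show ?thesis using null_facts(4)[of "{q\<in>relations u. \<psi> q = 0}" u] \<psi>(2) q by auto
  qed
  then show ?thesis using null_facts(3)[of u] by (auto simp: functionals_def)
qed

definition relation_class :: "'m \<Rightarrow> ('m \<Rightarrow>\<^sub>0 int) \<Rightarrow> ('m \<Rightarrow>\<^sub>0 int) set"
  where "relation_class u q = (\<lambda>b. b + q) ` null_relations u"

lemma relation_quotient_eq: "relation_quotient F S u = subgroup_monoid (relations u) Mod null_relations u"
  by (simp add: relation_quotient_def relation_group_eq null_relations_def Let_def)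

lemma carrier_relation_quotient: "carrier (relation_quotient F S u) = relation_class u ` relations u"
  by (auto simp: relation_quotient_eq FactGroup_def RCOSETS_def r_coset_subgroup_monoid relation_class_def)

lemma mult_relation_quotient:
  "relation_class u p \<otimes>\<^bsub>relation_quotient F S u\<^esub> relation_class u q = relation_class u (p + q)"
  using coset_add[OF null_facts(1)] by (simp add: relation_quotient_eq FactGroup_def relation_class_def)

lemma relation_class_eq_iff: "relation_class u p = relation_class u q \<longleftrightarrow> p - q \<in> null_relations u"
  unfolding relation_class_def by (rule coset_eq_iff[OF null_facts(1)])

definition dual_element :: "'m \<Rightarrow> (('m \<Rightarrow>\<^sub>0 int) \<Rightarrow> int) \<Rightarrow> ('m \<Rightarrow>\<^sub>0 int) set \<Rightarrow> int"
  where "dual_element u f = (\<lambda>X\<in>carrier (relation_quotient F S u). f (SOME x. x \<in> X))"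

lemma dual_element_apply:
  assumes f: "additive_on (relations u) f" "\<forall>b\<in>null_relations u. f b = 0" and x: "x \<in> relations u"
  shows "dual_element u f (relation_class u x) = f x"
proof -
  have "x \<in> relation_class u x"
    using is_subgroupD(1)[OF null_facts(1)] by (force simp: relation_class_def)
  then have "(SOME y. y \<in> relation_class u x) \<in> relation_class u x" by (rule someI)
  then obtain b where b: "b \<in> null_relations u" "(SOME y. y \<in> relation_class u x) = b + x"
    by (auto simp: relation_class_def)
  then have "f (b + x) = f x" using f x null_facts(2)[of u] additive_onD[OF f(1), of b x] by auto
  then show ?thesis using b x by (simp add: dual_element_def carrier_relation_quotient)
qed

lemma dual_element_mem:
  assumes f: "additive_on (relations u) f" "\<forall>b\<in>null_relations u. f b = 0"
  shows "dual_element u f \<in> carrier (int_dual (relation_quotient F S u))"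
proof -
  have "dual_element u f \<in> hom (relation_quotient F S u) integer_group"
    unfolding hom_def
    using additive_onD[OF f(1)] is_subgroupD(4)[OF relations_subgroup[of u]]
    by (auto simp: carrier_relation_quotient mult_relation_quotient dual_element_apply[OF f])
  then show ?thesis by (simp add: int_dual_def dual_element_def)
qed

lemma dual_restricts:
  assumes g: "g \<in> carrier (int_dual (relation_quotient F S u))"
  shows "additive_on (relations u) (\<lambda>x. g (relation_class u x))"
    and "\<forall>b\<in>null_relations u. g (relation_class u b) = 0"
proof -
  have "g (X \<otimes>\<^bsub>relation_quotient F S u\<^esub> Y) = g X + g Y"
    if "X \<in> carrier (relation_quotient F S u)" "Y \<in> carrier (relation_quotient F S u)" for X Y
    using g that by (auto simp: int_dual_def hom_def)
  then show add: "additive_on (relations u) (\<lambda>x. g (relation_class u x))"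
    by (auto simp: additive_on_def carrier_relation_quotient simp flip: mult_relation_quotient)
  show "\<forall>b\<in>null_relations u. g (relation_class u b) = 0"
    using additive_on_zero[OF relations_subgroup add] relation_class_eq_iff[of u _ 0] by (metis diff_zero)
qed

lemma monoid_int_dual: "monoid (int_dual (relation_quotient F S u))"
proof (rule monoidI)
  let ?Q = "relation_quotient F S u"
  have closed: "X \<otimes>\<^bsub>?Q\<^esub> Y \<in> carrier ?Q" if "X \<in> carrier ?Q" "Y \<in> carrier ?Q" for X Y
    using that is_subgroupD(4)[OF relations_subgroup[of u]]
    by (auto simp: carrier_relation_quotient mult_relation_quotient)
  show "x \<otimes>\<^bsub>int_dual ?Q\<^esub> y \<in> carrier (int_dual ?Q)"
    if "x \<in> carrier (int_dual ?Q)" "y \<in> carrier (int_dual ?Q)" for x y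
    using that closed by (auto simp: int_dual_def hom_def)
  show "\<one>\<^bsub>int_dual ?Q\<^esub> \<in> carrier (int_dual ?Q)"
    using closed by (auto simp: int_dual_def hom_def)
qed (auto simp: int_dual_def extensional_def fun_eq_iff restrict_def)

sublocale dual: tensor "int_dual (relation_quotient F S u)" for u
  by (simp add: tensor_def monoid_int_dual)

text \<open>Integers move across the tensor sign. The difference \<open>err m\<close> of the two sides is additive
  in \<open>m\<close> modulo the null elements and is null for \<open>m = 0\<close> and \<open>m = 1\<close>.\<close>

lemma dual_scalar_move:
  assumes g: "g \<in> carrier (int_dual (relation_quotient F S u))"
  shows "(\<lambda>X\<in>carrier (relation_quotient F S u). m * g X) \<in> carrier (int_dual (relation_quotient F S u))"
    and "frag_of (\<lambda>X\<in>carrier (relation_quotient F S u). m * g X, c :: 'k::field_char_0) - frag_of (g, of_int m * c)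
      \<in> tensor_null (int_dual (relation_quotient F S u))"
proof -
  let ?Q = "relation_quotient F S u" and ?D = "int_dual (relation_quotient F S u)"
  let ?g = "\<lambda>m. \<lambda>X\<in>carrier ?Q. m * g X"
  have closed: "X \<otimes>\<^bsub>?Q\<^esub> Y \<in> carrier ?Q" if "X \<in> carrier ?Q" "Y \<in> carrier ?Q" for X Y
    using that is_subgroupD(4)[OF relations_subgroup[of u]]
    by (auto simp: carrier_relation_quotient mult_relation_quotient)
  have mem: "?g m \<in> carrier ?D" for m
    using g closed by (auto simp: int_dual_def hom_def algebra_simps)
  then show "?g m \<in> carrier ?D" .
  note N = is_subgroupD[OF dual.tensor_null_facts(1)[where 'k = 'k, of u]]
  have mult: "?g m \<otimes>\<^bsub>?D\<^esub> ?g n = ?g (m + n)" for m n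
    by (auto simp: int_dual_def algebra_simps restrict_def)
  have one: "?g 1 = g" using g by (auto simp: int_dual_def extensional_def restrict_def)
  define err where "err m = frag_of (?g m, c) - frag_of (g, of_int m * c)" for m
  have step: "err (m + n) - (err m + err n) \<in> tensor_null ?D" for m n
  proof -
    have "err (m + n) - (err m + err n) = (frag_of (?g (m + n), c) - frag_of (?g m, c) - frag_of (?g n, c))
      - (frag_of (g, of_int (m + n) * c) - frag_of (g, of_int m * c) - frag_of (g, of_int n * c))"
      by (simp add: err_def)
    then show ?thesis
      using N(2)[OF dual.add_left_null[OF mem mem, of m n c] dual.add_right_null[OF g, of "of_int m * c" "of_int n * c"]]
      by (simp only: mult of_int_add ring_distribs)
  qed
  have zero: "err 0 \<in> tensor_null ?D"
  proof -
    have z: "?g 0 = \<one>\<^bsub>?D\<^esub>" by (auto simp: int_dual_def restrict_def)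
    have "(0 :: 'k) = of_int 0 * c" by simp
    then show ?thesis
      unfolding err_def z using N(2)[OF dual.zero_left_null dual.zero_right_null[OF g]] by metis
  qed
  have one: "err 1 \<in> tensor_null ?D"
    using one N(1) by (simp add: err_def)
  have nonneg_case: "err (int k) \<in> tensor_null ?D" for k
  proof (induction k)
    case 0 show ?case using zero by simp
  next
    case (Suc k)
    from N(4)[OF step[of 1 "int k"] N(4)[OF one Suc]] show ?case by simp
  qed
  have "err m \<in> tensor_null ?D"
  proof (cases m)
    case (nonneg k) then show ?thesis using nonneg_case by simp
  next
    case (neg k)
    have "err 0 - (err m + err (- m)) \<in> tensor_null ?D" using step[of m "- m"] by simp
    from N(2)[OF N(2)[OF zero this] nonneg_case[of "Suc k"]] show ?thesis using neg by (simp add: add.commute)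
  qed
  then show "frag_of (?g m, c) - frag_of (g, of_int m * c) \<in> tensor_null ?D" by (simp only: err_def)
qed

text \<open>For a dual system \<open>(q\<^sub>i, f\<^sub>i)\<close> the isomorphism \<open>H\<close> is \<open>\<psi> \<mapsto> \<Sum> f\<^sub>i \<otimes> \<psi>(q\<^sub>i)\<close>. Evaluation of tensors at a
  relation \<open>y\<close> sends \<open>H \<psi>\<close> to \<open>\<Sum> \<psi>(q\<^sub>i) f\<^sub>i(y) = \<psi>(y)\<close>, so \<open>H\<close> is injective. It is surjective because a pure
  tensor \<open>g \<otimes> c\<close> is the image of \<open>c g\<close>, by \<open>g = \<Sum> g(q\<^sub>i) f\<^sub>i\<close>.\<close>

lemma tensor_dual_isomorphic:
  "module_isomorphic (ring_on UNIV) (functionals u :: ('k::field_char_0, _) module)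
    (tensor_field (int_dual (relation_quotient F S u)))"
proof -
  let ?Q = "relation_quotient F S u" and ?L = "relations u"
  let ?D = "int_dual ?Q"
  let ?N = "tensor_null ?D :: (_ \<times> 'k \<Rightarrow>\<^sub>0 int) set"
  note N = is_subgroupD[OF dual.tensor_null_facts(1)[where 'k = 'k, of u]]
  note L = is_subgroupD[OF relations_subgroup[of u]]
  obtain n q f where ds: "dual_system ?L (null_relations u) (TYPE('k)) n q f"
    using dual_system_exists[OF finite_generators relations_subset[of _ u] relations_subgroup null_facts(1,2)] by blast
  have q: "\<And>i. i < n \<Longrightarrow> q i \<in> ?L" and f: "\<And>i. i < n \<Longrightarrow> additive_on ?L (f i)"
    and fB: "\<And>i. i < n \<Longrightarrow> \<forall>b\<in>null_relations u. f i b = 0"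
    and rep: "\<And>(\<psi>::_ \<Rightarrow> 'k) y. additive_on ?L \<psi> \<Longrightarrow> (\<forall>b\<in>null_relations u. \<psi> b = 0) \<Longrightarrow> y \<in> ?L \<Longrightarrow>
        \<psi> y = (\<Sum>i<n. \<psi> (q i) * of_int (f i y))"
    using ds unfolding dual_system_def by auto
  define e where "e i = dual_element u (f i)" for i
  have e: "e i \<in> carrier ?D" if "i < n" for i
    unfolding e_def using dual_element_mem[OF f[OF that] fB[OF that]] .
  have e_apply: "e i (relation_class u x) = f i x" if "i < n" "x \<in> ?L" for i x
    unfolding e_def using dual_element_apply[OF f fB] that by blast
  define s where "s v = (\<Sum>i<n. frag_of (e i, v i :: 'k))" for v
  have keys_s: "Poly_Mapping.keys (s v) \<subseteq> carrier ?D \<times> UNIV" for v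
    unfolding s_def using keys_sum[of "\<lambda>i. frag_of (e i, v i)" "{..<n}"] e by fastforce
  have s_add: "s (\<lambda>i. v i + w i) - s v - s w \<in> ?N" for v w
  proof -
    have "s (\<lambda>i. v i + w i) - s v - s w
        = (\<Sum>i<n. frag_of (e i, v i + w i) - frag_of (e i, v i) - frag_of (e i, w i))"
      by (simp add: s_def sum_subtractf)
    also have "\<dots> \<in> ?N"
      by (rule is_subgroup_sum[OF dual.tensor_null_facts(1)], rule dual.add_right_null[OF e]) simp
    finally show ?thesis .
  qed
  define H where "H \<psi> = tensor_class ?D (s (\<lambda>i. \<psi> (q i)))" for \<psi> :: "_ \<Rightarrow> 'k"
  have "H \<in> linear_maps (ring_on UNIV) (functionals u) (tensor_field ?D)"
    unfolding linear_maps_def hom_def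
  proof (intro CollectI conjI ballI)
    show "H \<in> carrier (add_monoid (functionals u)) \<rightarrow> carrier (add_monoid (tensor_field ?D))"
      using keys_s by (auto simp: H_def dual.carrier_tensor_field)
    fix \<psi> \<phi> :: "_ \<Rightarrow> 'k"
    have "H (\<lambda>x\<in>?L. \<psi> x + \<phi> x) = tensor_class ?D (s (\<lambda>i. \<psi> (q i) + \<phi> (q i)))"
      by (simp add: H_def s_def q)
    also have "\<dots> = tensor_class ?D (s (\<lambda>i. \<psi> (q i)) + s (\<lambda>i. \<phi> (q i)))"
      using s_add[of "\<lambda>i. \<psi> (q i)" "\<lambda>i. \<phi> (q i)"] by (simp add: dual.class_eq_iff diff_diff_eq)
    finally show "H (\<psi> \<otimes>\<^bsub>add_monoid (functionals u)\<^esub> \<phi>) = H \<psi> \<otimes>\<^bsub>add_monoid (tensor_field ?D)\<^esub> H \<phi>"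
      by (simp add: functionals_def H_def dual.add_tensor_field)
  next
    fix c :: 'k and \<psi>
    have "dual.scale c (s v) = s (\<lambda>i. c * v i)" for v
      by (simp add: s_def dual.scale_def frag_extend_sum)
    then show "H (c \<odot>\<^bsub>functionals u\<^esub> \<psi>) = c \<odot>\<^bsub>tensor_field ?D\<^esub> H \<psi>"
      by (simp add: functionals_def H_def dual.smult_tensor_field) (simp add: s_def q)
  qed
  moreover have "inj_on H (carrier (functionals u))"
  proof (rule inj_onI)
    fix \<psi> \<phi> :: "_ \<Rightarrow> 'k"
    assume \<psi>: "\<psi> \<in> carrier (functionals u)" and \<phi>: "\<phi> \<in> carrier (functionals u)" and eq: "H \<psi> = H \<phi>"
    have "\<psi> y = \<phi> y" if y: "y \<in> ?L" for y
    proof -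
      (* evaluation at y of a formal combination of pure tensors *)
      define ev where "ev = pairing (\<lambda>(g, c). of_int (g (relation_class u y)) * c :: 'k)"
      have ev: "ev (x - z) = ev x - ev z" for x z
        by (simp add: ev_def pairing_diff)
      have ev_frag: "ev (frag_of (g, c)) = of_int (g (relation_class u y)) * c" for g c
        by (simp add: ev_def pairing_frag_of)
      have yQ: "relation_class u y \<in> carrier ?Q" using y by (simp add: carrier_relation_quotient)
      have "is_subgroup {x. ev x = 0}" by (auto simp: is_subgroup_def ev) (simp add: ev_def pairing_zero)
      moreover have "tensor_relations ?D \<subseteq> {x. ev x = 0}"
        using yQ by (auto simp: tensor_relations_def ev ev_frag int_dual_def ring_distribs)
      ultimately have "?N \<subseteq> {x. ev x = 0}" by (rule dual.tensor_null_facts(4))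
      then have "ev (s (\<lambda>i. \<psi> (q i))) = ev (s (\<lambda>i. \<phi> (q i)))"
        using eq by (auto simp: H_def dual.class_eq_iff ev)
      moreover have "ev (s v) = (\<Sum>i<n. v i * of_int (f i y))" for v
      proof -
        have "ev (s v) = (\<Sum>i<n. ev (frag_of (e i, v i)))"
          unfolding s_def ev_def by (rule additive_on_sum[OF is_subgroup_UNIV pairing_additive_on UNIV_I])
        then show ?thesis using e_apply y by (simp add: ev_frag mult.commute)
      qed
      ultimately show ?thesis using rep \<psi> \<phi> y by (simp add: functionals_iff)
    qed
    then show "\<psi> = \<phi>" using \<psi> \<phi> by (auto simp: functionals_iff intro: extensionalityI)
  qed
  moreover have "tensor_class ?D x \<in> H ` carrier (functionals u)"
    if "Poly_Mapping.keys x \<subseteq> carrier ?D \<times> UNIV" for x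
  proof -
    have "\<exists>\<psi>\<in>carrier (functionals u). x - s (\<lambda>i. \<psi> (q i)) \<in> ?N"
      using that
    proof (induction x rule: free_Abelian_group_induct[consumes 1, case_names zero diff one])
      case zero
      have "(\<lambda>x\<in>?L. 0 :: 'k) \<in> carrier (functionals u)"
        using L null_facts(2)[of u] by (auto simp: functionals_iff additive_on_def)
      moreover have "0 - s (\<lambda>i. 0) \<in> ?N"
        unfolding s_def using is_subgroup_sum[OF dual.tensor_null_facts(1)] dual.zero_right_null[OF e] N
        by (metis (no_types, lifting) diff_0 lessThan_iff)
      ultimately show ?case by (intro bexI[of _ "\<lambda>x\<in>?L. 0"]) (auto simp: s_def q)
    next
      case (diff x y)
      then obtain \<psi> \<phi> where \<psi>: "\<psi> \<in> carrier (functionals u)" "x - s (\<lambda>i. \<psi> (q i)) \<in> ?N"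
        and \<phi>: "\<phi> \<in> carrier (functionals u)" "y - s (\<lambda>i. \<phi> (q i)) \<in> ?N" by blast
      have mem: "(\<lambda>x\<in>?L. \<psi> x - \<phi> x) \<in> carrier (functionals u)"
        using \<psi>(1) \<phi>(1) L(4) null_facts(2)[of u] by (auto simp: functionals_iff additive_on_def)
      have "s (\<lambda>i. \<psi> (q i)) - s (\<lambda>i. \<psi> (q i) - \<phi> (q i)) - s (\<lambda>i. \<phi> (q i)) \<in> ?N"
        using s_add[of "\<lambda>i. \<psi> (q i) - \<phi> (q i)" "\<lambda>i. \<phi> (q i)"] by simp
      from N(4)[OF N(2)[OF \<psi>(2) \<phi>(2)] this]
      have "x - y - s (\<lambda>i. \<psi> (q i) - \<phi> (q i)) \<in> ?N" by (simp add: algebra_simps)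
      moreover have "s (\<lambda>i. (\<lambda>x\<in>?L. \<psi> x - \<phi> x) (q i)) = s (\<lambda>i. \<psi> (q i) - \<phi> (q i))"
        by (simp add: s_def q)
      ultimately show ?case by (intro bexI[OF _ mem]) simp
    next
      case (one a)
      then obtain g c where a: "a = (g, c)" and g: "g \<in> carrier ?D" by auto
      define \<gamma> where "\<gamma> = (\<lambda>x. g (relation_class u x))"
      have \<gamma>: "additive_on ?L \<gamma>" "\<forall>b\<in>null_relations u. \<gamma> b = 0"
        using dual_restricts[OF g] by (simp_all add: \<gamma>_def)
      have mem: "(\<lambda>x\<in>?L. of_int (\<gamma> x) * c) \<in> carrier (functionals u)"
        using \<gamma> L(4) null_facts(2)[of u] by (auto simp: functionals_iff additive_on_def ring_distribs)
      (* the dual system reconstructs k-valued functionals, hence integral ones after embedding in k *)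
      have g_rep: "\<gamma> x = (\<Sum>i<n. \<gamma> (q i) * f i x)" if "x \<in> ?L" for x
      proof -
        have "of_int (\<gamma> x) = (\<Sum>i<n. of_int (\<gamma> (q i)) * of_int (f i x) :: 'k)"
          by (rule rep) (use \<gamma> that in \<open>auto simp: additive_on_def\<close>)
        also have "\<dots> = of_int (\<Sum>i<n. \<gamma> (q i) * f i x)" by simp
        finally show ?thesis by (simp only: of_int_eq_iff)
      qed
      (* partial sums of the expansion of g, so that linearity is applied to one summand at a time *)
      define h where "h k = (\<lambda>X\<in>carrier ?Q. \<Sum>i<k. \<gamma> (q i) * e i X)" for k
      have h: "h k \<in> carrier ?D \<and> frag_of (h k, c) - (\<Sum>i<k. frag_of (e i, of_int (\<gamma> (q i)) * c)) \<in> ?N"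
        if "k \<le> n" for k
        using that
      proof (induction k)
        case 0
        have "h 0 = \<one>\<^bsub>?D\<^esub>" by (auto simp: h_def int_dual_def restrict_def)
        then show ?case using dual.zero_left_null[of u c] monoid.one_closed[OF monoid_int_dual] by simp
      next
        case (Suc k)
        let ?m = "\<lambda>X\<in>carrier ?Q. \<gamma> (q k) * e k X"
        have k: "k < n" using Suc by simp
        have hk: "h k \<in> carrier ?D"
          "frag_of (h k, c) - (\<Sum>i<k. frag_of (e i, of_int (\<gamma> (q i)) * c)) \<in> ?N"
          using Suc by auto
        note m = dual_scalar_move[OF e[OF k], of "\<gamma> (q k)"]
        have hS: "h (Suc k) = h k \<otimes>\<^bsub>?D\<^esub> ?m" by (auto simp: h_def int_dual_def restrict_def)
        have "frag_of (h (Suc k), c) - frag_of (h k, c) - frag_of (?m, c) \<in> ?N"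
          unfolding hS by (rule dual.add_left_null[OF hk(1) m(1)])
        from N(4)[OF N(4)[OF this m(2)[of c]] hk(2)]
        have "frag_of (h (Suc k), c) - (\<Sum>i<Suc k. frag_of (e i, of_int (\<gamma> (q i)) * c)) \<in> ?N"
          by (simp add: algebra_simps)
        moreover have "h (Suc k) \<in> carrier ?D"
          unfolding hS by (rule monoid.m_closed[OF monoid_int_dual hk(1) m(1)])
        ultimately show ?case by blast
      qed
      have "h n = g"
        using g g_rep e_apply
        by (auto simp: h_def carrier_relation_quotient \<gamma>_def int_dual_def extensional_def restrict_def fun_eq_iff)
      then have "frag_of a - s (\<lambda>i. of_int (\<gamma> (q i)) * c) \<in> ?N"
        using h[of n] by (simp add: a s_def)
      moreover have "s (\<lambda>i. (\<lambda>x\<in>?L. of_int (\<gamma> x) * c) (q i)) = s (\<lambda>i. of_int (\<gamma> (q i)) * c)"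
        by (simp add: s_def q)
      ultimately show ?case by (intro bexI[OF _ mem]) simp
    qed
    then show ?thesis by (auto simp: H_def dual.class_eq_iff)
  qed
  ultimately show ?thesis
    unfolding module_isomorphic_def bij_betw_def linear_maps_def hom_def
    by (intro bexI[of _ H]) (auto simp: dual.carrier_tensor_field)
qed

end

section \<open>Derivations of the polynomial ring\<close>

lemma poly_mapping_sum_singles:
  "f = (\<Sum>m\<in>Poly_Mapping.keys f. Poly_Mapping.single m (Poly_Mapping.lookup f m))"
  by (rule poly_mapping_eqI) (auto simp: lookup_sum lookup_single when_def sum.delta' in_keys_iff)

lemma additive_eqI_singles:
  fixes P Q :: "('a \<Rightarrow>\<^sub>0 'b::ab_group_add) \<Rightarrow> 'c::ab_group_add"
  assumes "\<And>f g. P (f + g) = P f + P g" "\<And>f g. Q (f + g) = Q f + Q g"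
    and "\<And>m c. P (Poly_Mapping.single m c) = Q (Poly_Mapping.single m c)"
  shows "P f = Q f"
proof -
  have P: "additive_on UNIV P" and Q: "additive_on UNIV Q" using assms(1,2) by (auto simp: additive_on_def)
  show ?thesis
    by (subst (1 2) poly_mapping_sum_singles[of f])
       (simp only: additive_on_sum[OF is_subgroup_UNIV P UNIV_I] additive_on_sum[OF is_subgroup_UNIV Q UNIV_I] assms(3))
qed

lemma sum_keys_singles_add:
  assumes "\<And>m. g m 0 = 0" "\<And>m a b. g m (a + b) = g m a + g m b"
  shows "(\<Sum>m\<in>Poly_Mapping.keys (p + q). g m (Poly_Mapping.lookup (p + q) m))
    = (\<Sum>m\<in>Poly_Mapping.keys p. g m (Poly_Mapping.lookup p m))
      + (\<Sum>m\<in>Poly_Mapping.keys q. g m (Poly_Mapping.lookup q m))"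
  by (rule setsum_keys_plus_distrib) (use assms in auto)

text \<open>The derivation over the presentation that sends \<open>z\<^sup>m\<close> to \<open>\<langle>c, m\<rangle> \<chi>\<^bsup>deg m + u\<^esup>\<close>; on a variable \<open>z\<^sub>w\<close> it takes the
  value \<open>c\<^sub>w \<chi>\<^bsup>w + u\<^esup>\<close>. Its values are in the group algebra of the whole lattice: only on
  the toric ideal will they be required to lie in \<open>k[S]\<close>, and this depends on \<open>c\<close>.\<close>

definition log_derivation ::
    "('m \<Rightarrow> 'k) \<Rightarrow> 'm \<Rightarrow> (('m::ab_group_add \<Rightarrow>\<^sub>0 nat) \<Rightarrow>\<^sub>0 'k::field) \<Rightarrow> 'm \<Rightarrow>\<^sub>0 'k"
  where "log_derivation c u f = (\<Sum>m\<in>Poly_Mapping.keys f.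
    Poly_Mapping.single (monomial_degree m + u) (Poly_Mapping.lookup f m * pairing c (of_exponent m)))"

lemma log_derivation_add: "log_derivation c u (f + g) = log_derivation c u f + log_derivation c u g"
  unfolding log_derivation_def
  by (rule sum_keys_singles_add[where g = "\<lambda>m a. Poly_Mapping.single (monomial_degree m + u) (a * pairing c (of_exponent m))"])
     (auto simp: single_add ring_distribs)

lemma log_derivation_single: "log_derivation c u (Poly_Mapping.single m a)
    = Poly_Mapping.single (monomial_degree m + u) (a * pairing c (of_exponent m))"
  by (simp add: log_derivation_def)

lemma log_derivation_additive_on: "additive_on H (log_derivation c u)"
  by (simp add: additive_on_def log_derivation_add)

lemmas log_derivation_zero = additive_on_zero[OF is_subgroup_UNIV log_derivation_additive_on]
lemmas log_derivation_diff = additive_on_diff[OF is_subgroup_UNIV log_derivation_additive_on UNIV_I UNIV_I]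

lemma single_power:
  "Poly_Mapping.single w (1::'k::field) ^ n
    = Poly_Mapping.single (w [^]\<^bsub>additive_group\<^esub> (n::nat)) 1" for w :: "'m::ab_group_add"
  by (induction n) (simp_all add: mult_single add.commute)

lemma presentation_add: "presentation (f + g) = presentation f + presentation g"
  unfolding presentation_def
  by (rule sum_keys_singles_add[where g = "\<lambda>m a. Poly_Mapping.single 0 a *
        (\<Prod>w\<in>Poly_Mapping.keys m. Poly_Mapping.single w 1 ^ Poly_Mapping.lookup m w)"])
     (auto simp: single_add ring_distribs)

lemma presentation_single: "presentation (Poly_Mapping.single m (a::'k::field)) = Poly_Mapping.single (monomial_degree m) a"
proof -
  have "(\<Prod>w\<in>W. Poly_Mapping.single w (1::'k) ^ Poly_Mapping.lookup m w)
      = Poly_Mapping.single (\<Sum>w\<in>W. w [^]\<^bsub>additive_group\<^esub> Poly_Mapping.lookup m w) 1" for W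
    by (induction W rule: infinite_finite_induct) (auto simp: single_power mult_single)
  then show ?thesis by (simp add: presentation_def monomial_degree_def mult_single)
qed

lemma presentation_additive_on: "additive_on H presentation"
  by (simp add: additive_on_def presentation_add)

lemmas presentation_zero = additive_on_zero[OF is_subgroup_UNIV presentation_additive_on]
lemmas presentation_diff = additive_on_diff[OF is_subgroup_UNIV presentation_additive_on UNIV_I UNIV_I]

lemma presentation_eq_sum:
  "presentation f = (\<Sum>m\<in>Poly_Mapping.keys f. Poly_Mapping.single (monomial_degree m) (Poly_Mapping.lookup f m))"
  by (subst poly_mapping_sum_singles[of f])
     (simp only: additive_on_sum[OF is_subgroup_UNIV presentation_additive_on UNIV_I] presentation_single)

lemma presentation_mult: "presentation (f * g) = presentation f * presentation g"
proof (rule additive_eqI_singles[where P = "\<lambda>f. presentation (f * g)" and Q = "\<lambda>f. presentation f * presentation g"])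
  fix m :: "'a \<Rightarrow>\<^sub>0 nat" and a :: 'b
  show "presentation (Poly_Mapping.single m a * g) = presentation (Poly_Mapping.single m a) * presentation g"
    by (rule additive_eqI_singles[where P = "\<lambda>g. presentation (Poly_Mapping.single m a * g)"
          and Q = "\<lambda>g. presentation (Poly_Mapping.single m a) * presentation g"])
       (simp_all add: presentation_add presentation_single mult_single monomial_degree_add distrib_left)
qed (simp_all add: presentation_add distrib_right)

text \<open>Both sides are biadditive, so it is enough to compare them on monomials, where the rule says
  that the linear form \<open>\<langle>c, \<cdot>\<rangle>\<close> is additive.\<close>

lemma log_derivation_mult:
  "log_derivation c u (f * g) = presentation f * log_derivation c u g + log_derivation c u f * presentation g"
proof (rule additive_eqI_singles[where P = "\<lambda>f. log_derivation c u (f * g)"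
      and Q = "\<lambda>f. presentation f * log_derivation c u g + log_derivation c u f * presentation g"])
  fix m :: "'a \<Rightarrow>\<^sub>0 nat" and a :: 'b
  show "log_derivation c u (Poly_Mapping.single m a * g) = presentation (Poly_Mapping.single m a) * log_derivation c u g
      + log_derivation c u (Poly_Mapping.single m a) * presentation g"
    by (rule additive_eqI_singles[where P = "\<lambda>g. log_derivation c u (Poly_Mapping.single m a * g)"
          and Q = "\<lambda>g. presentation (Poly_Mapping.single m a) * log_derivation c u g
              + log_derivation c u (Poly_Mapping.single m a) * presentation g"])
       (simp_all add: presentation_add log_derivation_add presentation_single log_derivation_single
          mult_single monomial_degree_add of_exponent_add pairing_add algebra_simps flip: single_add)
qed (simp_all add: presentation_add log_derivation_add algebra_simps)

lemma partial_derivative_add: "partial_derivative w (f + g) = partial_derivative w f + partial_derivative w g"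
  unfolding partial_derivative_def
  by (rule sum_keys_singles_add[where g = "\<lambda>m a. Poly_Mapping.single (m - Poly_Mapping.single w 1)
       (of_nat (Poly_Mapping.lookup m w) * a)"])
     (auto simp: single_add ring_distribs)

text \<open>The partial derivatives are the logarithmic derivations of the coordinate functions. In a monomial
  without \<open>z\<^sub>w\<close> the truncated exponent on the left is wrong, but its coefficient is zero.\<close>

lemma presentation_partial_derivative:
  "presentation (partial_derivative w f) = log_derivation (\<lambda>v. if v = w then 1 else 0) (- w) f"
proof (rule additive_eqI_singles[where P = "\<lambda>f. presentation (partial_derivative w f)"])
  fix m :: "'a \<Rightarrow>\<^sub>0 nat" and a :: 'b
  have "partial_derivative w (Poly_Mapping.single m a) =
      Poly_Mapping.single (m - Poly_Mapping.single w 1) (of_nat (Poly_Mapping.lookup m w) * a)"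
    by (simp add: partial_derivative_def)
  moreover have "monomial_degree (m - Poly_Mapping.single w 1) = monomial_degree m + - w"
    if "w \<in> Poly_Mapping.keys m"
    using arg_cong[OF split_exponent(1)[OF that], of monomial_degree]
    by (simp add: monomial_degree_add del: One_nat_def)
  ultimately show "presentation (partial_derivative w (Poly_Mapping.single m a))
      = log_derivation (\<lambda>v. if v = w then 1 else 0) (- w) (Poly_Mapping.single m a)"
    by (cases "w \<in> Poly_Mapping.keys m")
       (simp_all add: presentation_zero presentation_single log_derivation_single pairing_indicator in_keys_iff
          mult.commute del: One_nat_def)
qed (simp_all add: partial_derivative_add presentation_add log_derivation_add)

lemma log_derivation_add_left:
  "log_derivation (\<lambda>v. c v + d v) u f = log_derivation c u f + log_derivation d u f"
  by (simp add: log_derivation_def pairing_add_left ring_distribs single_add sum.distrib)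

lemma log_derivation_indicator:
  "log_derivation (\<lambda>v. if v = w then a else 0) u f
    = Poly_Mapping.single (u + w) a * log_derivation (\<lambda>v. if v = w then 1 else 0) (- w) f"
  by (rule additive_eqI_singles[where P = "log_derivation (\<lambda>v. if v = w then a else 0) u"])
     (simp_all add: log_derivation_add log_derivation_single distrib_left mult_single pairing_indicator algebra_simps)

lemma lookup_mult_group:
  fixes x :: "'m::ab_group_add \<Rightarrow>\<^sub>0 'k::field"
  shows "Poly_Mapping.lookup (a * x) t
    = (\<Sum>s\<in>Poly_Mapping.keys a. Poly_Mapping.lookup a s * Poly_Mapping.lookup x (t - s))"
proof (rule additive_eqI_singles[where P = "\<lambda>a. Poly_Mapping.lookup (a * x) t"])
  fix s and c :: 'k
  have "Poly_Mapping.lookup (Poly_Mapping.single s c * x) t = c * Poly_Mapping.lookup x (t - s)"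
  proof (rule additive_eqI_singles[where P = "\<lambda>x. Poly_Mapping.lookup (Poly_Mapping.single s c * x) t"])
    fix r and d :: 'k
    show "Poly_Mapping.lookup (Poly_Mapping.single s c * Poly_Mapping.single r d) t
        = c * Poly_Mapping.lookup (Poly_Mapping.single r d) (t - s)"
      by (auto simp: mult_single lookup_single when_def algebra_simps)
  qed (simp_all add: lookup_add ring_distribs)
  then show "Poly_Mapping.lookup (Poly_Mapping.single s c * x) t
    = (\<Sum>s'\<in>Poly_Mapping.keys (Poly_Mapping.single s c).
        Poly_Mapping.lookup (Poly_Mapping.single s c) s' * Poly_Mapping.lookup x (t - s'))"
    by simp
next
  show "(\<Sum>s\<in>Poly_Mapping.keys (f + g). Poly_Mapping.lookup (f + g) s * Poly_Mapping.lookup x (t - s))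
    = (\<Sum>s\<in>Poly_Mapping.keys f. Poly_Mapping.lookup f s * Poly_Mapping.lookup x (t - s))
    + (\<Sum>s\<in>Poly_Mapping.keys g. Poly_Mapping.lookup g s * Poly_Mapping.lookup x (t - s))" for f g
    by (rule sum_keys_singles_add[where g = "\<lambda>s a. a * Poly_Mapping.lookup x (t - s)"])
       (simp_all add: ring_distribs)
qed (simp add: lookup_add ring_distribs)

lemma ring_on_simps [simp]:
  "carrier (ring_on C) = C" "x \<otimes>\<^bsub>ring_on C\<^esub> y = x * y" "\<zero>\<^bsub>ring_on C\<^esub> = 0" "x \<oplus>\<^bsub>ring_on C\<^esub> y = x + y"
  by (simp_all add: ring_on_def)

definition pure_binomial :: "('m \<Rightarrow>\<^sub>0 nat) \<Rightarrow> ('m \<Rightarrow>\<^sub>0 nat) \<Rightarrow> (('m \<Rightarrow>\<^sub>0 nat) \<Rightarrow>\<^sub>0 'k::field)"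
  where "pure_binomial a b = Poly_Mapping.single a 1 - Poly_Mapping.single b 1"

section \<open>The toric ideal and the conormal module\<close>

context generating_set
begin

abbreviation polynomials :: "(('m \<Rightarrow>\<^sub>0 nat) \<Rightarrow>\<^sub>0 'k::field) set"
  where "polynomials \<equiv> carrier (poly_ring F)"

lemma polynomials_iff: "f \<in> polynomials \<longleftrightarrow> (\<forall>m\<in>Poly_Mapping.keys f. Poly_Mapping.keys m \<subseteq> F)"
  by (simp add: poly_ring_def)

lemma polynomials_closed:
  assumes "f \<in> polynomials" "g \<in> polynomials"
  shows "f + g \<in> polynomials" "f - g \<in> polynomials" "f * g \<in> polynomials"
proof -
  show "f + g \<in> polynomials" using assms keys_add[of f g] by (auto simp: polynomials_iff)
  have "Poly_Mapping.keys (f - g) \<subseteq> Poly_Mapping.keys f \<union> Poly_Mapping.keys g"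
    by (auto simp: in_keys_iff lookup_minus)
  then show "f - g \<in> polynomials" using assms by (auto simp: polynomials_iff)
  show "f * g \<in> polynomials"
    using assms keys_mult[of f g] by (fastforce simp: polynomials_iff keys_add_nat)
qed

lemma polynomials_subgroup: "is_subgroup polynomials"
  by (auto simp: is_subgroup_def polynomials_closed) (simp add: polynomials_iff)

lemma single_polynomial: "Poly_Mapping.keys m \<subseteq> F \<Longrightarrow> Poly_Mapping.single m a \<in> polynomials"
  by (auto simp: polynomials_iff split: if_splits)

lemma toric_ideal_iff: "f \<in> toric_ideal F S \<longleftrightarrow> f \<in> polynomials \<and> presentation f = 0"
  by (simp add: toric_ideal_def a_kernel_def kernel_def monoid_algebra_def)

lemma toric_ideal_subgroup: "is_subgroup (toric_ideal F S)"
  by (auto simp: is_subgroup_def toric_ideal_iff presentation_zero presentation_diff polynomials_closed)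
     (simp add: polynomials_iff)

lemma toric_ideal_mult: "r \<in> polynomials \<Longrightarrow> f \<in> toric_ideal F S \<Longrightarrow> r * f \<in> toric_ideal F S"
  by (simp add: toric_ideal_iff polynomials_closed presentation_mult)

lemma pure_binomial_mem:
  assumes "Poly_Mapping.keys a \<subseteq> F" "Poly_Mapping.keys b \<subseteq> F" "monomial_degree a = monomial_degree b"
  shows "pure_binomial a b \<in> toric_ideal F S"
  using assms
  by (simp add: toric_ideal_iff pure_binomial_def polynomials_closed single_polynomial presentation_diff presentation_single)

text \<open>The toric ideal is spanned by binomials: if \<open>a\<close> occurs in \<open>f\<close>, another monomial \<open>b\<close> of the same degree
  must occur, since otherwise the coefficient of \<open>f\<close> at \<open>a\<close> survives in the presentation. Subtracting
  the right multiple of \<open>z\<^sup>a - z\<^sup>b\<close> removes \<open>a\<close> and adds no new monomial.\<close>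

lemma toric_ideal_induct [consumes 1, case_names zero step]:
  fixes f :: "('m \<Rightarrow>\<^sub>0 nat) \<Rightarrow>\<^sub>0 'k::field"
  assumes "f \<in> toric_ideal F S"
    and zero: "P 0"
    and step: "\<And>f a b x. f \<in> toric_ideal F S \<Longrightarrow> P f \<Longrightarrow> Poly_Mapping.keys a \<subseteq> F \<Longrightarrow> Poly_Mapping.keys b \<subseteq> F \<Longrightarrow>
      monomial_degree a = monomial_degree b \<Longrightarrow> P (f + Poly_Mapping.single 0 x * pure_binomial a b)"
  shows "P f"
  using assms(1)
proof (induction "card (Poly_Mapping.keys f)" arbitrary: f rule: less_induct)
  case less
  show ?case
  proof (cases "f = 0")
    case True then show ?thesis using zero by simp
  next
    case False
    then obtain a where a: "a \<in> Poly_Mapping.keys f" by (metis all_not_in_conv keys_eq_empty)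
    have fI: "f \<in> polynomials" "presentation f = 0" using less.prems by (auto simp: toric_ideal_iff)
    have "\<exists>b\<in>Poly_Mapping.keys f. b \<noteq> a \<and> monomial_degree b = monomial_degree a"
    proof (rule ccontr)
      assume none: "\<not> ?thesis"
      have "Poly_Mapping.lookup (presentation f) (monomial_degree a)
          = (\<Sum>m\<in>Poly_Mapping.keys f. if monomial_degree m = monomial_degree a then Poly_Mapping.lookup f m else 0)"
        by (simp add: presentation_eq_sum[of f] lookup_sum lookup_single when_def)
      also have "\<dots> = (\<Sum>m\<in>Poly_Mapping.keys f. if m = a then Poly_Mapping.lookup f a else 0)"
        by (rule sum.cong) (use none in auto)
      finally have "Poly_Mapping.lookup (presentation f) (monomial_degree a)
          = (\<Sum>m\<in>Poly_Mapping.keys f. if m = a then Poly_Mapping.lookup f a else 0)" .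
      then show False using a fI(2) by (simp add: sum.delta in_keys_iff)
    qed
    then obtain b where b: "b \<in> Poly_Mapping.keys f" "b \<noteq> a" "monomial_degree b = monomial_degree a" by blast
    have kF: "Poly_Mapping.keys a \<subseteq> F" "Poly_Mapping.keys b \<subseteq> F" using a b fI(1) by (auto simp: polynomials_iff)
    define x where "x = Poly_Mapping.lookup f a"
    define g where "g = f - Poly_Mapping.single 0 x * pure_binomial a b"
    have g: "g = f - Poly_Mapping.single a x + Poly_Mapping.single b x"
      by (simp add: g_def pure_binomial_def right_diff_distrib mult_single)
    have gI: "g \<in> toric_ideal F S"
      unfolding g_def
      by (intro is_subgroupD(2)[OF toric_ideal_subgroup] toric_ideal_mult less.prems pure_binomial_mem single_polynomial)
         (use kF b in auto)
    have "Poly_Mapping.keys g \<subseteq> Poly_Mapping.keys f - {a}"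
      using b by (auto simp: g in_keys_iff lookup_add lookup_minus lookup_single when_def x_def split: if_splits)
    then have "card (Poly_Mapping.keys g) < card (Poly_Mapping.keys f)"
      using a by (intro psubset_card_mono) auto
    then have "P g" using less.hyps gI by blast
    from step[OF gI this kF b(3)[symmetric], of x] show ?thesis by (simp add: g_def)
  qed
qed

lemma square_ideal_induct [consumes 1, case_names prod sum]:
  assumes "j \<in> square_ideal F S"
    and "\<And>f g. f \<in> toric_ideal F S \<Longrightarrow> g \<in> toric_ideal F S \<Longrightarrow> P (f * g)"
    and "\<And>x y. P x \<Longrightarrow> P y \<Longrightarrow> P (x + y)"
  shows "P j"
  using assms(1) unfolding square_ideal_def
  by (induction rule: ideal_prod.induct) (use assms(2,3) in \<open>auto simp: poly_ring_def\<close>)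

lemma square_ideal_prod: "f \<in> toric_ideal F S \<Longrightarrow> g \<in> toric_ideal F S \<Longrightarrow> f * g \<in> square_ideal F S"
  using ideal_prod.prod[of f "toric_ideal F S" g "toric_ideal F S" "poly_ring F"]
  by (simp add: square_ideal_def poly_ring_def)

lemma square_ideal_add: "x \<in> square_ideal F S \<Longrightarrow> y \<in> square_ideal F S \<Longrightarrow> x + y \<in> square_ideal F S"
  using ideal_prod.sum[of x "poly_ring F" "toric_ideal F S" "toric_ideal F S" y]
  by (simp add: square_ideal_def poly_ring_def)

lemma square_ideal_subgroup: "is_subgroup (square_ideal F S :: (('m \<Rightarrow>\<^sub>0 nat) \<Rightarrow>\<^sub>0 'k::field) set)"
proof -
  have "- x \<in> square_ideal F S" if "x \<in> square_ideal F S" for x :: "('m \<Rightarrow>\<^sub>0 nat) \<Rightarrow>\<^sub>0 'k"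
    using that
  proof (induction rule: square_ideal_induct)
    case (prod f g)
    then show ?case using square_ideal_prod[of "- f" g] is_subgroupD(3)[OF toric_ideal_subgroup, of f] by simp
  next
    case (sum x y)
    from square_ideal_add[OF this] show ?case by (simp add: algebra_simps)
  qed
  then have "x - y \<in> square_ideal F S" if "x \<in> square_ideal F S" "y \<in> square_ideal F S"
    for x y :: "('m \<Rightarrow>\<^sub>0 nat) \<Rightarrow>\<^sub>0 'k"
    using square_ideal_add[of x "- y"] that by simp
  then show ?thesis
    using square_ideal_prod[of 0 0] is_subgroupD(1)[OF toric_ideal_subgroup] by (simp add: is_subgroup_def)
qed

lemma square_ideal_mult:
  assumes "r \<in> polynomials" "j \<in> square_ideal F S" shows "r * j \<in> square_ideal F S"
  using assms(2)
proof (induction rule: square_ideal_induct)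
  case (prod f g)
  then show ?case using square_ideal_prod[OF toric_ideal_mult[OF assms(1)]] by (metis mult.assoc)
next
  case (sum x y)
  then show ?case using square_ideal_add by (simp add: distrib_left)
qed

text \<open>In the Leibniz rule both summands contain the presentation of an element of the ideal.\<close>

lemma log_derivation_square:
  assumes "j \<in> square_ideal F S" shows "log_derivation c u j = 0"
  using assms
  by (induction rule: square_ideal_induct) (auto simp: log_derivation_mult toric_ideal_iff log_derivation_add)

definition conormal_class :: "(('m \<Rightarrow>\<^sub>0 nat) \<Rightarrow>\<^sub>0 'k::field) \<Rightarrow> (('m \<Rightarrow>\<^sub>0 nat) \<Rightarrow>\<^sub>0 'k) set"
  where "conormal_class f = (\<lambda>j. j + f) ` square_ideal F S"

lemma conormal_class_eq_iff: "conormal_class f = conormal_class g \<longleftrightarrow> f - g \<in> square_ideal F S"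
  unfolding conormal_class_def by (rule coset_eq_iff[OF square_ideal_subgroup])

lemma poly_ring_coset: "square_ideal F S +>\<^bsub>poly_ring F\<^esub> f = conormal_class f"
  by (auto simp: a_r_coset_def r_coset_def conormal_class_def poly_ring_def)

lemma carrier_conormal: "carrier (conormal_module F S) = conormal_class ` toric_ideal F S"
  by (simp add: conormal_module_def poly_ring_coset Let_def)

lemma add_conormal:
  "conormal_class f \<oplus>\<^bsub>conormal_module F S\<^esub> conormal_class g = conormal_class (f + g)"
  using coset_add[OF square_ideal_subgroup, where x = f and y = g and H = UNIV]
  by (simp add: Let_def conormal_module_def conormal_class_def set_add_def set_mult_def poly_ring_def)

text \<open>Any polynomial \<open>r'\<close> with the same presentation as \<open>r\<close> gives the same class: \<open>r' - r\<close> lies in the ideal, and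
  its product with \<open>f\<close> in the square of the ideal.\<close>

lemma smult_conormal:
  assumes "r \<in> polynomials" "f \<in> toric_ideal F S"
  shows "presentation r \<odot>\<^bsub>conormal_module F S\<^esub> conormal_class f = conormal_class (r * f)"
proof -
  have "conormal_class (r' * x) = conormal_class (r * f)"
    if r': "r' \<in> polynomials" "presentation r' = presentation r" and x: "x \<in> conormal_class f" for r' x
  proof -
    have 1: "r' * (x - f) \<in> square_ideal F S"
      by (rule square_ideal_mult) (use r' x in \<open>auto simp: conormal_class_def\<close>)
    have "r' - r \<in> toric_ideal F S"
      using r' assms by (simp add: toric_ideal_iff polynomials_closed presentation_diff)
    then have 2: "(r' - r) * f \<in> square_ideal F S" using assms by (intro square_ideal_prod)
    have "r' * x - r * f = r' * (x - f) + (r' - r) * f" by (simp add: algebra_simps)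
    then show ?thesis using square_ideal_add[OF 1 2] by (simp add: conormal_class_eq_iff)
  qed
  moreover have "f \<in> conormal_class f"
    using is_subgroupD(1)[OF square_ideal_subgroup] by (force simp: conormal_class_def)
  moreover have "presentation r \<odot>\<^bsub>conormal_module F S\<^esub> conormal_class f
      = (\<Union>r'\<in>{r'\<in>polynomials. presentation r' = presentation r}. \<Union>x\<in>conormal_class f. conormal_class (r' * x))"
    by (simp add: conormal_module_def poly_ring_coset Let_def) (simp add: poly_ring_def)
  ultimately show ?thesis using assms(1) by blast
qed

lemma presentation_surj:
  assumes "a \<in> carrier (monoid_algebra S)"
  shows "\<exists>r\<in>polynomials. presentation r = (a :: 'm \<Rightarrow>\<^sub>0 'k::field)"
proof -
  have a: "Poly_Mapping.keys a \<subseteq> S" using assms by (simp add: monoid_algebra_def)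
  obtain m where m: "\<And>s. s \<in> S \<Longrightarrow> Poly_Mapping.keys (m s) \<subseteq> F \<and> monomial_degree (m s) = s"
    using mem_imp_monomial_degree by metis
  define r where "r = (\<Sum>s\<in>Poly_Mapping.keys a. Poly_Mapping.single (m s) (Poly_Mapping.lookup a s))"
  have "r \<in> polynomials"
    unfolding r_def by (rule is_subgroup_sum[OF polynomials_subgroup]) (use m a in \<open>auto intro!: single_polynomial\<close>)
  moreover have "presentation r = (\<Sum>s\<in>Poly_Mapping.keys a. Poly_Mapping.single s (Poly_Mapping.lookup a s))"
    unfolding r_def additive_on_sum[OF is_subgroup_UNIV presentation_additive_on UNIV_I] presentation_single
    by (rule sum.cong) (use m a in auto)
  ultimately show ?thesis using poly_mapping_sum_singles[of a] by metis
qed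

lemma presentation_polynomial:
  assumes "r \<in> polynomials" shows "Poly_Mapping.keys (presentation r) \<subseteq> S"
  unfolding presentation_eq_sum[of r]
  by (rule order_trans[OF keys_sum])
     (use assms in \<open>auto simp: polynomials_iff monomial_degree_mem split: if_splits\<close>)

section \<open>The normal module\<close>

lemma keys_mult_subset:
  assumes "Poly_Mapping.keys a \<subseteq> S" "Poly_Mapping.keys b \<subseteq> S" shows "Poly_Mapping.keys (a * b) \<subseteq> S"
proof
  fix t assume "t \<in> Poly_Mapping.keys (a * b)"
  then obtain x y where "x \<in> Poly_Mapping.keys a" "y \<in> Poly_Mapping.keys b" "t = x + y"
    using keys_mult[of a b] by blast
  then show "t \<in> S" using assms add_mem by blast
qed

text \<open>Every scalar in \<open>k[S]\<close> is the presentation of a polynomial, so linearity over \<open>k[S]\<close> is linearity over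
  the polynomial ring.\<close>

lemma normal_iff:
  fixes h :: "(('m \<Rightarrow>\<^sub>0 nat) \<Rightarrow>\<^sub>0 'k::field) set \<Rightarrow> 'm \<Rightarrow>\<^sub>0 'k"
  shows "h \<in> carrier (normal_module F S) \<longleftrightarrow> h \<in> extensional (carrier (conormal_module F S)) \<and>
    (\<forall>f\<in>toric_ideal F S. Poly_Mapping.keys (h (conormal_class f)) \<subseteq> S) \<and>
    (\<forall>f\<in>toric_ideal F S. \<forall>g\<in>toric_ideal F S.
       h (conormal_class (f + g)) = h (conormal_class f) + h (conormal_class g)) \<and>
    (\<forall>r\<in>polynomials. \<forall>f\<in>toric_ideal F S. h (conormal_class (r * f)) = presentation r * h (conormal_class f))"
  (is "_ \<longleftrightarrow> ?ext \<and> ?keys \<and> ?add \<and> ?mult")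
proof -
  have "(\<forall>a\<in>carrier (monoid_algebra S). \<forall>X\<in>carrier (conormal_module F S).
      h (a \<odot>\<^bsub>conormal_module F S\<^esub> X) = a * h X) \<longleftrightarrow> ?mult" (is "?mult' \<longleftrightarrow> _")
  proof
    assume l: ?mult'
    show ?mult
    proof (intro ballI)
      fix r f :: "('m \<Rightarrow>\<^sub>0 nat) \<Rightarrow>\<^sub>0 'k" assume rf: "r \<in> polynomials" "f \<in> toric_ideal F S"
      have "presentation r \<in> carrier (monoid_algebra S)"
        using presentation_polynomial[OF rf(1)] by (simp add: monoid_algebra_def)
      then show "h (conormal_class (r * f)) = presentation r * h (conormal_class f)"
        using l rf by (simp add: carrier_conormal flip: smult_conormal)
    qed
  next
    assume r: ?mult
    show ?mult'
    proof (intro ballI)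
      fix a :: "'m \<Rightarrow>\<^sub>0 'k" and X :: "(('m \<Rightarrow>\<^sub>0 nat) \<Rightarrow>\<^sub>0 'k) set"
      assume a: "a \<in> carrier (monoid_algebra S)" and X: "X \<in> carrier (conormal_module F S)"
      obtain r where "r \<in> polynomials" "presentation r = a" using presentation_surj[OF a] by blast
      moreover obtain f where "f \<in> toric_ideal F S" "X = conormal_class f" using X by (auto simp: carrier_conormal)
      ultimately show "h (a \<odot>\<^bsub>conormal_module F S\<^esub> X) = a * h X" using r by (auto simp: smult_conormal)
    qed
  qed
  then show ?thesis
    by (auto simp: normal_module_def Hom_module_def linear_maps_def hom_def regular_module_def
        carrier_conormal add_conormal monoid_algebra_def Pi_iff)
qed

lemma normal_apply_add: "h \<in> carrier (normal_module F S) \<Longrightarrow> f \<in> toric_ideal F S \<Longrightarrow> g \<in> toric_ideal F S \<Longrightarrow>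
    h (conormal_class (f + g)) = h (conormal_class f) + h (conormal_class g)"
  and normal_apply_mult: "h \<in> carrier (normal_module F S) \<Longrightarrow> r \<in> polynomials \<Longrightarrow> f \<in> toric_ideal F S \<Longrightarrow>
    h (conormal_class (r * f)) = presentation r * h (conormal_class f)"
  and normal_apply_keys: "h \<in> carrier (normal_module F S) \<Longrightarrow> f \<in> toric_ideal F S \<Longrightarrow>
    Poly_Mapping.keys (h (conormal_class f)) \<subseteq> S"
  by (simp_all add: normal_iff)

lemma normal_add: "h \<oplus>\<^bsub>normal_module F S\<^esub> g = (\<lambda>X\<in>carrier (conormal_module F S). h X + g X)"
  and normal_zero: "\<zero>\<^bsub>normal_module F S\<^esub> = (\<lambda>X\<in>carrier (conormal_module F S). 0)"
  and normal_smult: "a \<odot>\<^bsub>normal_module F S\<^esub> h = (\<lambda>X\<in>carrier (conormal_module F S). a * h X)"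
  by (simp_all add: normal_module_def Hom_module_def regular_module_def monoid_algebra_def)

lemma conormal_class_mem: "f \<in> toric_ideal F S \<Longrightarrow> conormal_class f \<in> carrier (conormal_module F S)"
  by (simp add: carrier_conormal)

lemma normal_closed:
  fixes h g :: "(('m \<Rightarrow>\<^sub>0 nat) \<Rightarrow>\<^sub>0 'k::field) set \<Rightarrow> 'm \<Rightarrow>\<^sub>0 'k"
  assumes h: "h \<in> carrier (normal_module F S)"
  shows "g \<in> carrier (normal_module F S) \<Longrightarrow> (\<lambda>X\<in>carrier (conormal_module F S). h X + g X) \<in> carrier (normal_module F S)"
    and "a \<in> carrier (monoid_algebra S) \<Longrightarrow> (\<lambda>X\<in>carrier (conormal_module F S). a * h X) \<in> carrier (normal_module F S)"
proof -
  note I = is_subgroupD(4)[OF toric_ideal_subgroup] toric_ideal_mult conormal_class_mem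
  show "(\<lambda>X\<in>carrier (conormal_module F S). h X + g X) \<in> carrier (normal_module F S)"
    if g: "g \<in> carrier (normal_module F S)"
  proof -
    have "Poly_Mapping.keys (h (conormal_class f) + g (conormal_class f)) \<subseteq> S" if "f \<in> toric_ideal F S" for f
      by (rule order_trans[OF keys_add]) (use h g that in \<open>simp add: normal_iff\<close>)
    then show ?thesis using h g by (auto simp: normal_iff I ring_distribs)
  qed
  show "(\<lambda>X\<in>carrier (conormal_module F S). a * h X) \<in> carrier (normal_module F S)"
    if a: "a \<in> carrier (monoid_algebra S)"
  proof -
    have "Poly_Mapping.keys (a * h (conormal_class f)) \<subseteq> S" if "f \<in> toric_ideal F S" for f
      by (rule keys_mult_subset) (use h a that in \<open>auto simp: normal_iff monoid_algebra_def\<close>)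
    then show ?thesis using h by (auto simp: normal_iff I ring_distribs mult.left_commute)
  qed
qed

lemma scalar_mem: "Poly_Mapping.single 0 c \<in> carrier (monoid_algebra S)"
  by (auto simp: monoid_algebra_def zero_mem split: if_splits)

lemma normal_zero_mem: "\<zero>\<^bsub>normal_module F S\<^esub> \<in> carrier (normal_module F S)"
  by (auto simp: normal_zero normal_iff conormal_class_mem is_subgroupD(4)[OF toric_ideal_subgroup] toric_ideal_mult)

definition normal_minus :: "((('m \<Rightarrow>\<^sub>0 nat) \<Rightarrow>\<^sub>0 'k::field) set \<Rightarrow> 'm \<Rightarrow>\<^sub>0 'k) \<Rightarrow> (('m \<Rightarrow>\<^sub>0 nat) \<Rightarrow>\<^sub>0 'k) set \<Rightarrow> 'm \<Rightarrow>\<^sub>0 'k"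
  where "normal_minus h = (\<lambda>X\<in>carrier (conormal_module F S). - h X)"

lemma normal_minus_mem:
  assumes "h \<in> carrier (normal_module F S)" shows "normal_minus h \<in> carrier (normal_module F S)"
  using normal_closed(2)[OF assms scalar_mem[of "- 1"]]
  by (simp add: normal_minus_def single_uminus)

lemma comm_group_normal: "comm_group (add_monoid (normal_module F S :: ('m \<Rightarrow>\<^sub>0 'k::field, _) module))"
proof (rule comm_groupI)
  fix h :: "(('m \<Rightarrow>\<^sub>0 nat) \<Rightarrow>\<^sub>0 'k) set \<Rightarrow> 'm \<Rightarrow>\<^sub>0 'k"
  assume "h \<in> carrier (add_monoid (normal_module F S))"
  then show "\<exists>g\<in>carrier (add_monoid (normal_module F S)). g \<otimes>\<^bsub>add_monoid (normal_module F S)\<^esub> h = \<one>\<^bsub>add_monoid (normal_module F S)\<^esub>"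
    by (intro bexI[of _ "normal_minus h"]) (auto simp: normal_add normal_zero normal_minus_def intro!: normal_minus_mem[unfolded normal_minus_def])
next
  fix h g :: "(('m \<Rightarrow>\<^sub>0 nat) \<Rightarrow>\<^sub>0 'k) set \<Rightarrow> 'm \<Rightarrow>\<^sub>0 'k"
  assume "h \<in> carrier (add_monoid (normal_module F S))" "g \<in> carrier (add_monoid (normal_module F S))"
  then show "h \<otimes>\<^bsub>add_monoid (normal_module F S)\<^esub> g \<in> carrier (add_monoid (normal_module F S))"
    by (simp add: normal_add normal_closed)
next
  fix h :: "(('m \<Rightarrow>\<^sub>0 nat) \<Rightarrow>\<^sub>0 'k) set \<Rightarrow> 'm \<Rightarrow>\<^sub>0 'k"
  assume "h \<in> carrier (add_monoid (normal_module F S))"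
  then have "h \<in> extensional (carrier (conormal_module F S))" by (simp add: normal_iff)
  then show "\<one>\<^bsub>add_monoid (normal_module F S)\<^esub> \<otimes>\<^bsub>add_monoid (normal_module F S)\<^esub> h = h"
    by (auto simp: normal_add normal_zero extensional_def fun_eq_iff)
qed (auto simp: normal_add normal_zero_mem add.assoc add.commute intro!: restrict_ext)

lemma inv_normal:
  assumes "h \<in> carrier (normal_module F S)"
  shows "inv\<^bsub>add_monoid (normal_module F S)\<^esub> h = normal_minus h"
  by (rule group.inv_equality[OF comm_group.axioms(2)[OF comm_group_normal]])
     (use assms normal_minus_mem in \<open>auto simp: normal_add normal_zero normal_minus_def\<close>)

end

lemma module_isomorphic_trans:
  assumes "module_isomorphic A M N" "module_isomorphic A N P"
  shows "module_isomorphic A M P"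
proof -
  obtain f g where f: "f \<in> linear_maps A M N" "bij_betw f (carrier M) (carrier N)"
    and g: "g \<in> linear_maps A N P" "bij_betw g (carrier N) (carrier P)"
    using assms unfolding module_isomorphic_def by blast
  have "g \<circ> f \<in> linear_maps A M P"
    using f(1) g(1) by (auto simp: linear_maps_def hom_def Pi_iff)
  then show ?thesis
    unfolding module_isomorphic_def using bij_betw_trans[OF f(2) g(2)] by blast
qed

section \<open>Symbols of homomorphisms\<close>

context generating_set
begin

text \<open>The restriction of a logarithmic derivation to the toric ideal; by the Leibniz rule it
  is constant on the cosets of the square of the ideal.\<close>

definition derivation_hom :: "('m \<Rightarrow> 'k::field) \<Rightarrow> 'm \<Rightarrow> (('m \<Rightarrow>\<^sub>0 nat) \<Rightarrow>\<^sub>0 'k) set \<Rightarrow> 'm \<Rightarrow>\<^sub>0 'k"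
  where "derivation_hom c u = (\<lambda>X\<in>carrier (conormal_module F S). the_elem (log_derivation c u ` X))"

lemma derivation_hom_apply:
  fixes f :: "('m \<Rightarrow>\<^sub>0 nat) \<Rightarrow>\<^sub>0 'k::field"
  assumes "f \<in> toric_ideal F S"
  shows "derivation_hom c u (conormal_class f) = log_derivation c u f"
proof -
  have "log_derivation c u ` conormal_class f = {log_derivation c u f}"
    using is_subgroupD(1)[OF square_ideal_subgroup[where 'k = 'k]]
    by (auto simp: conormal_class_def log_derivation_add log_derivation_square image_iff)
  then show ?thesis using assms by (simp add: derivation_hom_def conormal_class_mem)
qed

lemma derivative_hom_eq: "derivative_hom F S w = derivation_hom (\<lambda>v. if v = w then 1 else 0) (- w)"
  by (simp add: derivative_hom_def derivation_hom_def presentation_partial_derivative)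

lemma derivation_hom_mem:
  fixes c :: "'m \<Rightarrow> 'k::field"
  assumes "\<And>f. f \<in> toric_ideal F S \<Longrightarrow> Poly_Mapping.keys (log_derivation c u f) \<subseteq> S"
  shows "derivation_hom c u \<in> carrier (normal_module F S)"
  using assms
  by (auto simp: normal_iff derivation_hom_apply is_subgroupD(4)[OF toric_ideal_subgroup]
      toric_ideal_mult log_derivation_add log_derivation_mult)
     (auto simp: toric_ideal_iff derivation_hom_def)

lemma derivative_hom_mem:
  assumes "w \<in> F" shows "derivative_hom F S w \<in> carrier (normal_module F S :: ('m \<Rightarrow>\<^sub>0 'k::field, _) module)"
  unfolding derivative_hom_eq
proof (rule derivation_hom_mem)
  fix f :: "('m \<Rightarrow>\<^sub>0 nat) \<Rightarrow>\<^sub>0 'k" assume f: "f \<in> toric_ideal F S"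
  have "partial_derivative w f \<in> polynomials"
  proof -
    have "Poly_Mapping.keys (m - Poly_Mapping.single w 1) \<subseteq> Poly_Mapping.keys m" for m :: "'m \<Rightarrow>\<^sub>0 nat"
      by (auto simp: in_keys_iff lookup_minus)
    then show ?thesis
      unfolding partial_derivative_def
      by (intro is_subgroup_sum[OF polynomials_subgroup] single_polynomial) (use f in \<open>auto simp: toric_ideal_iff polynomials_iff\<close>)
  qed
  from presentation_polynomial[OF this]
  show "Poly_Mapping.keys (log_derivation (\<lambda>v. if v = w then 1 else 0) (- w) f) \<subseteq> S"
    by (simp add: presentation_partial_derivative)
qed

definition all_relations :: "('m \<Rightarrow>\<^sub>0 int) set"
  where "all_relations = {q. Poly_Mapping.keys q \<subseteq> F \<and> lin_comb q = 0}"

lemma all_relations_subgroup: "is_subgroup all_relations"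
  unfolding is_subgroup_def all_relations_def
  using keys_diff by (fastforce simp: lin_comb_zero lin_comb_diff)

lemma relations_subset_all: "relations u \<subseteq> all_relations"
  using relations_subset by (auto simp: all_relations_def relations_def E_set_def)

definition relation_binomial :: "('m \<Rightarrow>\<^sub>0 int) \<Rightarrow> (('m \<Rightarrow>\<^sub>0 nat) \<Rightarrow>\<^sub>0 'k::field)"
  where "relation_binomial q = pure_binomial (pos_exponent q) (pos_exponent (- q))"

lemma relation_exponents:
  assumes "q \<in> all_relations"
  shows "Poly_Mapping.keys (pos_exponent q) \<subseteq> F" "Poly_Mapping.keys (pos_exponent (- q)) \<subseteq> F"
    "monomial_degree (pos_exponent (- q)) = monomial_degree (pos_exponent q)"
  using assms keys_pos_exponent[of q] keys_pos_exponent[of "- q"] relation_degree_uminus[of q]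
  by (auto simp: all_relations_def relation_degree_eq)

lemma relation_binomial_mem:
  assumes "q \<in> all_relations" shows "relation_binomial q \<in> toric_ideal F S"
  unfolding relation_binomial_def using relation_exponents[OF assms] by (simp add: pure_binomial_mem)

text \<open>A homomorphism of degree \<open>u\<close> maps the binomial of a relation \<open>q\<close> to a multiple of
  \<open>\<chi>\<^bsup>q' + u\<^esup>\<close>, where \<open>q'\<close> is the degree of \<open>q\<close>, and the symbol is the coefficient. It is defined for
  homomorphisms that need not be homogeneous, because the cosets that make up \<open>T\<^sup>1\<close> contain such
  representatives.\<close>

definition symbol ::
    "'m \<Rightarrow> ((('m \<Rightarrow>\<^sub>0 nat) \<Rightarrow>\<^sub>0 'k::field) set \<Rightarrow> 'm \<Rightarrow>\<^sub>0 'k) \<Rightarrow> ('m \<Rightarrow>\<^sub>0 int) \<Rightarrow> 'k"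
  where "symbol u h q = Poly_Mapping.lookup (h (conormal_class (relation_binomial q))) (relation_degree q + u)"

text \<open>A common monomial factor of \<open>z\<^sup>a\<close> and \<open>z\<^sup>b\<close> multiplies the value of \<open>h\<close> by a power \<open>\<chi>\<^sup>s\<close> and shifts the
  degree by the same \<open>s\<close>.\<close>

lemma symbol_difference:
  fixes h :: "(('m \<Rightarrow>\<^sub>0 nat) \<Rightarrow>\<^sub>0 'k::field) set \<Rightarrow> 'm \<Rightarrow>\<^sub>0 'k"
  assumes h: "h \<in> carrier (normal_module F S)"
    and ab: "Poly_Mapping.keys a \<subseteq> F" "Poly_Mapping.keys b \<subseteq> F" "monomial_degree a = monomial_degree b"
  shows "of_exponent a - of_exponent b \<in> all_relations"
    and "symbol u h (of_exponent a - of_exponent b)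
      = Poly_Mapping.lookup (h (conormal_class (pure_binomial a b))) (monomial_degree a + u)"
proof -
  let ?q = "of_exponent a - of_exponent b"
  have "Poly_Mapping.keys ?q \<subseteq> Poly_Mapping.keys a \<union> Poly_Mapping.keys b"
    using keys_diff[of "of_exponent a" "of_exponent b"] by simp
  then show q: "?q \<in> all_relations"
    using ab by (auto simp: all_relations_def lin_comb_diff lin_comb_of_exponent)
  obtain c where c: "a = c + pos_exponent ?q" "b = c + pos_exponent (- ?q)"
    using exponent_common_part by blast
  have "Poly_Mapping.keys c \<subseteq> F" using ab(1) c(1) keys_add_nat[of c "pos_exponent ?q"] by simp
  then have zc: "Poly_Mapping.single c (1::'k) \<in> polynomials" by (rule single_polynomial)
  have "pure_binomial a b = Poly_Mapping.single c 1 * (relation_binomial ?q :: _ \<Rightarrow>\<^sub>0 'k)"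
    by (subst (1) c(1), subst (1) c(2)) (simp add: pure_binomial_def relation_binomial_def right_diff_distrib mult_single)
  then have "h (conormal_class (pure_binomial a b))
      = Poly_Mapping.single (monomial_degree c) 1 * h (conormal_class (relation_binomial ?q))"
    using normal_apply_mult[OF h zc relation_binomial_mem[OF q]] by (simp add: presentation_single)
  moreover have "monomial_degree a = monomial_degree c + relation_degree ?q"
    unfolding relation_degree_eq using c(1) monomial_degree_add by metis
  ultimately show "symbol u h ?q = Poly_Mapping.lookup (h (conormal_class (pure_binomial a b))) (monomial_degree a + u)"
    by (simp add: symbol_def lookup_mult_group add.assoc)
qed

text \<open>For \<open>a - b = p\<close> and \<open>b - c = q\<close> the binomials satisfy \<open>z\<^sup>a - z\<^sup>c = (z\<^sup>a - z\<^sup>b) + (z\<^sup>b - z\<^sup>c)\<close>; exponents \<open>a\<close>, \<open>b\<close>, \<open>c\<close>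
  with these differences are obtained by combining the parts of \<open>p\<close> and \<open>q\<close>.\<close>

lemma symbol_additive:
  fixes h :: "(('m \<Rightarrow>\<^sub>0 nat) \<Rightarrow>\<^sub>0 'k::field) set \<Rightarrow> 'm \<Rightarrow>\<^sub>0 'k"
  assumes h: "h \<in> carrier (normal_module F S)" shows "additive_on all_relations (symbol u h)"
  unfolding additive_on_def
proof (intro ballI)
  fix p q assume p: "p \<in> all_relations" and q: "q \<in> all_relations"
  define a b c where "a = pos_exponent p + pos_exponent q" and "b = pos_exponent (- p) + pos_exponent q"
    and "c = pos_exponent (- p) + pos_exponent (- q)"
  note ep = relation_exponents[OF p] and eq = relation_exponents[OF q]
  have keys: "Poly_Mapping.keys a \<subseteq> F" "Poly_Mapping.keys b \<subseteq> F" "Poly_Mapping.keys c \<subseteq> F"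
    using ep eq by (auto simp: a_def b_def c_def keys_add_nat)
  have deg: "monomial_degree a = monomial_degree b" "monomial_degree b = monomial_degree c"
    using ep eq by (auto simp: a_def b_def c_def monomial_degree_add)
  have "of_exponent a - of_exponent b = p" "of_exponent b - of_exponent c = q"
    "of_exponent a - of_exponent c = p + q"
    using exponent_difference[of p] exponent_difference[of q]
    by (simp_all add: a_def b_def c_def of_exponent_add algebra_simps)
  then have s: "symbol u h p = Poly_Mapping.lookup (h (conormal_class (pure_binomial a b))) (monomial_degree a + u)"
    "symbol u h q = Poly_Mapping.lookup (h (conormal_class (pure_binomial b c))) (monomial_degree a + u)"
    "symbol u h (p + q) = Poly_Mapping.lookup (h (conormal_class (pure_binomial a c))) (monomial_degree a + u)"
    using symbol_difference(2)[OF h keys(1,2) deg(1)] symbol_difference(2)[OF h keys(2,3) deg(2)]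
      symbol_difference(2)[OF h keys(1,3)] deg by simp_all
  have split: "pure_binomial a c = pure_binomial a b + (pure_binomial b c :: _ \<Rightarrow>\<^sub>0 'k)" by (simp add: pure_binomial_def)
  have "h (conormal_class (pure_binomial a c)) = h (conormal_class (pure_binomial a b)) + h (conormal_class (pure_binomial b c))"
    unfolding split
    by (rule normal_apply_add[OF h pure_binomial_mem[OF keys(1,2) deg(1)] pure_binomial_mem[OF keys(2,3) deg(2)]])
  then show "symbol u h (p + q) = symbol u h p + symbol u h q" by (simp add: s lookup_add)
qed

lemma symbol_obstructed:
  fixes h :: "(('m \<Rightarrow>\<^sub>0 nat) \<Rightarrow>\<^sub>0 'k::field) set \<Rightarrow> 'm \<Rightarrow>\<^sub>0 'k"
  assumes "h \<in> carrier (normal_module F S)" "q \<in> all_relations" "relation_degree q + u \<notin> S"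
  shows "symbol u h q = 0"
  using normal_apply_keys[OF assms(1) relation_binomial_mem[OF assms(2)]] assms(3)
  by (auto simp: symbol_def in_keys_iff subset_iff)

lemma symbol_functional:
  assumes "h \<in> carrier (normal_module F S)"
  shows "restrict (symbol u h) (relations u) \<in> carrier (functionals u :: ('k::field, _) module)"
  using symbol_additive[OF assms, of u] symbol_obstructed[OF assms] relations_subset_all
    is_subgroupD(4)[OF relations_subgroup[of u]]
  by (auto simp: functionals_def additive_on_def subset_iff)

lemma log_derivation_pure_binomial:
  assumes "monomial_degree a = monomial_degree b"
  shows "log_derivation c u (pure_binomial a b) = Poly_Mapping.single (monomial_degree a + u) (pairing c (of_exponent a - of_exponent b))"
  by (simp add: pure_binomial_def log_derivation_diff log_derivation_single assms pairing_diff single_diff)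

lemma symbol_derivation_hom:
  assumes "q \<in> all_relations"
  shows "symbol v (derivation_hom c u) q = (if u = v then pairing c q else 0)"
  using relation_exponents(3)[OF assms]
  by (simp add: symbol_def derivation_hom_apply[OF relation_binomial_mem[OF assms]])
     (simp add: relation_binomial_def log_derivation_pure_binomial exponent_difference relation_degree_eq
        lookup_single when_def)

section \<open>The span of the partial derivatives\<close>

text \<open>The third claim needs a submodule that contains the partial derivatives. The homomorphisms
  whose symbols in one fixed degree vanish do not form one, but those whose symbols vanish on
  \<open>L(F\<^sup>u)\<close> for all \<open>u\<close> do: multiplication by \<open>\<chi>\<^sup>s\<close> turns the symbol of degree \<open>u - s\<close> into that of degree \<open>u\<close>,
  and \<open>F\<^sup>u\<close> is contained in \<open>F\<^bsup>u - s\<^esup>\<close>. The symbol of the partial derivative by \<open>z\<^sub>w\<close> is the coordinate \<open>w\<close> in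
  degree \<open>-w\<close> and zero in all other degrees, and \<open>w\<close> is not in \<open>F\<^bsup>-w\<^esup>\<close> since \<open>0 \<in> S\<close>.\<close>

lemma derivative_submodule_facts:
  defines "D \<equiv> derivative_submodule F S :: ((('m \<Rightarrow>\<^sub>0 nat) \<Rightarrow>\<^sub>0 'k::field) set \<Rightarrow> 'm \<Rightarrow>\<^sub>0 'k) set"
  shows "submodule D (monoid_algebra S) (normal_module F S)"
    and "w \<in> F \<Longrightarrow> derivative_hom F S w \<in> D"
    and "h \<in> D \<Longrightarrow> q \<in> relations u \<Longrightarrow> symbol u h q = 0"
proof -
  let ?N = "normal_module F S :: ('m \<Rightarrow>\<^sub>0 'k, _) module"
  let ?K = "{h\<in>carrier ?N. \<forall>u. \<forall>q\<in>relations u. symbol u h q = 0}"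
  have cl: "conormal_class (relation_binomial q :: _ \<Rightarrow>\<^sub>0 'k) \<in> carrier (conormal_module F S)" if "q \<in> relations u" for q u
    using that relations_subset_all conormal_class_mem relation_binomial_mem by blast
  have K: "submodule ?K (monoid_algebra S) ?N"
  proof (intro submodule.intro subgroup.intro submodule_axioms.intro)
    show "?K \<subseteq> carrier (add_monoid ?N)" by auto
    show "h \<otimes>\<^bsub>add_monoid ?N\<^esub> g \<in> ?K" if "h \<in> ?K" "g \<in> ?K" for h g
      using that normal_closed(1)[of h g] by (auto simp: normal_add symbol_def lookup_add cl)
    show "\<one>\<^bsub>add_monoid ?N\<^esub> \<in> ?K"
    proof -
      have "\<zero>\<^bsub>?N\<^esub> \<in> carrier ?N" by (rule normal_zero_mem)
      then show ?thesis by (auto simp: normal_zero symbol_def cl)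
    qed
    show "inv\<^bsub>add_monoid ?N\<^esub> h \<in> ?K" if "h \<in> ?K" for h
    proof -
      have h: "h \<in> carrier ?N" using that by auto
      show ?thesis unfolding inv_normal[OF h]
        using that normal_minus_mem[OF h] by (auto simp: symbol_def normal_minus_def cl)
    qed
    fix a :: "'m \<Rightarrow>\<^sub>0 'k" and h assume a: "a \<in> carrier (monoid_algebra S)" and hK: "h \<in> ?K"
    have "symbol u (a \<odot>\<^bsub>?N\<^esub> h) q = 0" if q: "q \<in> relations u" for u q
    proof -
      have "Poly_Mapping.lookup (h (conormal_class (relation_binomial q))) (relation_degree q + u - s) = 0"
        if "s \<in> Poly_Mapping.keys a" for s
      proof -
        have s: "s \<in> S" using a that by (auto simp: monoid_algebra_def)
        have "E_set F S u \<subseteq> E_set F S (u - s)"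
        proof
          fix w assume w: "w \<in> E_set F S u"
          have "u + w = (u - s + w) + s" by (simp add: algebra_simps)
          then have "u - s + w \<notin> S" using add_mem[OF _ s, of "u - s + w"] w by (auto simp: E_set_def)
          then show "w \<in> E_set F S (u - s)" using w by (simp add: E_set_def)
        qed
        then have "q \<in> relations (u - s)" using q by (auto simp: relations_def)
        then have "symbol (u - s) h q = 0" using hK by blast
        then show ?thesis by (simp add: symbol_def add_diff_eq)
      qed
      then show ?thesis by (simp add: symbol_def normal_smult cl[OF q] lookup_mult_group)
    qed
    then show "a \<odot>\<^bsub>?N\<^esub> h \<in> ?K" using normal_closed(2)[OF _ a, of h] hK by (simp add: normal_smult)
  qed
  have gens: "derivative_hom F S ` F \<subseteq> ?K"
  proof (intro image_subsetI CollectI conjI allI ballI)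
    fix w u q assume w: "w \<in> F" and q: "q \<in> relations u"
    have "Poly_Mapping.lookup q w = 0" if "- w = u"
    proof -
      have "w \<notin> E_set F S u" using that zero_mem by (auto simp: E_set_def)
      then show ?thesis using q by (auto simp: relations_def in_keys_iff)
    qed
    then show "symbol u (derivative_hom F S w :: _ \<Rightarrow> _ \<Rightarrow>\<^sub>0 'k) q = 0"
      unfolding derivative_hom_eq
      using q relations_subset_all by (subst symbol_derivation_hom) (auto simp: pairing_indicator)
  qed (rule derivative_hom_mem)
  have D: "h \<in> D \<longleftrightarrow> (\<forall>H. submodule H (monoid_algebra S) ?N \<longrightarrow> derivative_hom F S ` F \<subseteq> H \<longrightarrow> h \<in> H)" for h
    unfolding D_def derivative_submodule_def hull_def by blast
  then have memD: "h \<in> D"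
    if "\<And>H. submodule H (monoid_algebra S) ?N \<Longrightarrow> derivative_hom F S ` F \<subseteq> H \<Longrightarrow> D \<subseteq> H \<Longrightarrow> h \<in> H" for h
    using that by (meson subsetI)
  have DK: "D \<subseteq> ?K" using D K gens by blast
  then show "h \<in> D \<Longrightarrow> q \<in> relations u \<Longrightarrow> symbol u h q = 0" by blast
  show "derivative_hom F S w \<in> D" if "w \<in> F" by (rule memD) (use that in blast)
  show "submodule D (monoid_algebra S) ?N"
  proof (intro submodule.intro subgroup.intro submodule_axioms.intro)
    show "D \<subseteq> carrier (add_monoid ?N)" using DK by auto
  next
    fix h g assume "h \<in> D" "g \<in> D"
    then show "h \<otimes>\<^bsub>add_monoid ?N\<^esub> g \<in> D"
      by (intro memD) (rule subgroup.m_closed[OF submodule.axioms(1)]; blast)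
  next
    show "\<one>\<^bsub>add_monoid ?N\<^esub> \<in> D"
      by (intro memD) (rule subgroup.one_closed[OF submodule.axioms(1)])
  next
    fix h assume "h \<in> D"
    then show "inv\<^bsub>add_monoid ?N\<^esub> h \<in> D"
      by (intro memD) (rule subgroup.m_inv_closed[OF submodule.axioms(1)]; blast)
  next
    fix a :: "'m \<Rightarrow>\<^sub>0 'k" and h assume "a \<in> carrier (monoid_algebra S)" "h \<in> D"
    then show "a \<odot>\<^bsub>?N\<^esub> h \<in> D"
      by (intro memD) (rule submodule.smult_closed; blast)
  qed
qed

text \<open>The derivation with coefficients \<open>c\<close> is the combination of the partial derivatives with coefficients
  \<open>c\<^sub>w \<chi>\<^bsup>u + w\<^esup>\<close>, which lie in \<open>k[S]\<close> for \<open>w \<in> W\<close>.\<close>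

lemma derivation_hom_in_derivative_submodule:
  fixes c :: "'m \<Rightarrow> 'k::field"
  assumes "W \<subseteq> {w\<in>F. u + w \<in> S}"
  shows "derivation_hom (\<lambda>v. if v \<in> W then c v else 0) u \<in> derivative_submodule F S"
proof -
  let ?N = "normal_module F S :: ('m \<Rightarrow>\<^sub>0 'k, _) module"
  let ?D = "derivative_submodule F S :: ((('m \<Rightarrow>\<^sub>0 nat) \<Rightarrow>\<^sub>0 'k) set \<Rightarrow> 'm \<Rightarrow>\<^sub>0 'k) set"
  have D: "subgroup ?D (add_monoid ?N)"
    "\<And>a h. a \<in> carrier (monoid_algebra S) \<Longrightarrow> h \<in> ?D \<Longrightarrow> a \<odot>\<^bsub>?N\<^esub> h \<in> ?D"
    by (rule submodule.axioms(1)[OF derivative_submodule_facts(1)])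
       (rule submodule.smult_closed[OF derivative_submodule_facts(1)])
  have ext: "g = derivation_hom d u"
    if "g \<in> extensional (carrier (conormal_module F S))"
      "\<And>f. f \<in> toric_ideal F S \<Longrightarrow> g (conormal_class f) = log_derivation d u f" for g and d :: "'m \<Rightarrow> 'k"
    using that by (intro extensionalityI[of _ "carrier (conormal_module F S)"])
      (auto simp: carrier_conormal derivation_hom_apply, simp add: derivation_hom_def carrier_conormal)
  have "W \<subseteq> F" using assms by blast
  then have "finite W" using finite_generators by (rule finite_subset)
  then show ?thesis using assms
  proof (induction W rule: finite_induct)
    case empty
    have "\<zero>\<^bsub>?N\<^esub> = derivation_hom (\<lambda>v. if v \<in> {} then c v else 0) u"
      by (rule ext) (auto simp: normal_zero conormal_class_mem log_derivation_def pairing_def)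
    then show ?case using subgroup.one_closed[OF D(1)] by simp
  next
    case (insert w W)
    let ?g = "Poly_Mapping.single (u + w) (c w) \<odot>\<^bsub>?N\<^esub> derivative_hom F S w"
    let ?h = "derivation_hom (\<lambda>v. if v \<in> W then c v else 0) u"
    have w: "w \<in> F" "u + w \<in> S" using insert.prems by auto
    have "Poly_Mapping.single (u + w) (c w) \<in> carrier (monoid_algebra S)"
      using w by (simp add: monoid_algebra_def)
    then have "?g \<in> ?D" using D(2) derivative_submodule_facts(2)[OF w(1)] by blast
    moreover have "?h \<in> ?D" using insert by simp
    ultimately have "?h \<oplus>\<^bsub>?N\<^esub> ?g \<in> ?D" using subgroup.m_closed[OF D(1)] by simp
    moreover have "?h \<oplus>\<^bsub>?N\<^esub> ?g = derivation_hom (\<lambda>v. if v \<in> insert w W then c v else 0) u"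
    proof (rule ext)
      fix f :: "('m \<Rightarrow>\<^sub>0 nat) \<Rightarrow>\<^sub>0 'k" assume f: "f \<in> toric_ideal F S"
      have "(\<lambda>v. if v \<in> insert w W then c v else 0)
          = (\<lambda>v. (if v \<in> W then c v else 0) + (if v = w then c w else 0))"
        using insert.hyps(2) by auto
      then show "(?h \<oplus>\<^bsub>?N\<^esub> ?g) (conormal_class f) = log_derivation (\<lambda>v. if v \<in> insert w W then c v else 0) u f"
        using f by (simp only: log_derivation_add_left log_derivation_indicator[of w "c w"])
          (simp add: normal_add normal_smult conormal_class_mem derivative_hom_eq derivation_hom_apply)
    qed (simp add: normal_add)
    ultimately show ?case by simp
  qed
qed

text \<open>Both sides are linear, so it suffices to compare them on binomials; there homogeneity leaves a
  single coefficient, which is the symbol.\<close>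

lemma homogeneous_hom_eq_derivation_hom:
  fixes h :: "(('m \<Rightarrow>\<^sub>0 nat) \<Rightarrow>\<^sub>0 'k::field_char_0) set \<Rightarrow> 'm \<Rightarrow>\<^sub>0 'k"
  assumes h: "h \<in> normal_component F S u" and c: "\<And>q. q \<in> all_relations \<Longrightarrow> symbol u h q = pairing c q"
  shows "h = derivation_hom c u"
proof (rule extensionalityI)
  have hN: "h \<in> carrier (normal_module F S)"
    and hdeg: "\<And>d X. X \<in> conormal_component F S d \<Longrightarrow> Poly_Mapping.keys (h X) \<subseteq> {d + u}"
    using h by (auto simp: normal_component_def)
  show "h \<in> extensional (carrier (conormal_module F S))" using hN by (simp add: normal_iff)
  show "derivation_hom c u \<in> extensional (carrier (conormal_module F S))" by (simp add: derivation_hom_def)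
  have "h (conormal_class f) = log_derivation c u f" if "f \<in> toric_ideal F S" for f
    using that
  proof (induction f rule: toric_ideal_induct)
    case zero
    have "0 \<in> toric_ideal F S" by (rule is_subgroupD(1)[OF toric_ideal_subgroup])
    then have "h (conormal_class (0 + 0)) = h (conormal_class 0) + h (conormal_class 0)"
      by (intro normal_apply_add[OF hN])
    then show ?case by (simp add: log_derivation_zero)
  next
    case (step f a b x)
    note ab = step(2-4)
    have bI: "(pure_binomial a b :: _ \<Rightarrow>\<^sub>0 'k) \<in> toric_ideal F S" by (rule pure_binomial_mem[OF ab])
    have xR: "Poly_Mapping.single 0 x \<in> polynomials" by (simp add: single_polynomial)
    have "\<forall>m\<in>Poly_Mapping.keys (pure_binomial a b :: _ \<Rightarrow>\<^sub>0 'k). monomial_degree m = monomial_degree a"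
      using ab by (auto simp: pure_binomial_def in_keys_iff lookup_minus lookup_single when_def split: if_splits)
    then have "conormal_class (pure_binomial a b :: _ \<Rightarrow>\<^sub>0 'k) \<in> conormal_component F S (monomial_degree a)"
      unfolding conormal_component_def poly_ring_coset
      by (intro CollectI exI[of _ "pure_binomial a b :: _ \<Rightarrow>\<^sub>0 'k"] conjI refl bI)
    from hdeg[OF this] have "h (conormal_class (pure_binomial a b)) =
        Poly_Mapping.single (monomial_degree a + u) (Poly_Mapping.lookup (h (conormal_class (pure_binomial a b))) (monomial_degree a + u))"
      by (intro poly_mapping_eqI) (auto simp: lookup_single when_def in_keys_iff)
    also have "\<dots> = log_derivation c u (pure_binomial a b)"
      using symbol_difference(1)[OF hN ab] symbol_difference(2)[OF hN ab, of u] c by (simp add: log_derivation_pure_binomial ab(3))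
    finally have "h (conormal_class (pure_binomial a b)) = log_derivation c u (pure_binomial a b)" .
    moreover have "h (conormal_class (f + Poly_Mapping.single 0 x * pure_binomial a b))
        = h (conormal_class f) + presentation (Poly_Mapping.single 0 x) * h (conormal_class (pure_binomial a b))"
      by (simp add: normal_apply_add[OF hN step(1) toric_ideal_mult[OF xR bI]] normal_apply_mult[OF hN xR bI])
    moreover have "presentation (pure_binomial a b :: _ \<Rightarrow>\<^sub>0 'k) = 0" using bI by (simp add: toric_ideal_iff)
    ultimately show ?case using step(5) by (simp add: log_derivation_add log_derivation_mult)
  qed
  then show "h X = derivation_hom c u X" if "X \<in> carrier (conormal_module F S)" for X
    using that by (auto simp: carrier_conormal derivation_hom_apply)
qed

text \<open>A relation whose coordinates at the \<open>w\<close> with \<open>u + w \<in> S\<close> vanish lies in \<open>L(F\<^sup>u)\<close>. So the symbol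
  on all relations vanishes wherever these coordinates do, and is a combination of them.\<close>

lemma symbol_zero_imp_derivative:
  fixes h :: "(('m \<Rightarrow>\<^sub>0 nat) \<Rightarrow>\<^sub>0 'k::field_char_0) set \<Rightarrow> 'm \<Rightarrow>\<^sub>0 'k"
  assumes h: "h \<in> normal_component F S u" and zero: "\<And>q. q \<in> relations u \<Longrightarrow> symbol u h q = 0"
  shows "h \<in> derivative_submodule F S"
proof -
  define W where "W = {w\<in>F. u + w \<in> S}"
  have hN: "h \<in> carrier (normal_module F S)" using h by (simp add: normal_component_def)
  have "symbol u h q = 0" if "q \<in> all_relations" "\<forall>w\<in>W. Poly_Mapping.lookup q w = 0" for q
    by (rule zero) (use that in \<open>auto simp: relations_def all_relations_def E_set_def W_def in_keys_iff\<close>)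
  moreover have "finite W" using finite_generators by (simp add: W_def)
  ultimately obtain c where c: "\<And>w. w \<notin> W \<Longrightarrow> c w = 0" "\<And>q. q \<in> all_relations \<Longrightarrow> symbol u h q = pairing c q"
    using additive_eq_pairing[OF _ all_relations_subgroup symbol_additive[OF hN]] by metis
  have "h = derivation_hom c u" by (rule homogeneous_hom_eq_derivation_hom[OF h c(2)])
  moreover have "c = (\<lambda>v. if v \<in> W then c v else 0)" using c(1) by auto
  ultimately show ?thesis using derivation_hom_in_derivative_submodule[of W u c] by (simp add: W_def)
qed

text \<open>Extend \<open>\<psi>\<close> to a linear form \<open>c\<close>. The derivation with coefficients \<open>c\<close> maps \<open>z\<^sup>a - z\<^sup>b\<close> to
  \<open>\<langle>c, a - b\<rangle> \<chi>\<^bsup>deg a + u\<^esup>\<close>. If this exponent is outside \<open>S\<close>, then \<open>a - b\<close> is an obstructed relation,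
  which already lies in \<open>L(F\<^sup>u)\<close>, and the coefficient is \<open>\<psi>(a - b) = 0\<close>.\<close>

lemma symbol_surj:
  fixes \<psi> :: "_ \<Rightarrow> 'k::field_char_0"
  assumes \<psi>: "\<psi> \<in> carrier (functionals u)"
  shows "\<exists>h\<in>normal_component F S u. restrict (symbol u h) (relations u) = \<psi>"
proof -
  have \<psi>: "\<psi> \<in> extensional (relations u)" "additive_on (relations u) \<psi>"
    "\<And>q. q \<in> relations u \<Longrightarrow> relation_degree q + u \<notin> S \<Longrightarrow> \<psi> q = 0"
    using \<psi> by (auto simp: functionals_def)
  obtain c where c: "\<And>q. q \<in> relations u \<Longrightarrow> \<psi> q = pairing c q"
    using additive_extends[OF finite_generators relations_subgroup _ \<psi>(2)] relations_subset by metis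
  have "Poly_Mapping.keys (log_derivation c u f) \<subseteq> S" if "f \<in> toric_ideal F S" for f
    using that
  proof (induction f rule: toric_ideal_induct)
    case zero then show ?case by (simp add: log_derivation_zero)
  next
    case (step f a b x)
    note ab = step(2-4)
    have "(pure_binomial a b :: _ \<Rightarrow>\<^sub>0 'k) \<in> toric_ideal F S" by (rule pure_binomial_mem[OF ab])
    then have "presentation (pure_binomial a b :: _ \<Rightarrow>\<^sub>0 'k) = 0" by (simp add: toric_ideal_iff)
    then have eq: "log_derivation c u (f + Poly_Mapping.single 0 x * pure_binomial a b) = log_derivation c u f +
      Poly_Mapping.single (monomial_degree a + u) (x * pairing c (of_exponent a - of_exponent b))"
      by (simp add: log_derivation_add log_derivation_mult presentation_single log_derivation_pure_binomial[OF ab(3)] mult_single)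
    have "pairing c (of_exponent a - of_exponent b) = 0" if "monomial_degree a + u \<notin> S"
      using obstructed_difference[OF ab that] \<psi>(3) c by metis
    then have "Poly_Mapping.keys (Poly_Mapping.single (monomial_degree a + u) (x * pairing c (of_exponent a - of_exponent b))) \<subseteq> S"
      by auto
    then show ?case unfolding eq using step(5) by (intro order_trans[OF keys_add] Un_least)
  qed
  then have hN: "derivation_hom c u \<in> carrier (normal_module F S)" by (rule derivation_hom_mem)
  have "Poly_Mapping.keys (derivation_hom c u X) \<subseteq> {d + u}" if X: "X \<in> conormal_component F S d" for d X
  proof -
    obtain f where f: "X = conormal_class f" "f \<in> toric_ideal F S" "\<forall>m\<in>Poly_Mapping.keys f. monomial_degree m = d"
      using X unfolding conormal_component_def poly_ring_coset by blast
    have "Poly_Mapping.keys (log_derivation c u f) \<subseteq> {d + u}"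
      unfolding log_derivation_def using f(3)
      by (intro order_trans[OF keys_sum]) (auto split: if_splits)
    then show ?thesis using f by (simp add: derivation_hom_apply)
  qed
  then have "derivation_hom c u \<in> normal_component F S u" using hN by (auto simp: normal_component_def)
  moreover have "restrict (symbol u (derivation_hom c u)) (relations u) = \<psi>"
    using \<psi>(1) c relations_subset_all by (intro extensionalityI[of _ "relations u"]) (auto simp: symbol_derivation_hom subset_iff)
  ultimately show ?thesis by blast
qed

section \<open>The graded components of the first-order deformations\<close>

text \<open>On \<open>L(F\<^sup>u)\<close> the symbol of degree \<open>u\<close> is constant on the cosets of the span \<open>D\<close> of the partial
  derivatives, so it induces a linear map \<open>\<Theta>\<close> on the component of degree \<open>u\<close>. Its kernel is trivial by \<open>symbol_zero_imp_derivative\<close> and it is surjective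
  by \<open>symbol_surj\<close>.\<close>

lemma T1_component_isomorphic:
  "module_isomorphic (ring_on UNIV) (T1_component F S u :: ('k::field_char_0, _) module) (functionals u)"
proof -
  let ?N = "normal_module F S :: ('m \<Rightarrow>\<^sub>0 'k, _) module"
  let ?D = "derivative_submodule F S :: ((('m \<Rightarrow>\<^sub>0 nat) \<Rightarrow>\<^sub>0 'k) set \<Rightarrow> 'm \<Rightarrow>\<^sub>0 'k) set"
  let ?T = "T1_component F S u :: ('k, _) module"
  let ?C = "carrier (conormal_module F S :: ('m \<Rightarrow>\<^sub>0 'k, _) module)"
  interpret N: comm_group "add_monoid ?N" by (rule comm_group_normal)
  have D: "subgroup ?D (add_monoid ?N)" "\<And>a h. a \<in> carrier (monoid_algebra S) \<Longrightarrow> h \<in> ?D \<Longrightarrow> a \<odot>\<^bsub>?N\<^esub> h \<in> ?D"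
    by (rule submodule.axioms(1)[OF derivative_submodule_facts(1)])
       (rule submodule.smult_closed[OF derivative_submodule_facts(1)])
  have DN: "h \<in> carrier ?N" if "h \<in> ?D" for h using subgroup.subset[OF D(1)] that by auto
  have nor: "?D \<lhd> add_monoid ?N" using N.subgroup_imp_normal[OF D(1)] .
  have cl: "conormal_class (relation_binomial q :: _ \<Rightarrow>\<^sub>0 'k) \<in> ?C" if "q \<in> relations u" for q
    using that relations_subset_all conormal_class_mem relation_binomial_mem by blast
  have compN: "h \<in> carrier ?N" if "h \<in> normal_component F S u" for h
    using that by (simp add: normal_component_def)
  have comp_sub: "(\<lambda>X\<in>?C. h X + normal_minus g X) \<in> normal_component F S u"
    if h: "h \<in> normal_component F S u" and g: "g \<in> normal_component F S u" for h g
  proof -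
    have "Poly_Mapping.keys (h X + normal_minus g X) \<subseteq> {d + u}" if X: "X \<in> conormal_component F S d" for X d
    proof -
      have "X \<in> ?C" using X by (auto simp: conormal_component_def carrier_conormal poly_ring_coset)
      then show ?thesis
        using h g X by (intro order_trans[OF keys_add] Un_least) (auto simp: normal_component_def normal_minus_def)
    qed
    moreover have "conormal_component F S d \<subseteq> ?C" for d
      by (auto simp: conormal_component_def carrier_conormal poly_ring_coset)
    ultimately show ?thesis
      using normal_closed(1)[OF compN[OF h] normal_minus_mem[OF compN[OF g]]]
      by (auto simp: normal_component_def subset_iff)
  qed
  define c where "c h = ?D +>\<^bsub>?N\<^esub> h" for h
  have c_mem: "g \<in> c h \<longleftrightarrow> (\<exists>d\<in>?D. g = (\<lambda>X\<in>?C. d X + h X))" for g h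
    by (auto simp: c_def a_r_coset_def r_coset_def normal_add)
  have c_self: "h \<in> c h" if "h \<in> carrier ?N" for h
    using N.rcos_self[OF _ D(1), of h] that by (simp add: c_def a_r_coset_def)
  have c_eq: "c h = c g" if "h \<in> c g" "g \<in> carrier ?N" for h g
    using N.repr_independence[OF _ _ D(1), of h g] that by (simp add: c_def a_r_coset_def)
  have sym_add: "symbol u (\<lambda>X\<in>?C. h X + g X) q = symbol u h q + symbol u g q" if "q \<in> relations u" for h g q
    using cl[OF that] by (simp add: symbol_def lookup_add)
  have sym_scale: "symbol u (\<lambda>X\<in>?C. Poly_Mapping.single 0 a * h X) q = a * symbol u h q" if "q \<in> relations u" for a h q
    using cl[OF that] by (simp add: symbol_def lookup_mult_group)
  define \<Theta> where "\<Theta> X = (\<lambda>q\<in>relations u. symbol u (SOME h. h \<in> X) q)"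
    for X :: "((('m \<Rightarrow>\<^sub>0 nat) \<Rightarrow>\<^sub>0 'k) set \<Rightarrow> 'm \<Rightarrow>\<^sub>0 'k) set"
  have \<Theta>: "\<Theta> (c h) = restrict (symbol u h) (relations u)" if "h \<in> carrier ?N" for h
  proof -
    have "(SOME g. g \<in> c h) \<in> c h" by (rule someI[of "\<lambda>g. g \<in> c h", OF c_self[OF that]])
    then obtain d where "d \<in> ?D" "(SOME g. g \<in> c h) = (\<lambda>X\<in>?C. d X + h X)" unfolding c_mem by blast
    then show ?thesis unfolding \<Theta>_def by (simp add: sym_add derivative_submodule_facts(3) cong: restrict_cong)
  qed
  have carT: "carrier ?T = c ` normal_component F S u"
    by (simp add: T1_component_def c_def)
  have addT: "c h \<oplus>\<^bsub>?T\<^esub> c g = c (\<lambda>X\<in>?C. h X + g X)" if "h \<in> carrier ?N" "g \<in> carrier ?N" for h g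
    using normal.rcos_sum[OF nor, of h g] that
    by (simp add: T1_component_def T1_def quotient_module_def c_def a_r_coset_def set_add_def normal_add)
  have smT: "a \<odot>\<^bsub>?T\<^esub> c h = c (\<lambda>X\<in>?C. Poly_Mapping.single 0 a * h X)" if h: "h \<in> carrier ?N" for a h
  proof -
    let ?s = "\<lambda>g. \<lambda>X\<in>?C. Poly_Mapping.single 0 a * g X"
    have "c (?s g) = c (?s h)" if "g \<in> c h" for g
    proof -
      obtain d where d: "d \<in> ?D" "g = (\<lambda>X\<in>?C. d X + h X)" using \<open>g \<in> c h\<close> unfolding c_mem by blast
      have "?s d \<in> ?D" using D(2)[OF scalar_mem d(1)] by (simp add: normal_smult)
      moreover have "?s g = (\<lambda>X\<in>?C. ?s d X + ?s h X)" by (auto simp: d(2) distrib_left)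
      ultimately have "?s g \<in> c (?s h)" unfolding c_mem by blast
      then show ?thesis by (rule c_eq) (rule normal_closed(2)[OF h scalar_mem])
    qed
    moreover have "a \<odot>\<^bsub>?T\<^esub> c h = (\<Union>g\<in>c h. c (?s g))"
      by (simp add: T1_component_def T1_def quotient_module_def c_def normal_smult)
    ultimately show ?thesis using c_self[OF h] by blast
  qed
  have "\<Theta> \<in> linear_maps (ring_on UNIV) ?T (functionals u)"
    unfolding linear_maps_def hom_def
  proof (intro CollectI conjI ballI)
    show "\<Theta> \<in> carrier (add_monoid ?T) \<rightarrow> carrier (add_monoid (functionals u))"
      using compN by (auto simp: carT \<Theta> symbol_functional)
  next
    fix X Y assume "X \<in> carrier (add_monoid ?T)" "Y \<in> carrier (add_monoid ?T)"
    then obtain h g where "X = c h" "Y = c g" "h \<in> carrier ?N" "g \<in> carrier ?N" using compN by (auto simp: carT)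
    then show "\<Theta> (X \<otimes>\<^bsub>add_monoid ?T\<^esub> Y) = \<Theta> X \<otimes>\<^bsub>add_monoid (functionals u)\<^esub> \<Theta> Y"
      by (auto simp: addT \<Theta> normal_closed functionals_def sym_add)
  next
    fix a :: 'k and X assume "X \<in> carrier ?T"
    then obtain h where "X = c h" "h \<in> carrier ?N" using compN by (auto simp: carT)
    then show "\<Theta> (a \<odot>\<^bsub>?T\<^esub> X) = a \<odot>\<^bsub>functionals u\<^esub> \<Theta> X"
      by (auto simp: smT \<Theta> normal_closed(2)[OF _ scalar_mem] functionals_def sym_scale)
  qed
  moreover have "inj_on \<Theta> (carrier ?T)"
  proof (rule inj_onI)
    fix X Y assume "X \<in> carrier ?T" "Y \<in> carrier ?T" and eq: "\<Theta> X = \<Theta> Y"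
    then obtain h g where h: "X = c h" "h \<in> normal_component F S u" and g: "Y = c g" "g \<in> normal_component F S u"
      by (auto simp: carT)
    let ?d = "\<lambda>X\<in>?C. h X + normal_minus g X"
    have "symbol u ?d q = 0" if q: "q \<in> relations u" for q
    proof -
      have "symbol u h q = symbol u g q"
        using eq q h g compN by (auto simp: \<Theta> dest: fun_cong[of _ _ q])
      then show ?thesis using q cl[OF q] by (simp add: sym_add) (simp add: symbol_def normal_minus_def)
    qed
    then have "?d \<in> ?D" by (rule symbol_zero_imp_derivative[OF comp_sub[OF h(2) g(2)]])
    moreover have "h \<in> extensional ?C" using compN[OF h(2)] by (simp add: normal_iff)
    then have "h = (\<lambda>X\<in>?C. ?d X + g X)"
      by (intro extensionalityI[of _ ?C]) (auto simp: normal_minus_def)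
    ultimately have "h \<in> c g" unfolding c_mem by blast
    then show "X = Y" using c_eq compN[OF g(2)] h g by simp
  qed
  moreover have "\<Theta> ` carrier ?T = carrier (functionals u)"
  proof
    show "\<Theta> ` carrier ?T \<subseteq> carrier (functionals u)" using compN by (auto simp: carT \<Theta> symbol_functional)
    show "carrier (functionals u) \<subseteq> \<Theta> ` carrier ?T"
    proof
      fix \<psi> :: "_ \<Rightarrow> 'k" assume "\<psi> \<in> carrier (functionals u)"
      then obtain h where "h \<in> normal_component F S u" "restrict (symbol u h) (relations u) = \<psi>"
        using symbol_surj by blast
      then show "\<psi> \<in> \<Theta> ` carrier ?T" using compN \<Theta> by (auto simp: carT image_iff)
    qed
  qed
  ultimately show ?thesis unfolding module_isomorphic_def bij_betw_def by blast
qed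

end

theorem theorem1:
  fixes S E G :: "'m::ab_group_add set" and u :: 'm
  assumes "affine_monoid S"
    and "generate additive_group S = UNIV"
    and "finite E" and "monoid_span E = S"
    and "finite G" and "monoid_span G = S"
  shows "module_isomorphic (ring_on UNIV)
    (T1_component G S u :: ('k::field_char_0, _) module)
    (tensor_field (int_dual (relation_quotient E S u)))"
proof -
  interpret E: generating_set E S by unfold_locales fact+
  interpret G: generating_set G S by unfold_locales fact+
  show ?thesis
    by (rule module_isomorphic_trans[OF G.T1_component_isomorphic module_isomorphic_trans[OF
          functionals_independent_of_generators[OF G.generating_set_axioms E.generating_set_axioms]
          E.tensor_dual_isomorphic]])
qed

end
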